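(* Let $(\mathcal D,\Delta,\epsilon)$ be an $R$-coring and let $B\subseteq A$ be an algebra extension by $\mathcal D$. Then $B\subseteq A$ is $\mathcal D$-cleft if and only if it is a $\mathcal D$-Galois extension, i.e. the canonical map $$\mathrm{can}:A\otimes_BA\to A\otimes_R\mathcal D,\qquad a\otimes_Ba'\mapsto a\varrho^A(a')$$ is bijective, and the normal basis property holds, i.e. $B$ is an $R$-subring of $A$ and $A\cong B\otimes_R\mathcal D$ as left $B$-modules and right $\mathcal D$-comodules.
   Context: $k$ is a commutative, associative, unital ring; algebras are associative unital $k$-algebras. For an algebra $R$, an $R$-ring is a monoid in the category of $R$-$R$ bimodules (equivalently an algebra $A$ with an algebra map $\eta:R\to A$), an $R$-coring is a comonoid in that category, and a right comodule of an $R$-coring $\mathcal D$ is a right $R$-module $M$ with a right $R$-linear coassociative counital coaction $M\to M\otimes_R\mathcal D$. An $R$-subring of $A$ is a subalgebra containing $\eta(R)$. Algebra extension by a coring: let $A$ be an $R$-ring with unit map $\eta$, which is also a right $\mathcal D$-comodule via $\varrho^A:A\to A\otimes_R\mathcal D$ (with the same right $R$-action). The coinvariants are $A^{co\mathcal D}=\{b\in A\mid \varrho^A(ba)=b\varrho^A(a)\ \forall a\in A\}$. $B\subseteq A$ is an extension by $\mathcal D$ if $B=A^{co\mathcal D}$. $\mathcal D$-cleft extension: $B\subseteq A$ (with $B=A^{co\mathcal D}$) is $\mathcal D$-cleft if (1) $\mathcal C:=A\otimes_R\mathcal D$ is an $A$-coring, with the left regular $A$-module structure of the first factor, some right $A$-module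 structure, coproduct $A\otimes_R\Delta$ (using $(A\otimes_R\mathcal D)\otimes_A(A\otimes_R\mathcal D)\cong A\otimes_R\mathcal D\otimes_R\mathcal D$) and counit $A\otimes_R\epsilon$. Then $\mathcal C$ is a right $\mathcal D$-comodule via $A\otimes_R\Delta$, written $c\mapsto c_{[0]}\otimes_Rc_{[1]}$, and the coproduct of $\mathcal C$, written $c\mapsto c^{(1)}\otimes_Ac^{(2)}$, is a right $\mathcal D$-comodule map. (2) The right regular $A$-module, with $\varrho^A:A\to A\otimes_R\mathcal D\cong A\otimes_A\mathcal C$, $x\mapsto x^{[0]}\otimes_Ax^{[1]}$, and the left $R$-action given by left multiplication by $\eta$, is a cleft $R$-$\mathcal C$ bicomodule. That is, $A$ is a right $\mathcal C$-comodule via this coaction, which is left $R$-linear, and with $T:=\mathrm{End}^{\mathcal C}(A)$ (right $\mathcal C$-comodule endomorphisms) there exist a left $R$-linear right $\mathcal D$-comodule map $j:\mathcal D\to A$ and a map $\widetilde j:\mathcal C\to\mathrm{Hom}_A(A,A)$ that is left $A$-linear and right $R$-linear (where $(a\varphi r)(x)=a\varphi(rx)$), satisfying $c^{(1)}\,\widetilde j(c^{(2)})(x)=\widetilde j(c)(x^{[0]})\,x^{[1]}$ for all $x\in A$, $c\in\mathcal C$, such that $j(d)^{[0]}\,\widetilde j(j(d)^{[1]})(-)$ equals the element $x\mapsto\epsilon(d)x$ of $T$ for all $d\in\mathcal D$, and $c^{(1)}\,\widetilde j({c^{(2)}}_{[0]})\big(j({c^{(2)}}_{[1]})\big)=c$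 for all $c\in\mathcal C$. *)

theory Defs
  imports "HOL-Algebra.Module" "HOL-Algebra.Subrings" "HOL-Algebra.Free_Abelian_Groups"
begin

section \<open>Algebras, modules and bimodules over noncommutative rings\<close>

text \<open>The locale \<open>algebra\<close> of HOL-Algebra is restricted to commutative algebras and the
  locale \<open>module\<close> to modules over commutative rings, hence the following variants.\<close>

locale assoc_algebra = module + ring M +
  assumes smult_mult_left:
      "\<lbrakk>a \<in> carrier R; x \<in> carrier M; y \<in> carrier M\<rbrakk>
        \<Longrightarrow> a \<odot>\<^bsub>M\<^esub> (x \<otimes>\<^bsub>M\<^esub> y) = (a \<odot>\<^bsub>M\<^esub> x) \<otimes>\<^bsub>M\<^esub> y"
    and smult_mult_right:
      "\<lbrakk>a \<in> carrier R; x \<in> carrier M; y \<in> carrier M\<rbrakk>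
        \<Longrightarrow> a \<odot>\<^bsub>M\<^esub> (x \<otimes>\<^bsub>M\<^esub> y) = x \<otimes>\<^bsub>M\<^esub> (a \<odot>\<^bsub>M\<^esub> y)"

definition algebra_hom ::
    "'k ring \<Rightarrow> ('k, 'r, 'x) module_scheme \<Rightarrow> ('k, 'a, 'y) module_scheme \<Rightarrow> ('r \<Rightarrow> 'a) set"
  where "algebra_hom K R A = {h \<in> ring_hom R A.
    \<forall>c\<in>carrier K. \<forall>r\<in>carrier R. h (c \<odot>\<^bsub>R\<^esub> r) = c \<odot>\<^bsub>A\<^esub> h r}"

text \<open>As in the record \<open>module\<close>, the inherited fields for multiplication and unit are irrelevant.
  The field \<open>smult\<close> is the left action. One-sided notions ignore the other action.\<close>

record ('l, 'm, 's) bimod = "('l, 'm) module" +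
  rsmult :: "['m, 's] \<Rightarrow> 'm" (infixl "\<odot>\<^sub>r\<index>" 70)

locale left_module = L?: ring L + M?: abelian_group M
  for L :: "('l, 'x) ring_scheme" (structure) and M :: "('l, 'm, 'y) module_scheme" (structure) +
  assumes lsmult_closed:
      "\<lbrakk>a \<in> carrier L; x \<in> carrier M\<rbrakk> \<Longrightarrow> a \<odot>\<^bsub>M\<^esub> x \<in> carrier M"
    and lsmult_l_distr:
      "\<lbrakk>a \<in> carrier L; b \<in> carrier L; x \<in> carrier M\<rbrakk>
        \<Longrightarrow> (a \<oplus>\<^bsub>L\<^esub> b) \<odot>\<^bsub>M\<^esub> x = a \<odot>\<^bsub>M\<^esub> x \<oplus>\<^bsub>M\<^esub> b \<odot>\<^bsub>M\<^esub> x"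
    and lsmult_r_distr:
      "\<lbrakk>a \<in> carrier L; x \<in> carrier M; y \<in> carrier M\<rbrakk>
        \<Longrightarrow> a \<odot>\<^bsub>M\<^esub> (x \<oplus>\<^bsub>M\<^esub> y) = a \<odot>\<^bsub>M\<^esub> x \<oplus>\<^bsub>M\<^esub> a \<odot>\<^bsub>M\<^esub> y"
    and lsmult_assoc:
      "\<lbrakk>a \<in> carrier L; b \<in> carrier L; x \<in> carrier M\<rbrakk>
        \<Longrightarrow> (a \<otimes>\<^bsub>L\<^esub> b) \<odot>\<^bsub>M\<^esub> x = a \<odot>\<^bsub>M\<^esub> (b \<odot>\<^bsub>M\<^esub> x)"
    and lsmult_one:
      "x \<in> carrier M \<Longrightarrow> \<one>\<^bsub>L\<^esub> \<odot>\<^bsub>M\<^esub> x = x"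

locale right_module = S?: ring S + M?: abelian_group M
  for S :: "('s, 'x) ring_scheme" (structure) and M :: "('l, 'm, 's, 'y) bimod_scheme" (structure) +
  assumes rsmult_closed:
      "\<lbrakk>x \<in> carrier M; a \<in> carrier S\<rbrakk> \<Longrightarrow> x \<odot>\<^sub>r\<^bsub>M\<^esub> a \<in> carrier M"
    and rsmult_r_distr:
      "\<lbrakk>x \<in> carrier M; a \<in> carrier S; b \<in> carrier S\<rbrakk>
        \<Longrightarrow> x \<odot>\<^sub>r\<^bsub>M\<^esub> (a \<oplus>\<^bsub>S\<^esub> b) = x \<odot>\<^sub>r\<^bsub>M\<^esub> a \<oplus>\<^bsub>M\<^esub> x \<odot>\<^sub>r\<^bsub>M\<^esub> b"
    and rsmult_l_distr:
      "\<lbrakk>x \<in> carrier M; y \<in> carrier M; a \<in> carrier S\<rbrakk>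
        \<Longrightarrow> (x \<oplus>\<^bsub>M\<^esub> y) \<odot>\<^sub>r\<^bsub>M\<^esub> a = x \<odot>\<^sub>r\<^bsub>M\<^esub> a \<oplus>\<^bsub>M\<^esub> y \<odot>\<^sub>r\<^bsub>M\<^esub> a"
    and rsmult_assoc:
      "\<lbrakk>x \<in> carrier M; a \<in> carrier S; b \<in> carrier S\<rbrakk>
        \<Longrightarrow> x \<odot>\<^sub>r\<^bsub>M\<^esub> (a \<otimes>\<^bsub>S\<^esub> b) = (x \<odot>\<^sub>r\<^bsub>M\<^esub> a) \<odot>\<^sub>r\<^bsub>M\<^esub> b"
    and rsmult_one:
      "x \<in> carrier M \<Longrightarrow> x \<odot>\<^sub>r\<^bsub>M\<^esub> \<one>\<^bsub>S\<^esub> = x"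

text \<open>Bimodules of algebras over \<open>K\<close>: the two actions of \<open>K\<close>, via the units of \<open>L\<close> and \<open>S\<close>,
  coincide.\<close>

definition bimodule :: "'k ring \<Rightarrow> ('k, 'l, 'x) module_scheme \<Rightarrow> ('k, 's, 'y) module_scheme
    \<Rightarrow> ('l, 'm, 's, 'z) bimod_scheme \<Rightarrow> bool"
  where "bimodule K L S M \<longleftrightarrow>
    assoc_algebra K L \<and> assoc_algebra K S \<and> left_module L M \<and> right_module S M \<and>
    (\<forall>a\<in>carrier L. \<forall>x\<in>carrier M. \<forall>s\<in>carrier S.
      (a \<odot>\<^bsub>M\<^esub> x) \<odot>\<^sub>r\<^bsub>M\<^esub> s = a \<odot>\<^bsub>M\<^esub> (x \<odot>\<^sub>r\<^bsub>M\<^esub> s)) \<and>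
    (\<forall>c\<in>carrier K. \<forall>x\<in>carrier M.
      (c \<odot>\<^bsub>L\<^esub> \<one>\<^bsub>L\<^esub>) \<odot>\<^bsub>M\<^esub> x = x \<odot>\<^sub>r\<^bsub>M\<^esub> (c \<odot>\<^bsub>S\<^esub> \<one>\<^bsub>S\<^esub>))"

definition left_hom :: "('l, 'x) ring_scheme \<Rightarrow> ('l, 'm, 'y) module_scheme
    \<Rightarrow> ('l, 'n, 'z) module_scheme \<Rightarrow> ('m \<Rightarrow> 'n) set"
  where "left_hom L M N = {f \<in> hom (add_monoid M) (add_monoid N).
    \<forall>a\<in>carrier L. \<forall>x\<in>carrier M. f (a \<odot>\<^bsub>M\<^esub> x) = a \<odot>\<^bsub>N\<^esub> f x}"

definition right_hom :: "('s, 'x) ring_scheme \<Rightarrow> ('l, 'm, 's, 'y) bimod_scheme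
    \<Rightarrow> ('l1, 'n, 's, 'z) bimod_scheme \<Rightarrow> ('m \<Rightarrow> 'n) set"
  where "right_hom S M N = {f \<in> hom (add_monoid M) (add_monoid N).
    \<forall>x\<in>carrier M. \<forall>a\<in>carrier S. f (x \<odot>\<^sub>r\<^bsub>M\<^esub> a) = f x \<odot>\<^sub>r\<^bsub>N\<^esub> a}"

text \<open>The ring \<open>A\<close> as a bimodule, with rings acting by multiplication through \<open>f\<close> on the
  left and \<open>g\<close> on the right.\<close>

definition ring_bimod ::
    "('a, 'x) ring_scheme \<Rightarrow> ('l \<Rightarrow> 'a) \<Rightarrow> ('s \<Rightarrow> 'a) \<Rightarrow> ('l, 'a, 's) bimod"
  where "ring_bimod A f g =
    \<lparr>carrier = carrier A, monoid.mult = monoid.mult A, one = one A, ring.zero = ring.zero A, ring.add = ring.add A,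
     module.smult = (\<lambda>l x. f l \<otimes>\<^bsub>A\<^esub> x), rsmult = (\<lambda>x s. x \<otimes>\<^bsub>A\<^esub> g s)\<rparr>"

text \<open>Replaces the right action of \<open>M\<close> by the action \<open>act\<close> of a possibly different ring.\<close>

definition with_right_action ::
    "('l, 'm, 's) bimod \<Rightarrow> ('m \<Rightarrow> 't \<Rightarrow> 'm) \<Rightarrow> ('l, 'm, 't) bimod"
  where "with_right_action M act =
    \<lparr>carrier = carrier M, monoid.mult = monoid.mult M, one = one M, ring.zero = ring.zero M, ring.add = ring.add M,
     module.smult = module.smult M, rsmult = act\<rparr>"


section \<open>Tensor products over noncommutative rings\<close>

text \<open>\<open>tensor S M N\<close> is the quotient of the free abelian group on pairs by the biadditivity and
  \<open>S\<close>-balancedness relations. It keeps the left action of \<open>M\<close> and the right action of \<open>N\<close>.\<close>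

definition tensor_free :: "('l, 'm, 's) bimod \<Rightarrow> ('s, 'n, 't) bimod \<Rightarrow> ('m \<times> 'n \<Rightarrow>\<^sub>0 int) monoid"
  where "tensor_free M N = free_Abelian_group (carrier M \<times> carrier N)"

definition tensor_rel ::
    "('s, 'x) ring_scheme \<Rightarrow> ('l, 'm, 's) bimod \<Rightarrow> ('s, 'n, 't) bimod \<Rightarrow> ('m \<times> 'n \<Rightarrow>\<^sub>0 int) set"
  where "tensor_rel S M N =
    {frag_of (x \<oplus>\<^bsub>M\<^esub> x', y) - (frag_of (x, y) + frag_of (x', y)) | x x' y.
       x \<in> carrier M \<and> x' \<in> carrier M \<and> y \<in> carrier N} \<union>
    {frag_of (x, y \<oplus>\<^bsub>N\<^esub> y') - (frag_of (x, y) + frag_of (x, y')) | x y y'.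
       x \<in> carrier M \<and> y \<in> carrier N \<and> y' \<in> carrier N} \<union>
    {frag_of (x \<odot>\<^sub>r\<^bsub>M\<^esub> s, y) - frag_of (x, s \<odot>\<^bsub>N\<^esub> y) | x s y.
       x \<in> carrier M \<and> s \<in> carrier S \<and> y \<in> carrier N}"

definition tensor_null ::
    "('s, 'x) ring_scheme \<Rightarrow> ('l, 'm, 's) bimod \<Rightarrow> ('s, 'n, 't) bimod \<Rightarrow> ('m \<times> 'n \<Rightarrow>\<^sub>0 int) set"
  where "tensor_null S M N = generate (tensor_free M N) (tensor_rel S M N)"

definition tensor_class :: "('s, 'x) ring_scheme \<Rightarrow> ('l, 'm, 's) bimod \<Rightarrow> ('s, 'n, 't) bimod
    \<Rightarrow> ('m \<times> 'n \<Rightarrow>\<^sub>0 int) \<Rightarrow> ('m \<times> 'n \<Rightarrow>\<^sub>0 int) set"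
  where "tensor_class S M N z = tensor_null S M N #>\<^bsub>tensor_free M N\<^esub> z"

definition tensor :: "('s, 'x) ring_scheme \<Rightarrow> ('l, 'm, 's) bimod \<Rightarrow> ('s, 'n, 't) bimod
    \<Rightarrow> ('l, ('m \<times> 'n \<Rightarrow>\<^sub>0 int) set, 't) bimod"
  where "tensor S M N =
   (let Q = tensor_free M N Mod tensor_null S M N in
    \<lparr>carrier = carrier Q, monoid.mult = undefined, one = undefined,
     ring.zero = one Q, ring.add = monoid.mult Q,
     module.smult = (\<lambda>l X. \<Union>z\<in>X.
       tensor_class S M N (frag_extend (\<lambda>(x, y). frag_of (l \<odot>\<^bsub>M\<^esub> x, y)) z)),
     rsmult = (\<lambda>X t. \<Union>z\<in>X.
       tensor_class S M N (frag_extend (\<lambda>(x, y). frag_of (x, y \<odot>\<^sub>r\<^bsub>N\<^esub> t)) z))\<rparr>)"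

definition tens :: "('s, 'x) ring_scheme \<Rightarrow> ('l, 'm, 's) bimod \<Rightarrow> ('s, 'n, 't) bimod
    \<Rightarrow> 'm \<Rightarrow> 'n \<Rightarrow> ('m \<times> 'n \<Rightarrow>\<^sub>0 int) set"
  where "tens S M N x y = tensor_class S M N (frag_of (x, y))"

definition balanced :: "('s, 'x) ring_scheme \<Rightarrow> ('l, 'm, 's) bimod \<Rightarrow> ('s, 'n, 't) bimod
    \<Rightarrow> ('g, 'z) ring_scheme \<Rightarrow> ('m \<Rightarrow> 'n \<Rightarrow> 'g) \<Rightarrow> bool"
  where "balanced S M N G f \<longleftrightarrow>
    (\<forall>x\<in>carrier M. \<forall>y\<in>carrier N. f x y \<in> carrier G) \<and>
    (\<forall>x\<in>carrier M. \<forall>x'\<in>carrier M. \<forall>y\<in>carrier N. f (x \<oplus>\<^bsub>M\<^esub> x') y = f x y \<oplus>\<^bsub>G\<^esub> f x' y) \<and>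
    (\<forall>x\<in>carrier M. \<forall>y\<in>carrier N. \<forall>y'\<in>carrier N. f x (y \<oplus>\<^bsub>N\<^esub> y') = f x y \<oplus>\<^bsub>G\<^esub> f x y') \<and>
    (\<forall>x\<in>carrier M. \<forall>s\<in>carrier S. \<forall>y\<in>carrier N. f (x \<odot>\<^sub>r\<^bsub>M\<^esub> s) y = f x (s \<odot>\<^bsub>N\<^esub> y))"

text \<open>The additive map on \<open>tensor S M N\<close> induced by a balanced map \<open>f\<close>. Expressions in
  Sweedler notation are values of such maps. The description is meaningful only if \<open>f\<close> is
  \<open>balanced\<close>, see \<open>tensor_lift_ex1\<close> below.\<close>

definition tensor_lift :: "('s, 'x) ring_scheme \<Rightarrow> ('l, 'm, 's) bimod \<Rightarrow> ('s, 'n, 't) bimod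
    \<Rightarrow> ('g, 'z) ring_scheme \<Rightarrow> ('m \<Rightarrow> 'n \<Rightarrow> 'g) \<Rightarrow> ('m \<times> 'n \<Rightarrow>\<^sub>0 int) set \<Rightarrow> 'g"
  where "tensor_lift S M N G f =
    (THE h. h \<in> extensional (carrier (tensor S M N)) \<and>
            h \<in> hom (add_monoid (tensor S M N)) (add_monoid G) \<and>
            (\<forall>x\<in>carrier M. \<forall>y\<in>carrier N. h (tens S M N x y) = f x y))"

lemma tensor_simps:
  "carrier (tensor S M N) = carrier (tensor_free M N Mod tensor_null S M N)"
  "\<zero>\<^bsub>tensor S M N\<^esub> = \<one>\<^bsub>tensor_free M N Mod tensor_null S M N\<^esub>"
  "ring.add (tensor S M N) = monoid.mult (tensor_free M N Mod tensor_null S M N)"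
  by (simp_all add: tensor_def Let_def)

context
  fixes S :: "('s, 'x) ring_scheme" and M :: "('l, 'm, 's) bimod" and N :: "('s, 'n, 't) bimod"
  assumes M: "right_module S M" and N: "left_module S N"
begin

interpretation M: right_module S M by (rule M)
interpretation N: left_module S N by (rule N)

interpretation F: comm_group "tensor_free M N"
  by (simp add: tensor_free_def abelian_free_Abelian_group)

lemma tensor_rel_subset: "tensor_rel S M N \<subseteq> carrier (tensor_free M N)"
proof -
  have "frag_of (x \<oplus>\<^bsub>M\<^esub> x', y) - (frag_of (x, y) + frag_of (x', y)) \<in> carrier (tensor_free M N)"
    if "x \<in> carrier M" "x' \<in> carrier M" "y \<in> carrier N" for x x' y
    unfolding tensor_free_def carrier_free_Abelian_group_iff
    by (rule order_trans[OF keys_diff]) (use that keys_add[of "frag_of (x, y)" "frag_of (x', y)"] in auto)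
  moreover have "frag_of (x, y \<oplus>\<^bsub>N\<^esub> y') - (frag_of (x, y) + frag_of (x, y')) \<in> carrier (tensor_free M N)"
    if "x \<in> carrier M" "y \<in> carrier N" "y' \<in> carrier N" for x y y'
    unfolding tensor_free_def carrier_free_Abelian_group_iff
    by (rule order_trans[OF keys_diff]) (use that keys_add[of "frag_of (x, y)" "frag_of (x, y')"] in auto)
  moreover have "frag_of (x \<odot>\<^sub>r\<^bsub>M\<^esub> s, y) - frag_of (x, s \<odot>\<^bsub>N\<^esub> y) \<in> carrier (tensor_free M N)"
    if "x \<in> carrier M" "s \<in> carrier S" "y \<in> carrier N" for x s y
    unfolding tensor_free_def carrier_free_Abelian_group_iff
    by (rule order_trans[OF keys_diff])
      (use that M.rsmult_closed N.lsmult_closed in auto)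
  ultimately show ?thesis
    unfolding tensor_rel_def
    by (intro Un_least subsetI; elim CollectE exE conjE; simp only:)
qed

lemma tensor_null_subgroup: "subgroup (tensor_null S M N) (tensor_free M N)"
  unfolding tensor_null_def by (rule F.generate_is_subgroup[OF tensor_rel_subset])

lemma tensor_abelian_group: "abelian_group (tensor S M N)"
proof -
  interpret Q: comm_group "tensor_free M N Mod tensor_null S M N"
    by (rule F.abelian_FactGroup[OF tensor_null_subgroup])
  show ?thesis
    by (rule abelian_groupI, unfold tensor_simps)
      (use Q.m_assoc Q.m_comm Q.l_inv_ex in \<open>auto simp del: one_FactGroup mult_FactGroup\<close>)
qed

lemma tens_closed:
  "\<lbrakk>x \<in> carrier M; y \<in> carrier N\<rbrakk> \<Longrightarrow> tens S M N x y \<in> carrier (tensor S M N)"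
  by (simp add: tens_def tensor_class_def tensor_simps carrier_FactGroup tensor_free_def)

lemma tensor_lift_ex1:
  fixes G :: "('g, 'z) ring_scheme"
  assumes G: "abelian_group G" and f: "balanced S M N G f"
  shows "\<exists>!h. h \<in> extensional (carrier (tensor S M N)) \<and>
            h \<in> hom (add_monoid (tensor S M N)) (add_monoid G) \<and>
            (\<forall>x\<in>carrier M. \<forall>y\<in>carrier N. h (tens S M N x y) = f x y)"
    (is "\<exists>!h. ?P h")
proof -
  interpret G: abelian_group G by (rule G)
  have Ga: "group (add_monoid G)" by (rule comm_group.axioms(2)[OF G.a_comm_group])
  let ?F = "tensor_free M N" and ?H = "tensor_null S M N"
  have normal: "?H \<lhd> ?F"
    using F.normal_iff_subgroup tensor_null_subgroup by blast
  have fin: "case_prod f ` (carrier M \<times> carrier N) \<subseteq> carrier (add_monoid G)"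
    using f by (auto simp: balanced_def)
  obtain k where k: "k \<in> hom ?F (add_monoid G)"
    and kf: "\<And>p. p \<in> carrier M \<times> carrier N \<Longrightarrow> k (frag_of p) = case_prod f p"
    using comm_group.free_Abelian_group_universal[OF G.a_comm_group fin] unfolding tensor_free_def by metis
  interpret k: group_hom ?F "add_monoid G" k
    using k by (simp add: group_hom_def group_hom_axioms_def F.is_group Ga)
  have mult: "a \<otimes>\<^bsub>?F\<^esub> b = a + b" for a b by (simp add: tensor_free_def)
  have frag_in: "frag_of p \<in> carrier ?F \<longleftrightarrow> p \<in> carrier M \<times> carrier N" for p
    unfolding tensor_free_def by (rule frag_of_in_free_Abelian_group)
  have k_add: "k (a + b) = k a \<oplus>\<^bsub>G\<^esub> k b" if "a \<in> carrier ?F" "b \<in> carrier ?F" for a b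
    using k.hom_mult[OF that] by (simp add: mult)
  have k_rel: "k (a - b) = \<zero>\<^bsub>G\<^esub>"
    if "a \<in> carrier ?F" "b \<in> carrier ?F" "k a = k b" for a b
  proof -
    have ab: "a - b \<in> carrier ?F"
      using that keys_diff[of a b] by (auto simp: tensor_free_def)
    have "k a = k (a - b) \<oplus>\<^bsub>G\<^esub> k b"
      using k_add[OF ab that(2)] by simp
    moreover have "k (a - b) \<in> carrier G" "k b \<in> carrier G"
      using k.hom_closed[OF ab] k.hom_closed[OF that(2)] by simp_all
    ultimately show ?thesis
      using that(3) G.add.l_cancel_one' G.add.r_cancel_one' by simp
  qed
  have add_in: "a + b \<in> carrier ?F" if "a \<in> carrier ?F" "b \<in> carrier ?F" for a b
    using F.m_closed[OF that] by (simp add: mult)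
  have rel_ker: "tensor_rel S M N \<subseteq> kernel ?F (add_monoid G) k"
  proof
    fix z assume z: "z \<in> tensor_rel S M N"
    then have "k z = \<zero>\<^bsub>G\<^esub>"
      unfolding tensor_rel_def
    proof (elim UnE CollectE exE conjE)
      fix x x' y assume *: "z = frag_of (x \<oplus>\<^bsub>M\<^esub> x', y) - (frag_of (x, y) + frag_of (x', y))"
        "x \<in> carrier M" "x' \<in> carrier M" "y \<in> carrier N"
      show ?thesis unfolding *(1)
        by (rule k_rel) (use * f in \<open>auto simp: frag_in add_in k_add kf balanced_def\<close>)
    next
      fix x y y' assume *: "z = frag_of (x, y \<oplus>\<^bsub>N\<^esub> y') - (frag_of (x, y) + frag_of (x, y'))"
        "x \<in> carrier M" "y \<in> carrier N" "y' \<in> carrier N"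
      show ?thesis unfolding *(1)
        by (rule k_rel) (use * f in \<open>auto simp: frag_in add_in k_add kf balanced_def\<close>)
    next
      fix x s y assume *: "z = frag_of (x \<odot>\<^sub>r\<^bsub>M\<^esub> s, y) - frag_of (x, s \<odot>\<^bsub>N\<^esub> y)"
        "x \<in> carrier M" "s \<in> carrier S" "y \<in> carrier N"
      show ?thesis unfolding *(1)
        by (rule k_rel) (use * f M.rsmult_closed N.lsmult_closed in
            \<open>auto simp: frag_in kf balanced_def\<close>)
    qed
    then show "z \<in> kernel ?F (add_monoid G) k"
      using z tensor_rel_subset by (auto simp: kernel_def)
  qed
  have null_ker: "?H \<subseteq> kernel ?F (add_monoid G) k"
    unfolding tensor_null_def
    by (rule F.generate_subgroup_incl[OF rel_ker k.subgroup_kernel])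
  obtain g where g: "g \<in> hom (?F Mod ?H) (add_monoid G)"
    and gk: "\<And>z. z \<in> carrier ?F \<Longrightarrow> g (?H #>\<^bsub>?F\<^esub> z) = k z"
    using k.FactGroup_universal_kernel[OF normal null_ker] by metis
  have homT: "hom (add_monoid (tensor S M N)) (add_monoid G) = hom (?F Mod ?H) (add_monoid G)"
    by (simp add: hom_def tensor_simps)
  have carT: "carrier (tensor S M N) = (\<lambda>z. ?H #>\<^bsub>?F\<^esub> z) ` carrier ?F"
    by (simp add: tensor_simps carrier_FactGroup)
  let ?g = "restrict g (carrier (tensor S M N))"
  interpret Q: group "?F Mod ?H" by (rule normal.factorgroup_is_group[OF normal])
  have "?P ?g"
  proof (intro conjI ballI)
    show "?g \<in> hom (add_monoid (tensor S M N)) (add_monoid G)"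
      unfolding homT using Q.hom_restrict[OF g, of ?g] by (simp add: tensor_simps)
    fix x y assume xy: "x \<in> carrier M" "y \<in> carrier N"
    then show "?g (tens S M N x y) = f x y"
      using tens_closed[OF xy] gk[of "frag_of (x, y)"] kf[of "(x, y)"] frag_in[of "(x, y)"]
      by (simp add: tens_def tensor_class_def)
  qed simp
  moreover have "h = h'" if h: "?P h" and h': "?P h'" for h h'
  proof -
    have ev: "h (?H #>\<^bsub>?F\<^esub> z) = h' (?H #>\<^bsub>?F\<^esub> z)" if z: "z \<in> carrier ?F" for z
    proof -
      have "group_hom (?F Mod ?H) (add_monoid G) h" "group_hom (?F Mod ?H) (add_monoid G) h'"
        using h h' homT by (simp_all add: group_hom_def group_hom_axioms_def Q.is_group Ga)
      then interpret h: group_hom "?F Mod ?H" "add_monoid G" h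
        + h': group_hom "?F Mod ?H" "add_monoid G" h' .
      have hm: "(\<lambda>a. ?H #>\<^bsub>?F\<^esub> a) \<in> hom ?F (?F Mod ?H)"
        by (rule normal.r_coset_hom_Mod[OF normal])
      interpret c: group_hom ?F "?F Mod ?H" "\<lambda>a. ?H #>\<^bsub>?F\<^esub> a"
        using hm by (simp add: group_hom_def group_hom_axioms_def F.is_group Q.is_group)
      have "Poly_Mapping.keys z \<subseteq> carrier M \<times> carrier N"
        using z by (simp add: tensor_free_def)
      then show ?thesis
      proof (induction rule: free_Abelian_group_induct[consumes 1])
        case 1
        have "?H #>\<^bsub>?F\<^esub> 0 = \<one>\<^bsub>?F Mod ?H\<^esub>"
          using c.hom_one by (simp add: tensor_free_def)
        then show ?case by (simp add: h.hom_one h'.hom_one del: one_FactGroup)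
      next
        case (2 x y)
        then have xy: "x \<in> carrier ?F" "y \<in> carrier ?F" by (simp_all add: tensor_free_def)
        have inv: "x - y = x \<otimes>\<^bsub>?F\<^esub> inv\<^bsub>?F\<^esub> y"
          using 2 by (simp add: tensor_free_def)
        have "?H #>\<^bsub>?F\<^esub> (x - y) = (?H #>\<^bsub>?F\<^esub> x) \<otimes>\<^bsub>?F Mod ?H\<^esub> inv\<^bsub>?F Mod ?H\<^esub> (?H #>\<^bsub>?F\<^esub> y)"
          unfolding inv using xy by (simp only: c.hom_mult c.hom_inv F.inv_closed)
        then show ?case
          using xy 2(3,4) by (simp only: h.hom_mult h.hom_inv h'.hom_mult h'.hom_inv
              c.hom_closed Q.inv_closed)
      next
        case (3 p)
        then show ?case
          using h h' by (cases p) (simp add: tens_def tensor_class_def)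
      qed
    qed
    show ?thesis
      by (rule extensionalityI[of _ "carrier (tensor S M N)"]) (use h h' ev carT in auto)
  qed
  ultimately show ?thesis by blast
qed

end

definition tensor_map :: "('s, 'x) ring_scheme \<Rightarrow> ('l, 'm, 's) bimod \<Rightarrow> ('s, 'n, 't) bimod
    \<Rightarrow> ('l1, 'm1, 's) bimod \<Rightarrow> ('s, 'n1, 't1) bimod \<Rightarrow> ('m \<Rightarrow> 'm1) \<Rightarrow> ('n \<Rightarrow> 'n1)
    \<Rightarrow> ('m \<times> 'n \<Rightarrow>\<^sub>0 int) set \<Rightarrow> ('m1 \<times> 'n1 \<Rightarrow>\<^sub>0 int) set"
  where "tensor_map S M N M' N' f g =
    tensor_lift S M N (tensor S M' N') (\<lambda>x y. tens S M' N' (f x) (g y))"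

text \<open>The associativity isomorphism sending $(x \otimes y) \otimes z$ to $x \otimes (y \otimes z)$.\<close>

definition tensor_assoc :: "('s, 'x) ring_scheme \<Rightarrow> ('t, 'y) ring_scheme \<Rightarrow> ('l, 'm, 's) bimod
    \<Rightarrow> ('s, 'n, 't) bimod \<Rightarrow> ('t, 'p, 'u) bimod
    \<Rightarrow> (('m \<times> 'n \<Rightarrow>\<^sub>0 int) set \<times> 'p \<Rightarrow>\<^sub>0 int) set \<Rightarrow> ('m \<times> ('n \<times> 'p \<Rightarrow>\<^sub>0 int) set \<Rightarrow>\<^sub>0 int) set"
  where "tensor_assoc S T M N P =
    (let G = tensor S M (tensor T N P) in
     tensor_lift T (tensor S M N) P G
       (\<lambda>w z. tensor_lift S M N G (\<lambda>x y. tens S M (tensor T N P) x (tens T N P y z)) w))"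


section \<open>Corings and comodules\<close>

definition coring :: "'k ring \<Rightarrow> ('k, 's, 'x) module_scheme \<Rightarrow> ('s, 'c, 's) bimod
    \<Rightarrow> ('c \<Rightarrow> ('c \<times> 'c \<Rightarrow>\<^sub>0 int) set) \<Rightarrow> ('c \<Rightarrow> 's) \<Rightarrow> bool"
  where "coring K S C \<Delta> \<epsilon> \<longleftrightarrow>
    bimodule K S S C \<and>
    \<Delta> \<in> left_hom S C (tensor S C C) \<inter> right_hom S C (tensor S C C) \<and>
    \<epsilon> \<in> left_hom S C (ring_bimod S id id) \<inter> right_hom S C (ring_bimod S id id) \<and>
    (\<forall>c\<in>carrier C.
      tensor_assoc S S C C C (tensor_map S C C (tensor S C C) C \<Delta> id (\<Delta> c)) =
        tensor_map S C C C (tensor S C C) id \<Delta> (\<Delta> c) \<and>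
      tensor_lift S C C C (\<lambda>c1 c2. \<epsilon> c1 \<odot>\<^bsub>C\<^esub> c2) (\<Delta> c) = c \<and>
      tensor_lift S C C C (\<lambda>c1 c2. c1 \<odot>\<^sub>r\<^bsub>C\<^esub> \<epsilon> c2) (\<Delta> c) = c)"

text \<open>Right comodules. The left action stored in \<open>M\<close> plays no role.\<close>

definition comodule :: "('s, 'x) ring_scheme \<Rightarrow> ('s, 'c, 's) bimod
    \<Rightarrow> ('c \<Rightarrow> ('c \<times> 'c \<Rightarrow>\<^sub>0 int) set) \<Rightarrow> ('c \<Rightarrow> 's)
    \<Rightarrow> ('l, 'm, 's) bimod \<Rightarrow> ('m \<Rightarrow> ('m \<times> 'c \<Rightarrow>\<^sub>0 int) set) \<Rightarrow> bool"
  where "comodule S C \<Delta> \<epsilon> M \<rho> \<longleftrightarrow>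
    right_module S M \<and>
    \<rho> \<in> right_hom S M (tensor S M C) \<and>
    (\<forall>x\<in>carrier M.
      tensor_assoc S S M C C (tensor_map S M C (tensor S M C) C \<rho> id (\<rho> x)) =
        tensor_map S M C M (tensor S C C) id \<Delta> (\<rho> x) \<and>
      tensor_lift S M C M (\<lambda>y c. y \<odot>\<^sub>r\<^bsub>M\<^esub> \<epsilon> c) (\<rho> x) = x)"

definition comodule_hom :: "('s, 'x) ring_scheme \<Rightarrow> ('s, 'c, 's) bimod
    \<Rightarrow> ('l, 'm, 's) bimod \<Rightarrow> ('m \<Rightarrow> ('m \<times> 'c \<Rightarrow>\<^sub>0 int) set)
    \<Rightarrow> ('l1, 'n, 's) bimod \<Rightarrow> ('n \<Rightarrow> ('n \<times> 'c \<Rightarrow>\<^sub>0 int) set) \<Rightarrow> ('m \<Rightarrow> 'n) set"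
  where "comodule_hom S C M \<rho> N \<sigma> = {f \<in> right_hom S M N.
    \<forall>x\<in>carrier M. \<sigma> (f x) = tensor_map S M C N C f id (\<rho> x)}"

text \<open>The coaction $X \otimes \Delta$ on $X \otimes_R D$, with values in
  $(X \otimes_R D) \otimes_R D$.\<close>

definition tensor_coaction :: "('r, 'x) ring_scheme \<Rightarrow> ('l, 'm, 'r) bimod \<Rightarrow> ('r, 'd, 'r) bimod
    \<Rightarrow> ('d \<Rightarrow> ('d \<times> 'd \<Rightarrow>\<^sub>0 int) set)
    \<Rightarrow> ('m \<times> 'd \<Rightarrow>\<^sub>0 int) set \<Rightarrow> (('m \<times> 'd \<Rightarrow>\<^sub>0 int) set \<times> 'd \<Rightarrow>\<^sub>0 int) set"
  where "tensor_coaction R X D \<Delta> =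
    (let Y = tensor R X D; Z = tensor R Y D in
     tensor_lift R X D Z
       (\<lambda>x d. tensor_lift R D D Z (\<lambda>d1 d2. tens R Y D (tens R X D x d1) d2) (\<Delta> d)))"


section \<open>Extensions of algebras by a coring\<close>

definition ring_over :: "'k ring \<Rightarrow> ('k, 'r) module \<Rightarrow> ('k, 'a) module \<Rightarrow> ('r \<Rightarrow> 'a) \<Rightarrow> bool"
  where "ring_over K R A \<eta> \<longleftrightarrow>
    assoc_algebra K R \<and> assoc_algebra K A \<and> \<eta> \<in> algebra_hom K R A"

definition subring_over ::
    "'k ring \<Rightarrow> ('k, 'r) module \<Rightarrow> ('k, 'a) module \<Rightarrow> ('r \<Rightarrow> 'a) \<Rightarrow> 'a set \<Rightarrow> bool"
  where "subring_over K R A \<eta> B \<longleftrightarrow>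
    subring B A \<and> (\<forall>c\<in>carrier K. \<forall>b\<in>B. c \<odot>\<^bsub>A\<^esub> b \<in> B) \<and> \<eta> ` carrier R \<subseteq> B"

text \<open>The $A$-$R$ bimodule $A \otimes_R D$.\<close>

definition tensor_AD :: "('k, 'r) module \<Rightarrow> ('k, 'a) module \<Rightarrow> ('r \<Rightarrow> 'a) \<Rightarrow> ('r, 'd, 'r) bimod
    \<Rightarrow> ('a, ('a \<times> 'd \<Rightarrow>\<^sub>0 int) set, 'r) bimod"
  where "tensor_AD R A \<eta> D = tensor R (ring_bimod A id \<eta>) D"

definition coinvariants :: "('k, 'r) module \<Rightarrow> ('k, 'a) module \<Rightarrow> ('r \<Rightarrow> 'a)
    \<Rightarrow> ('r, 'd, 'r) bimod \<Rightarrow> ('a \<Rightarrow> ('a \<times> 'd \<Rightarrow>\<^sub>0 int) set) \<Rightarrow> 'a set"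
  where "coinvariants R A \<eta> D \<rho> =
    {b \<in> carrier A. \<forall>a\<in>carrier A. \<rho> (b \<otimes>\<^bsub>A\<^esub> a) = b \<odot>\<^bsub>tensor_AD R A \<eta> D\<^esub> \<rho> a}"

definition coring_extension :: "'k ring \<Rightarrow> ('k, 'r) module \<Rightarrow> ('k, 'a) module \<Rightarrow> ('r \<Rightarrow> 'a)
    \<Rightarrow> ('r, 'd, 'r) bimod \<Rightarrow> ('d \<Rightarrow> ('d \<times> 'd \<Rightarrow>\<^sub>0 int) set) \<Rightarrow> ('d \<Rightarrow> 'r)
    \<Rightarrow> ('a \<Rightarrow> ('a \<times> 'd \<Rightarrow>\<^sub>0 int) set) \<Rightarrow> 'a set \<Rightarrow> bool"
  where "coring_extension K R A \<eta> D \<Delta> \<epsilon> \<rho> B \<longleftrightarrow>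
    ring_over K R A \<eta> \<and>
    comodule R D \<Delta> \<epsilon> (ring_bimod A id \<eta>) \<rho> \<and>
    B = coinvariants R A \<eta> D \<rho>"

subsection \<open>Galois extensions and the normal basis property\<close>

definition canonical_map :: "('k, 'r) module \<Rightarrow> ('k, 'a) module \<Rightarrow> ('r \<Rightarrow> 'a)
    \<Rightarrow> ('r, 'd, 'r) bimod \<Rightarrow> ('a \<Rightarrow> ('a \<times> 'd \<Rightarrow>\<^sub>0 int) set) \<Rightarrow> 'a set
    \<Rightarrow> ('a \<times> 'a \<Rightarrow>\<^sub>0 int) set \<Rightarrow> ('a \<times> 'd \<Rightarrow>\<^sub>0 int) set"
  where "canonical_map R A \<eta> D \<rho> B =
    tensor_lift (A\<lparr>carrier := B\<rparr>) (ring_bimod A id id) (ring_bimod A id id) (tensor_AD R A \<eta> D)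
      (\<lambda>a a'. a \<odot>\<^bsub>tensor_AD R A \<eta> D\<^esub> \<rho> a')"

definition galois_extension :: "('k, 'r) module \<Rightarrow> ('k, 'a) module \<Rightarrow> ('r \<Rightarrow> 'a)
    \<Rightarrow> ('r, 'd, 'r) bimod \<Rightarrow> ('a \<Rightarrow> ('a \<times> 'd \<Rightarrow>\<^sub>0 int) set) \<Rightarrow> 'a set \<Rightarrow> bool"
  where "galois_extension R A \<eta> D \<rho> B \<longleftrightarrow>
    bij_betw (canonical_map R A \<eta> D \<rho> B)
      (carrier (tensor (A\<lparr>carrier := B\<rparr>) (ring_bimod A id id) (ring_bimod A id id)))
      (carrier (tensor_AD R A \<eta> D))"

definition normal_basis_property :: "'k ring \<Rightarrow> ('k, 'r) module \<Rightarrow> ('k, 'a) module \<Rightarrow> ('r \<Rightarrow> 'a)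
    \<Rightarrow> ('r, 'd, 'r) bimod \<Rightarrow> ('d \<Rightarrow> ('d \<times> 'd \<Rightarrow>\<^sub>0 int) set)
    \<Rightarrow> ('a \<Rightarrow> ('a \<times> 'd \<Rightarrow>\<^sub>0 int) set) \<Rightarrow> 'a set \<Rightarrow> bool"
  where "normal_basis_property K R A \<eta> D \<Delta> \<rho> B \<longleftrightarrow>
    subring_over K R A \<eta> B \<and>
    (let Bm = ring_bimod (A\<lparr>carrier := B\<rparr>) id \<eta>; Am = ring_bimod A id \<eta> in
     \<exists>f. bij_betw f (carrier A) (carrier (tensor R Bm D)) \<and>
         f \<in> left_hom (A\<lparr>carrier := B\<rparr>) Am (tensor R Bm D) \<and>
         f \<in> comodule_hom R D Am \<rho> (tensor R Bm D) (tensor_coaction R Bm D \<Delta>))"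

subsection \<open>Cleft extensions\<close>

text \<open>The $A$-coring $C = A \otimes_R D$. Its right $A$-action \<open>act\<close> is additional data.\<close>

definition coring_AD :: "('k, 'r) module \<Rightarrow> ('k, 'a) module \<Rightarrow> ('r \<Rightarrow> 'a) \<Rightarrow> ('r, 'd, 'r) bimod
    \<Rightarrow> (('a \<times> 'd \<Rightarrow>\<^sub>0 int) set \<Rightarrow> 'a \<Rightarrow> ('a \<times> 'd \<Rightarrow>\<^sub>0 int) set)
    \<Rightarrow> ('a, ('a \<times> 'd \<Rightarrow>\<^sub>0 int) set, 'a) bimod"
  where "coring_AD R A \<eta> D act = with_right_action (tensor_AD R A \<eta> D) act"

text \<open>The coproduct $A \otimes \Delta$ of $C$, composed with the isomorphism
  $A \otimes_R D \otimes_R D \cong C \otimes_A C$ that sends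
  $a \otimes d \otimes d'$ to $(a \otimes d) \otimes (1 \otimes d')$.\<close>

definition coproduct_AD :: "('k, 'r) module \<Rightarrow> ('k, 'a) module \<Rightarrow> ('r \<Rightarrow> 'a) \<Rightarrow> ('r, 'd, 'r) bimod
    \<Rightarrow> ('d \<Rightarrow> ('d \<times> 'd \<Rightarrow>\<^sub>0 int) set)
    \<Rightarrow> (('a \<times> 'd \<Rightarrow>\<^sub>0 int) set \<Rightarrow> 'a \<Rightarrow> ('a \<times> 'd \<Rightarrow>\<^sub>0 int) set)
    \<Rightarrow> ('a \<times> 'd \<Rightarrow>\<^sub>0 int) set \<Rightarrow> (('a \<times> 'd \<Rightarrow>\<^sub>0 int) set \<times> ('a \<times> 'd \<Rightarrow>\<^sub>0 int) set \<Rightarrow>\<^sub>0 int) set"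
  where "coproduct_AD R A \<eta> D \<Delta> act =
    (let Am = ring_bimod A id \<eta>; C = coring_AD R A \<eta> D act in
     tensor_lift R Am D (tensor A C C)
       (\<lambda>a d. tensor_lift R D D (tensor A C C)
          (\<lambda>d1 d2. tens A C C (tens R Am D a d1) (tens R Am D \<one>\<^bsub>A\<^esub> d2)) (\<Delta> d)))"

definition counit_AD :: "('k, 'r) module \<Rightarrow> ('k, 'a) module \<Rightarrow> ('r \<Rightarrow> 'a) \<Rightarrow> ('r, 'd, 'r) bimod
    \<Rightarrow> ('d \<Rightarrow> 'r) \<Rightarrow> ('a \<times> 'd \<Rightarrow>\<^sub>0 int) set \<Rightarrow> 'a"
  where "counit_AD R A \<eta> D \<epsilon> =
    tensor_lift R (ring_bimod A id \<eta>) D A (\<lambda>a d. a \<otimes>\<^bsub>A\<^esub> \<eta> (\<epsilon> d))"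

definition coaction_AD :: "('k, 'r) module \<Rightarrow> ('k, 'a) module \<Rightarrow> ('r \<Rightarrow> 'a) \<Rightarrow> ('r, 'd, 'r) bimod
    \<Rightarrow> ('d \<Rightarrow> ('d \<times> 'd \<Rightarrow>\<^sub>0 int) set)
    \<Rightarrow> ('a \<times> 'd \<Rightarrow>\<^sub>0 int) set \<Rightarrow> (('a \<times> 'd \<Rightarrow>\<^sub>0 int) set \<times> 'd \<Rightarrow>\<^sub>0 int) set"
  where "coaction_AD R A \<eta> D \<Delta> = tensor_coaction R (ring_bimod A id \<eta>) D \<Delta>"

text \<open>The right $D$-coaction on $C \otimes_A C$ given by the coaction of the second factor.\<close>

definition coaction_CC :: "('k, 'r) module \<Rightarrow> ('k, 'a) module \<Rightarrow> ('r \<Rightarrow> 'a) \<Rightarrow> ('r, 'd, 'r) bimod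
    \<Rightarrow> ('d \<Rightarrow> ('d \<times> 'd \<Rightarrow>\<^sub>0 int) set)
    \<Rightarrow> (('a \<times> 'd \<Rightarrow>\<^sub>0 int) set \<Rightarrow> 'a \<Rightarrow> ('a \<times> 'd \<Rightarrow>\<^sub>0 int) set)
    \<Rightarrow> (('a \<times> 'd \<Rightarrow>\<^sub>0 int) set \<times> ('a \<times> 'd \<Rightarrow>\<^sub>0 int) set \<Rightarrow>\<^sub>0 int) set
    \<Rightarrow> ((('a \<times> 'd \<Rightarrow>\<^sub>0 int) set \<times> ('a \<times> 'd \<Rightarrow>\<^sub>0 int) set \<Rightarrow>\<^sub>0 int) set \<times> 'd \<Rightarrow>\<^sub>0 int) set"
  where "coaction_CC R A \<eta> D \<Delta> act =
    (let C = coring_AD R A \<eta> D act; CR = tensor_AD R A \<eta> D;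
         CC = tensor A C CR; Z = tensor R CC D in
     tensor_lift A C CR Z
       (\<lambda>c c'. tensor_lift R CR D Z (\<lambda>c0 d. tens R CC D (tens A C CR c c0) d)
          (coaction_AD R A \<eta> D \<Delta> c')))"

text \<open>The condition that the right $A$-action of $C$ restricts along $\eta$ to the right $R$-action
  inherited from $D$ is what makes the identification
  $(A \otimes_R D) \otimes_A (A \otimes_R D) \cong A \otimes_R D \otimes_R D$
  used in the coproduct meaningful.\<close>

definition cleft_coring :: "'k ring \<Rightarrow> ('k, 'r) module \<Rightarrow> ('k, 'a) module \<Rightarrow> ('r \<Rightarrow> 'a)
    \<Rightarrow> ('r, 'd, 'r) bimod \<Rightarrow> ('d \<Rightarrow> ('d \<times> 'd \<Rightarrow>\<^sub>0 int) set) \<Rightarrow> ('d \<Rightarrow> 'r)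
    \<Rightarrow> (('a \<times> 'd \<Rightarrow>\<^sub>0 int) set \<Rightarrow> 'a \<Rightarrow> ('a \<times> 'd \<Rightarrow>\<^sub>0 int) set) \<Rightarrow> bool"
  where "cleft_coring K R A \<eta> D \<Delta> \<epsilon> act \<longleftrightarrow>
    (let C = coring_AD R A \<eta> D act; CR = tensor_AD R A \<eta> D in
     (\<forall>c\<in>carrier C. \<forall>r\<in>carrier R. c \<odot>\<^sub>r\<^bsub>C\<^esub> \<eta> r = c \<odot>\<^sub>r\<^bsub>CR\<^esub> r) \<and>
     coring K A C (coproduct_AD R A \<eta> D \<Delta> act) (counit_AD R A \<eta> D \<epsilon>) \<and>
     comodule R D \<Delta> \<epsilon> CR (coaction_AD R A \<eta> D \<Delta>) \<and>
     coproduct_AD R A \<eta> D \<Delta> act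
       \<in> comodule_hom R D CR (coaction_AD R A \<eta> D \<Delta>) (tensor A C CR) (coaction_CC R A \<eta> D \<Delta> act))"

text \<open>The coaction \<open>\<rho>\<close> composed with $A \otimes_R D = C \cong A \otimes_A C$.\<close>

definition coaction_A :: "('k, 'r) module \<Rightarrow> ('k, 'a) module \<Rightarrow> ('r \<Rightarrow> 'a) \<Rightarrow> ('r, 'd, 'r) bimod
    \<Rightarrow> ('a \<Rightarrow> ('a \<times> 'd \<Rightarrow>\<^sub>0 int) set)
    \<Rightarrow> (('a \<times> 'd \<Rightarrow>\<^sub>0 int) set \<Rightarrow> 'a \<Rightarrow> ('a \<times> 'd \<Rightarrow>\<^sub>0 int) set)
    \<Rightarrow> 'a \<Rightarrow> ('a \<times> ('a \<times> 'd \<Rightarrow>\<^sub>0 int) set \<Rightarrow>\<^sub>0 int) set"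
  where "coaction_A R A \<eta> D \<rho> act =
    (\<lambda>x. tens A (ring_bimod A \<eta> id) (coring_AD R A \<eta> D act) \<one>\<^bsub>A\<^esub> (\<rho> x))"

text \<open>$\mathrm{Hom}_A(A, A)$ as an $A$-$R$ bimodule by $(a \varphi r)(x) = a \varphi(r x)$.\<close>

definition hom_AA :: "('k, 'a) module \<Rightarrow> ('r \<Rightarrow> 'a) \<Rightarrow> ('a, 'a \<Rightarrow> 'a, 'r) bimod"
  where "hom_AA A \<eta> =
    \<lparr>carrier = right_hom A (ring_bimod A id id) (ring_bimod A id id) \<inter> extensional (carrier A),
     monoid.mult = undefined, one = undefined,
     ring.zero = (\<lambda>x\<in>carrier A. \<zero>\<^bsub>A\<^esub>),
     ring.add = (\<lambda>\<phi> \<psi>. \<lambda>x\<in>carrier A. \<phi> x \<oplus>\<^bsub>A\<^esub> \<psi> x),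
     module.smult = (\<lambda>a \<phi>. \<lambda>x\<in>carrier A. a \<otimes>\<^bsub>A\<^esub> \<phi> x),
     rsmult = (\<lambda>\<phi> r. \<lambda>x\<in>carrier A. \<phi> (\<eta> r \<otimes>\<^bsub>A\<^esub> x))\<rparr>"

text \<open>The right regular $A$-module, with left $R$-action through $\eta$, is a cleft
  $R$-$C$ bicomodule.\<close>

definition cleft_bicomodule :: "('k, 'r) module \<Rightarrow> ('k, 'a) module \<Rightarrow> ('r \<Rightarrow> 'a)
    \<Rightarrow> ('r, 'd, 'r) bimod \<Rightarrow> ('d \<Rightarrow> ('d \<times> 'd \<Rightarrow>\<^sub>0 int) set) \<Rightarrow> ('d \<Rightarrow> 'r)
    \<Rightarrow> ('a \<Rightarrow> ('a \<times> 'd \<Rightarrow>\<^sub>0 int) set)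
    \<Rightarrow> (('a \<times> 'd \<Rightarrow>\<^sub>0 int) set \<Rightarrow> 'a \<Rightarrow> ('a \<times> 'd \<Rightarrow>\<^sub>0 int) set) \<Rightarrow> bool"
  where "cleft_bicomodule R A \<eta> D \<Delta> \<epsilon> \<rho> act \<longleftrightarrow>
    (let C = coring_AD R A \<eta> D act; CR = tensor_AD R A \<eta> D;
         \<Delta>C = coproduct_AD R A \<eta> D \<Delta> act; \<epsilon>C = counit_AD R A \<eta> D \<epsilon>;
         Ar = ring_bimod A id \<eta>; Al = ring_bimod A \<eta> id;
         \<rho>C = coaction_A R A \<eta> D \<rho> act;
         T = comodule_hom A C Al \<rho>C Al \<rho>C;
         H = hom_AA A \<eta> in
     comodule A C \<Delta>C \<epsilon>C Al \<rho>C \<and>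
     \<rho>C \<in> left_hom R Al (tensor A Al C) \<and>
     (\<exists>j jt.
        j \<in> left_hom R D Al \<inter> comodule_hom R D D \<Delta> Ar \<rho> \<and>
        jt \<in> left_hom A CR H \<inter> right_hom R CR H \<and>
        (\<forall>c\<in>carrier C. \<forall>x\<in>carrier A.
           tensor_lift A C C C (\<lambda>c1 c2. c1 \<odot>\<^sub>r\<^bsub>C\<^esub> jt c2 x) (\<Delta>C c) =
           tensor_lift A Al C C (\<lambda>x0 x1. jt c x0 \<odot>\<^bsub>C\<^esub> x1) (\<rho>C x)) \<and>
        (\<forall>d\<in>carrier D.
           (\<lambda>x\<in>carrier A. \<eta> (\<epsilon> d) \<otimes>\<^bsub>A\<^esub> x) \<in> T \<and>
           tensor_lift A Al C H (\<lambda>y0 y1. y0 \<odot>\<^bsub>H\<^esub> jt y1) (\<rho>C (j d)) =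
             (\<lambda>x\<in>carrier A. \<eta> (\<epsilon> d) \<otimes>\<^bsub>A\<^esub> x)) \<and>
        (\<forall>c\<in>carrier C.
           tensor_lift A C C C
             (\<lambda>c1 c2. c1 \<odot>\<^sub>r\<^bsub>C\<^esub>
                tensor_lift R CR D A (\<lambda>c0 d. jt c0 (j d)) (coaction_AD R A \<eta> D \<Delta> c2))
             (\<Delta>C c) = c)))"

definition cleft_extension :: "'k ring \<Rightarrow> ('k, 'r) module \<Rightarrow> ('k, 'a) module \<Rightarrow> ('r \<Rightarrow> 'a)
    \<Rightarrow> ('r, 'd, 'r) bimod \<Rightarrow> ('d \<Rightarrow> ('d \<times> 'd \<Rightarrow>\<^sub>0 int) set) \<Rightarrow> ('d \<Rightarrow> 'r)
    \<Rightarrow> ('a \<Rightarrow> ('a \<times> 'd \<Rightarrow>\<^sub>0 int) set) \<Rightarrow> 'a set \<Rightarrow> bool"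
  where "cleft_extension K R A \<eta> D \<Delta> \<epsilon> \<rho> B \<longleftrightarrow>
    coring_extension K R A \<eta> D \<Delta> \<epsilon> \<rho> B \<and>
    (\<exists>act. cleft_coring K R A \<eta> D \<Delta> \<epsilon> act \<and> cleft_bicomodule R A \<eta> D \<Delta> \<epsilon> \<rho> act)"

end

theory Submission
  imports Defs
begin

text \<open>If $C = A \otimes_R D$ is an $A$-coring and $\rho$ is right $A$-linear, then $g = \rho(1)$ is
  grouplike and $\Delta_C(\rho(y)) = g \otimes_A \rho(y)$. Write $j'(c) = \widetilde j(c)(1)$ and
  $p = j' \circ \rho$. The compatibility of $\widetilde j$ with the coactions, at $c = \rho(y)$, says that
  $p$ takes values in $B$. The two inverse identities for $j$ and $\widetilde j$ give
  $p \circ j = \eta \circ \epsilon$ and, at $c = \rho(y)$, also $p(y^{[0]})\,j(y^{[1]}) = y$. Hence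
  $y \mapsto p(y^{[0]}) \otimes y^{[1]}$ is an isomorphism $A \cong B \otimes_R D$ with inverse
  $b \otimes d \mapsto b\,j(d)$, and $c \mapsto j'(c_{[0]}) \otimes_B j(c_{[1]})$ inverts the canonical
  map.

  Conversely, transport the right $A$-action of $A \otimes_B A$ along the canonical map. Then $C$ is
  additively generated by the elements $a\rho(x)$, on which every coring identity is immediate. Given an
  isomorphism $f : A \cong B \otimes_R D$, put $p = (B \otimes \epsilon) \circ f$,
  $j(d) = f^{-1}(1 \otimes d)$ and $\widetilde j(a\rho(x)) = a\,p(x)\,(-)$.\<close>

section \<open>Tensor products\<close>

text \<open>Sweedler expressions are values of maps induced by balanced maps, and
  \<open>tensor_lift\<close> is a definite description that carries information only once
  balancedness is known. So every such formula, also one with three legs, is accompanied by a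
  balancedness proof, and identities are checked on additive generators. The element g = \<rho>(1)
  matters because for right A-linear \<rho> an element b of A is coinvariant exactly when b g = g b.
  The compatibility of \<open>jt\<close> with the coactions is used in this form to place p(y) in B.
  That B contains \<eta>(R) has another origin, the left R-linearity of the coaction on A. Of the
  two composites that show \<open>can\<close> to be bijective, the one on A \<otimes> A only
  involves elements \<rho>(y). The one on A \<otimes> D uses the compatibility and the inverse
  identity at arbitrary elements, and coassociativity of \<Delta> links the two. In the converse the
  transported right action has no visible formula on pure tensors a \<otimes> d; this is the reason
  for working with the generators a \<rho>(x).\<close>

abbreviation add_hom :: "('m, 'x) ring_scheme \<Rightarrow> ('n, 'y) ring_scheme \<Rightarrow> ('m \<Rightarrow> 'n) set"
  where "add_hom M N \<equiv> hom (add_monoid M) (add_monoid N)"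

lemma add_homI:
  assumes "\<And>x. x \<in> carrier M \<Longrightarrow> h x \<in> carrier N"
    and "\<And>x y. \<lbrakk>x \<in> carrier M; y \<in> carrier M\<rbrakk> \<Longrightarrow> h (x \<oplus>\<^bsub>M\<^esub> y) = h x \<oplus>\<^bsub>N\<^esub> h y"
  shows "h \<in> add_hom M N"
  using assms by (simp add: hom_def)

lemma add_hom_closed: "\<lbrakk>h \<in> add_hom M N; x \<in> carrier M\<rbrakk> \<Longrightarrow> h x \<in> carrier N"
  by (auto simp: hom_def)

lemma add_hom_add:
  "\<lbrakk>h \<in> add_hom M N; x \<in> carrier M; y \<in> carrier M\<rbrakk> \<Longrightarrow> h (x \<oplus>\<^bsub>M\<^esub> y) = h x \<oplus>\<^bsub>N\<^esub> h y"
  by (auto simp: hom_def)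

lemma add_hom_comp: "\<lbrakk>g \<in> add_hom M N; h \<in> add_hom N P\<rbrakk> \<Longrightarrow> (\<lambda>x. h (g x)) \<in> add_hom M P"
  by (auto simp: hom_def Pi_iff)

lemma left_homI:
  assumes "\<And>x. x \<in> carrier M \<Longrightarrow> h x \<in> carrier N"
    and "\<And>x y. \<lbrakk>x \<in> carrier M; y \<in> carrier M\<rbrakk> \<Longrightarrow> h (x \<oplus>\<^bsub>M\<^esub> y) = h x \<oplus>\<^bsub>N\<^esub> h y"
    and "\<And>a x. \<lbrakk>a \<in> carrier L; x \<in> carrier M\<rbrakk> \<Longrightarrow> h (a \<odot>\<^bsub>M\<^esub> x) = a \<odot>\<^bsub>N\<^esub> h x"
  shows "h \<in> left_hom L M N"
  using assms by (simp add: left_hom_def hom_def)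

lemma right_homI:
  assumes "\<And>x. x \<in> carrier M \<Longrightarrow> h x \<in> carrier N"
    and "\<And>x y. \<lbrakk>x \<in> carrier M; y \<in> carrier M\<rbrakk> \<Longrightarrow> h (x \<oplus>\<^bsub>M\<^esub> y) = h x \<oplus>\<^bsub>N\<^esub> h y"
    and "\<And>x a. \<lbrakk>x \<in> carrier M; a \<in> carrier S\<rbrakk> \<Longrightarrow> h (x \<odot>\<^sub>r\<^bsub>M\<^esub> a) = h x \<odot>\<^sub>r\<^bsub>N\<^esub> a"
  shows "h \<in> right_hom S M N"
  using assms by (simp add: right_hom_def hom_def)

lemma left_hom_add_hom: "h \<in> left_hom L M N \<Longrightarrow> h \<in> add_hom M N"
  by (simp add: left_hom_def)

lemma right_hom_add_hom: "h \<in> right_hom S M N \<Longrightarrow> h \<in> add_hom M N"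
  by (simp add: right_hom_def)

lemma left_hom_smult:
  "\<lbrakk>h \<in> left_hom L M N; a \<in> carrier L; x \<in> carrier M\<rbrakk> \<Longrightarrow> h (a \<odot>\<^bsub>M\<^esub> x) = a \<odot>\<^bsub>N\<^esub> h x"
  by (simp add: left_hom_def)

lemma right_hom_rsmult:
  "\<lbrakk>h \<in> right_hom S M N; x \<in> carrier M; a \<in> carrier S\<rbrakk> \<Longrightarrow> h (x \<odot>\<^sub>r\<^bsub>M\<^esub> a) = h x \<odot>\<^sub>r\<^bsub>N\<^esub> a"
  by (simp add: right_hom_def)

lemma id_left_hom: "id \<in> left_hom L M M" and id_right_hom: "id \<in> right_hom S M M"
  by (auto simp: left_hom_def right_hom_def hom_def)

lemma balancedI:
  assumes "\<And>x y. \<lbrakk>x \<in> carrier M; y \<in> carrier N\<rbrakk> \<Longrightarrow> f x y \<in> carrier G"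
    and "\<And>x x' y. \<lbrakk>x \<in> carrier M; x' \<in> carrier M; y \<in> carrier N\<rbrakk> \<Longrightarrow>
      f (x \<oplus>\<^bsub>M\<^esub> x') y = f x y \<oplus>\<^bsub>G\<^esub> f x' y"
    and "\<And>x y y'. \<lbrakk>x \<in> carrier M; y \<in> carrier N; y' \<in> carrier N\<rbrakk> \<Longrightarrow>
      f x (y \<oplus>\<^bsub>N\<^esub> y') = f x y \<oplus>\<^bsub>G\<^esub> f x y'"
    and "\<And>x s y. \<lbrakk>x \<in> carrier M; s \<in> carrier S; y \<in> carrier N\<rbrakk> \<Longrightarrow>
      f (x \<odot>\<^sub>r\<^bsub>M\<^esub> s) y = f x (s \<odot>\<^bsub>N\<^esub> y)"
  shows "balanced S M N G f"
  using assms by (simp add: balanced_def)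

text \<open>The balancedness equations evaluate the map at sums and at x s and s y. The module
  hypotheses keep these arguments inside the carriers, where f and g agree.\<close>

lemma balanced_cong:
  assumes "right_module S M" "left_module S N"
    and "\<And>x y. \<lbrakk>x \<in> carrier M; y \<in> carrier N\<rbrakk> \<Longrightarrow> f x y = g x y"
  shows "balanced S M N G f \<longleftrightarrow> balanced S M N G g"
proof -
  interpret M: right_module S M by fact
  interpret N: left_module S N by fact
  show ?thesis
    using assms(3) M.rsmult_closed N.lsmult_closed by (simp add: balanced_def)
qed

lemma balanced_comp:
  assumes "balanced S M' N' G h" "f \<in> right_hom S M M'" "g \<in> left_hom S N N'"
  shows "balanced S M N G (\<lambda>x y. h (f x) (g y))"
  using assms by (auto simp: balanced_def right_hom_def left_hom_def hom_def Pi_iff)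

lemma balanced_add_hom:
  assumes "balanced S M N G f" "h \<in> add_hom G G'"
  shows "balanced S M N G' (\<lambda>x y. h (f x y))"
  using assms by (auto simp: balanced_def hom_def Pi_iff)

text \<open>The description behind \<open>tensor_lift\<close> refers to f only through its values on
  the two carriers, so f and g give literally the same description. This permits rewriting inside a
  Sweedler sum.\<close>

lemma tensor_lift_cong:
  assumes "\<And>x y. \<lbrakk>x \<in> carrier M; y \<in> carrier N\<rbrakk> \<Longrightarrow> f x y = g x y"
  shows "tensor_lift S M N G f = tensor_lift S M N G g"
  unfolding tensor_lift_def using assms by (intro arg_cong[where f = The]) auto

lemma tensor_lift_apply_cong:
  assumes "\<And>x y. \<lbrakk>x \<in> carrier M; y \<in> carrier N\<rbrakk> \<Longrightarrow> f x y = g x y"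
  shows "tensor_lift S M N G f u = tensor_lift S M N G g u"
  using tensor_lift_cong[of M N f g S G] assms by simp

section \<open>The quotient presentation of the tensor product and induction on tensors\<close>

context
  fixes S :: "('s, 'x) ring_scheme" and M :: "('l, 'm, 's) bimod" and N :: "('s, 'n, 't) bimod"
  assumes M: "right_module S M" and N: "left_module S N"
begin

interpretation M: right_module S M by (rule M)
interpretation N: left_module S N by (rule N)

interpretation F: comm_group "tensor_free M N"
  by (simp add: tensor_free_def abelian_free_Abelian_group)

interpretation T: abelian_group "tensor S M N"
  by (rule tensor_abelian_group[OF M N])

lemma tensor_class_hom: "tensor_class S M N \<in> hom (tensor_free M N) (add_monoid (tensor S M N))"
proof -
  have "tensor_null S M N \<lhd> tensor_free M N"
    using F.normal_iff_subgroup tensor_null_subgroup[OF M N] by blast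
  from normal.r_coset_hom_Mod[OF this] show ?thesis
    by (simp add: hom_def tensor_class_def[abs_def] tensor_simps)
qed

interpretation c: group_hom "tensor_free M N" "add_monoid (tensor S M N)" "tensor_class S M N"
  using tensor_class_hom T.a_group by (simp add: group_hom_def group_hom_axioms_def F.is_group)

lemma carrier_tensor: "carrier (tensor S M N) = tensor_class S M N ` carrier (tensor_free M N)"
  by (auto simp: tensor_simps carrier_FactGroup tensor_class_def)

lemma tensor_class_eq:
  assumes "z \<in> carrier (tensor_free M N)" "z' \<in> carrier (tensor_free M N)"
    and "z - z' \<in> tensor_null S M N"
  shows "tensor_class S M N z = tensor_class S M N z'"
proof -
  have "z \<in> tensor_null S M N #>\<^bsub>tensor_free M N\<^esub> z'"
    using assms(3) by (auto simp: r_coset_def tensor_free_def intro!: bexI[of _ "z - z'"])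
  then show ?thesis
    unfolding tensor_class_def
    using F.repr_independence[OF _ assms(2) tensor_null_subgroup[OF M N]] by metis
qed

lemma tensor_class_rel:
  assumes "z \<in> carrier (tensor_free M N)" "z' \<in> carrier (tensor_free M N)"
    and "z - z' \<in> tensor_rel S M N"
  shows "tensor_class S M N z = tensor_class S M N z'"
  by (rule tensor_class_eq[OF assms(1,2)]) (auto simp: tensor_null_def intro: generate.incl assms(3))

lemma frag_of_in_tensor_free:
  "frag_of (x, y) \<in> carrier (tensor_free M N) \<longleftrightarrow> x \<in> carrier M \<and> y \<in> carrier N"
  by (simp add: tensor_free_def)

lemma tensor_free_add:
  "\<lbrakk>z \<in> carrier (tensor_free M N); z' \<in> carrier (tensor_free M N)\<rbrakk>
    \<Longrightarrow> z + z' \<in> carrier (tensor_free M N)"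
  using F.m_closed by (simp add: tensor_free_def)

lemma tensor_class_add:
  "\<lbrakk>z \<in> carrier (tensor_free M N); z' \<in> carrier (tensor_free M N)\<rbrakk>
    \<Longrightarrow> tensor_class S M N (z + z') = tensor_class S M N z \<oplus>\<^bsub>tensor S M N\<^esub> tensor_class S M N z'"
  using c.hom_mult by (simp add: tensor_free_def)

lemma tens_add_left:
  assumes "x \<in> carrier M" "x' \<in> carrier M" "y \<in> carrier N"
  shows "tens S M N (x \<oplus>\<^bsub>M\<^esub> x') y = tens S M N x y \<oplus>\<^bsub>tensor S M N\<^esub> tens S M N x' y"
proof -
  have "tensor_class S M N (frag_of (x \<oplus>\<^bsub>M\<^esub> x', y)) =
      tensor_class S M N (frag_of (x, y) + frag_of (x', y))"
    by (rule tensor_class_rel)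
      (use assms in \<open>auto simp: frag_of_in_tensor_free tensor_free_add tensor_rel_def\<close>)
  then show ?thesis
    using assms by (simp add: tens_def tensor_class_add frag_of_in_tensor_free)
qed

lemma tens_add_right:
  assumes "x \<in> carrier M" "y \<in> carrier N" "y' \<in> carrier N"
  shows "tens S M N x (y \<oplus>\<^bsub>N\<^esub> y') = tens S M N x y \<oplus>\<^bsub>tensor S M N\<^esub> tens S M N x y'"
proof -
  have "tensor_class S M N (frag_of (x, y \<oplus>\<^bsub>N\<^esub> y')) =
      tensor_class S M N (frag_of (x, y) + frag_of (x, y'))"
    by (rule tensor_class_rel)
      (use assms in \<open>auto simp: frag_of_in_tensor_free tensor_free_add tensor_rel_def\<close>)
  then show ?thesis
    using assms by (simp add: tens_def tensor_class_add frag_of_in_tensor_free)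
qed

lemma tens_rsmult:
  assumes "x \<in> carrier M" "s \<in> carrier S" "y \<in> carrier N"
  shows "tens S M N (x \<odot>\<^sub>r\<^bsub>M\<^esub> s) y = tens S M N x (s \<odot>\<^bsub>N\<^esub> y)"
  unfolding tens_def
  by (rule tensor_class_rel)
    (use assms M.rsmult_closed N.lsmult_closed in \<open>auto simp: frag_of_in_tensor_free tensor_rel_def\<close>)

lemma balanced_tens: "balanced S M N (tensor S M N) (tens S M N)"
  by (rule balancedI) (simp_all add: tens_closed[OF M N] tens_add_left tens_add_right tens_rsmult)

text \<open>Pure tensors generate under addition alone: 0 = 0 \<otimes> 0, and the negative of x
  \<otimes> y is the pure tensor (-x) \<otimes> y.\<close>

lemma tensor_induct [consumes 1, case_names tens add]:
  assumes u: "u \<in> carrier (tensor S M N)"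
    and tens: "\<And>x y. \<lbrakk>x \<in> carrier M; y \<in> carrier N\<rbrakk> \<Longrightarrow> P (tens S M N x y)"
    and add: "\<And>u v. \<lbrakk>u \<in> carrier (tensor S M N); v \<in> carrier (tensor S M N); P u; P v\<rbrakk>
      \<Longrightarrow> P (u \<oplus>\<^bsub>tensor S M N\<^esub> v)"
  shows "P u"
proof -
  have zero: "tens S M N \<zero>\<^bsub>M\<^esub> y = \<zero>\<^bsub>tensor S M N\<^esub>" if "y \<in> carrier N" for y
  proof -
    have "tens S M N \<zero>\<^bsub>M\<^esub> y \<oplus>\<^bsub>tensor S M N\<^esub> tens S M N \<zero>\<^bsub>M\<^esub> y = tens S M N \<zero>\<^bsub>M\<^esub> y"
      using tens_add_left[of "\<zero>\<^bsub>M\<^esub>" "\<zero>\<^bsub>M\<^esub>" y] that by simp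
    then show ?thesis
      using T.add.r_cancel_one' tens_closed[OF M N] that by simp
  qed
  have neg: "\<ominus>\<^bsub>tensor S M N\<^esub> tens S M N x y = tens S M N (\<ominus>\<^bsub>M\<^esub> x) y"
    if "x \<in> carrier M" "y \<in> carrier N" for x y
  proof (rule T.minus_equality)
    show "tens S M N (\<ominus>\<^bsub>M\<^esub> x) y \<oplus>\<^bsub>tensor S M N\<^esub> tens S M N x y = \<zero>\<^bsub>tensor S M N\<^esub>"
      using tens_add_left[of "\<ominus>\<^bsub>M\<^esub> x" x y] that by (simp add: zero M.M.l_neg)
  qed (use that in \<open>simp_all add: tens_closed[OF M N]\<close>)
  \<comment> \<open>Induction on the free abelian group passes through differences, so the claim is
    carried for a class and its negative together.\<close>
  have "P (tensor_class S M N z) \<and> P (\<ominus>\<^bsub>tensor S M N\<^esub> tensor_class S M N z)"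
    if "Poly_Mapping.keys z \<subseteq> carrier M \<times> carrier N" for z
    using that
  proof (induction rule: free_Abelian_group_induct[consumes 1])
    case 1
    have "tensor_class S M N 0 = \<zero>\<^bsub>tensor S M N\<^esub>"
      using c.hom_one by (simp add: tensor_free_def)
    moreover have "P \<zero>\<^bsub>tensor S M N\<^esub>"
    proof -
      have "P (tens S M N \<zero>\<^bsub>M\<^esub> \<zero>\<^bsub>N\<^esub>)" by (rule tens) simp_all
      then show ?thesis by (simp add: zero)
    qed
    ultimately show ?case
      by (simp add: a_inv_def)
  next
    case (2 x y)
    then have xy: "x \<in> carrier (tensor_free M N)" "y \<in> carrier (tensor_free M N)"
      by (simp_all add: tensor_free_def)
    have "x - y = x \<otimes>\<^bsub>tensor_free M N\<^esub> inv\<^bsub>tensor_free M N\<^esub> y"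
      using 2 by (simp add: tensor_free_def)
    then have eq: "tensor_class S M N (x - y) =
        tensor_class S M N x \<oplus>\<^bsub>tensor S M N\<^esub> \<ominus>\<^bsub>tensor S M N\<^esub> tensor_class S M N y"
      using xy c.hom_mult c.hom_inv by (simp add: a_inv_def)
    have mem: "tensor_class S M N x \<in> carrier (tensor S M N)"
      "tensor_class S M N y \<in> carrier (tensor S M N)"
      using xy c.hom_closed by simp_all
    show ?case
      unfolding eq using 2(3,4) mem by (simp add: add T.minus_add)
  next
    case (3 p)
    then have "P (tens S M N (fst p) (snd p))" "P (tens S M N (\<ominus>\<^bsub>M\<^esub> (fst p)) (snd p))"
      by (auto intro!: tens)
    then show ?case
      using neg[of "fst p" "snd p"] 3 by (auto simp: tens_def)
  qed
  then show ?thesis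
    using u by (auto simp: carrier_tensor tensor_free_def)
qed

lemma tensor_hom_eqI:
  assumes "h \<in> add_hom (tensor S M N) G" "k \<in> add_hom (tensor S M N) G"
    and "\<And>x y. \<lbrakk>x \<in> carrier M; y \<in> carrier N\<rbrakk> \<Longrightarrow> h (tens S M N x y) = k (tens S M N x y)"
    and "u \<in> carrier (tensor S M N)"
  shows "h u = k u"
  using assms(4) by (induction rule: tensor_induct) (simp_all add: assms(3) add_hom_add[OF assms(1)] add_hom_add[OF assms(2)])

context
  fixes G :: "('g, 'z) ring_scheme" and f :: "'m \<Rightarrow> 'n \<Rightarrow> 'g"
  assumes G: "abelian_group G" and f: "balanced S M N G f"
begin

lemma tensor_lift_hom: "tensor_lift S M N G f \<in> add_hom (tensor S M N) G"
  and tensor_lift_tens: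
    "\<lbrakk>x \<in> carrier M; y \<in> carrier N\<rbrakk> \<Longrightarrow> tensor_lift S M N G f (tens S M N x y) = f x y"
  using theI'[OF tensor_lift_ex1[OF M N G f], folded tensor_lift_def] by simp_all

lemma tensor_lift_closed:
  "u \<in> carrier (tensor S M N) \<Longrightarrow> tensor_lift S M N G f u \<in> carrier G"
  by (rule add_hom_closed[OF tensor_lift_hom])

lemma tensor_lift_add:
  "\<lbrakk>u \<in> carrier (tensor S M N); v \<in> carrier (tensor S M N)\<rbrakk> \<Longrightarrow>
    tensor_lift S M N G f (u \<oplus>\<^bsub>tensor S M N\<^esub> v) = tensor_lift S M N G f u \<oplus>\<^bsub>G\<^esub> tensor_lift S M N G f v"
  by (rule add_hom_add[OF tensor_lift_hom])

lemma tensor_lift_eqI: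
  assumes "h \<in> add_hom (tensor S M N) G" "u \<in> carrier (tensor S M N)"
    and "\<And>x y. \<lbrakk>x \<in> carrier M; y \<in> carrier N\<rbrakk> \<Longrightarrow> h (tens S M N x y) = f x y"
  shows "h u = tensor_lift S M N G f u"
  by (rule tensor_hom_eqI[OF assms(1) tensor_lift_hom _ assms(2)]) (simp add: assms(3) tensor_lift_tens)

end

text \<open>Both sides are additive in u and agree on pure tensors. In Sweedler notation, an
  additive map moves inside the sum.\<close>

lemma add_hom_tensor_lift:
  assumes G: "abelian_group G" "abelian_group G'" and f: "balanced S M N G f"
    and h: "h \<in> add_hom G G'" and u: "u \<in> carrier (tensor S M N)"
  shows "h (tensor_lift S M N G f u) = tensor_lift S M N G' (\<lambda>x y. h (f x y)) u"
  by (rule tensor_lift_eqI[OF G(2) balanced_add_hom[OF f h], where h = "\<lambda>u. h (tensor_lift S M N G f u)"])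
    (simp_all add: add_hom_comp[OF tensor_lift_hom[OF G(1) f] h] u tensor_lift_tens[OF G(1) f])

lemma tensor_lift_tens_id:
  "u \<in> carrier (tensor S M N) \<Longrightarrow> tensor_lift S M N (tensor S M N) (tens S M N) u = u"
  by (rule tensor_lift_eqI[OF T.abelian_group_axioms balanced_tens, where h = "\<lambda>u. u", symmetric])
    (simp_all add: hom_def)

text \<open>The two actions on \<open>tensor\<close> are defined as unions over all representatives
  z of a class X. Such a union collapses to a single class, the value of an induced map, and this
  turns the actions into instances of \<open>tensor_lift\<close>.\<close>

lemma tensor_class_frag_extend:
  assumes b: "balanced S M N (tensor S M N) (\<lambda>x y. tens S M N (g x) (k y))"
    and g: "\<And>x. x \<in> carrier M \<Longrightarrow> g x \<in> carrier M"
    and k: "\<And>y. y \<in> carrier N \<Longrightarrow> k y \<in> carrier N"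
    and X: "X \<in> carrier (tensor S M N)"
  shows "(\<Union>z\<in>X. tensor_class S M N (frag_extend (\<lambda>(x, y). frag_of (g x, k y)) z)) =
      tensor_lift S M N (tensor S M N) (\<lambda>x y. tens S M N (g x) (k y)) X"
proof -
  let ?e = "frag_extend (\<lambda>(x, y). frag_of (g x, k y))"
  let ?h = "tensor_lift S M N (tensor S M N) (\<lambda>x y. tens S M N (g x) (k y))"
  have h: "?h \<in> add_hom (tensor S M N) (tensor S M N)"
    by (rule tensor_lift_hom[OF T.abelian_group_axioms b])
  interpret h: group_hom "add_monoid (tensor S M N)" "add_monoid (tensor S M N)" ?h
    using h T.a_group by (simp add: group_hom_def group_hom_axioms_def)
  \<comment> \<open>On formal sums the substitution \<open>?e\<close> and the induced map
    \<open>?h\<close> are additive and agree on generators, so \<open>?h\<close> computes the class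
    of \<open>?e z\<close> from the class of z.\<close>
  have eq: "?e z \<in> carrier (tensor_free M N) \<and> tensor_class S M N (?e z) = ?h (tensor_class S M N z)"
    if "Poly_Mapping.keys z \<subseteq> carrier M \<times> carrier N" for z
    using that
  proof (induction rule: free_Abelian_group_induct[consumes 1])
    case 1
    have "tensor_class S M N 0 = \<zero>\<^bsub>tensor S M N\<^esub>"
      using c.hom_one by (simp add: tensor_free_def)
    then show ?case using h.hom_one by (simp add: tensor_free_def)
  next
    case (2 x y)
    then have xy: "x \<in> carrier (tensor_free M N)" "y \<in> carrier (tensor_free M N)"
      by (simp_all add: tensor_free_def)
    have diff: "tensor_class S M N (a - b) =
        tensor_class S M N a \<oplus>\<^bsub>tensor S M N\<^esub> inv\<^bsub>add_monoid (tensor S M N)\<^esub> tensor_class S M N b \<and>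
        a - b \<in> carrier (tensor_free M N)"
      if "a \<in> carrier (tensor_free M N)" "b \<in> carrier (tensor_free M N)" for a b
    proof -
      have "a - b = a \<otimes>\<^bsub>tensor_free M N\<^esub> inv\<^bsub>tensor_free M N\<^esub> b"
        using that by (simp add: tensor_free_def)
      then show ?thesis
        using that c.hom_mult c.hom_inv by (simp add: F.m_closed)
    qed
    have mem: "tensor_class S M N x \<in> carrier (tensor S M N)"
      "tensor_class S M N y \<in> carrier (tensor S M N)"
      using xy c.hom_closed by simp_all
    show ?case
      using diff[OF xy] diff[of "?e x" "?e y"] 2(3,4) mem h.hom_mult h.hom_inv 
      by (simp add: frag_extend_diff)
  next
    case (3 p)
    then show ?case
      using tensor_lift_tens[OF T.abelian_group_axioms b, of "fst p" "snd p"] g k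
      by (auto simp: tens_def tensor_free_def split: prod.splits)
  qed
  obtain z0 where z0: "z0 \<in> carrier (tensor_free M N)" "X = tensor_class S M N z0"
    using X by (auto simp: carrier_tensor)
  \<comment> \<open>Every z in the coset X represents X, so all members of the union coincide with
    \<open>?h X\<close>; the union is not empty because \<open>z0\<close> lies in X.\<close>
  have X': "X = tensor_class S M N z \<and> z \<in> carrier (tensor_free M N)" if "z \<in> X" for z
    using that z0 F.repr_independence[OF _ z0(1) tensor_null_subgroup[OF M N]]
      F.r_coset_subset_G[OF subgroup.subset[OF tensor_null_subgroup[OF M N]]]
    unfolding tensor_class_def by blast
  have "z0 \<in> X"
    using F.rcos_self[OF z0(1) tensor_null_subgroup[OF M N]] z0 by (simp add: tensor_class_def)
  moreover have "tensor_class S M N (?e z) = ?h X" if "z \<in> X" for z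
    using X'[OF that] eq[of z] by (auto simp: tensor_free_def)
  ultimately show ?thesis by auto
qed

end

text \<open>The part of \<open>bimodule\<close> that concerns the two acting rings alone. It applies
  to the coinvariants acting on A as soon as they are known to form a ring.\<close>

locale ring_bimodule = left_module L M + right_module S M
  for L :: "('l, 'x) ring_scheme" and S :: "('s, 'y) ring_scheme"
    and M :: "('l, 'm, 's, 'z) bimod_scheme" +
  assumes smult_rsmult:
    "\<lbrakk>a \<in> carrier L; x \<in> carrier M; s \<in> carrier S\<rbrakk>
      \<Longrightarrow> (a \<odot>\<^bsub>M\<^esub> x) \<odot>\<^sub>r\<^bsub>M\<^esub> s = a \<odot>\<^bsub>M\<^esub> (x \<odot>\<^sub>r\<^bsub>M\<^esub> s)"

lemma bimodule_ring_bimodule: "bimodule K L S M \<Longrightarrow> ring_bimodule L S M"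
  by (simp add: bimodule_def ring_bimodule_def ring_bimodule_axioms_def)

lemma ring_bimodule_left: "ring_bimodule L S M \<Longrightarrow> left_module L M"
  and ring_bimodule_right: "ring_bimodule L S M \<Longrightarrow> right_module S M"
  by (simp_all add: ring_bimodule_def)

lemma left_module_abelian_group: "left_module L M \<Longrightarrow> abelian_group M"
  by (simp add: left_module_def)

lemma right_module_abelian_group: "right_module S M \<Longrightarrow> abelian_group M"
  by (simp add: right_module_def)

lemma left_module_smult_hom: "\<lbrakk>left_module L M; a \<in> carrier L\<rbrakk> \<Longrightarrow> (\<lambda>x. a \<odot>\<^bsub>M\<^esub> x) \<in> add_hom M M"
  by (auto simp: hom_def left_module.lsmult_closed left_module.lsmult_r_distr)

lemma right_module_rsmult_hom: "\<lbrakk>right_module S M; a \<in> carrier S\<rbrakk> \<Longrightarrow> (\<lambda>x. x \<odot>\<^sub>r\<^bsub>M\<^esub> a) \<in> add_hom M M"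
  by (auto simp: hom_def right_module.rsmult_closed right_module.rsmult_l_distr)

section \<open>Module structures on a tensor product\<close>

lemma smult_tensor:
  assumes M: "ring_bimodule L S M" and N: "left_module S N"
    and "a \<in> carrier L" "u \<in> carrier (tensor S M N)"
  shows "balanced S M N (tensor S M N) (\<lambda>x y. tens S M N (a \<odot>\<^bsub>M\<^esub> x) y)" (is ?b)
    and "a \<odot>\<^bsub>tensor S M N\<^esub> u = tensor_lift S M N (tensor S M N) (\<lambda>x y. tens S M N (a \<odot>\<^bsub>M\<^esub> x) y) u"
proof -
  interpret M: ring_bimodule L S M by fact
  show b: ?b
    by (rule balanced_comp[OF balanced_tens[OF M.right_module_axioms N] _ id_left_hom, simplified])
      (use \<open>a \<in> carrier L\<close> in \<open>auto intro!: right_homI simp: M.lsmult_closed M.lsmult_r_distr M.smult_rsmult\<close>)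
  show "a \<odot>\<^bsub>tensor S M N\<^esub> u = tensor_lift S M N (tensor S M N) (\<lambda>x y. tens S M N (a \<odot>\<^bsub>M\<^esub> x) y) u"
    using tensor_class_frag_extend[OF M.right_module_axioms N b] assms(3,4) M.lsmult_closed
    by (simp add: tensor_def Let_def)
qed

lemma smult_tens:
  assumes M: "ring_bimodule L S M" and N: "left_module S N"
    and "a \<in> carrier L" "x \<in> carrier M" "y \<in> carrier N"
  shows "a \<odot>\<^bsub>tensor S M N\<^esub> tens S M N x y = tens S M N (a \<odot>\<^bsub>M\<^esub> x) y"
proof -
  note R = ring_bimodule_right[OF M]
  show ?thesis
    using smult_tensor[OF M N assms(3) tens_closed[OF R N assms(4,5)]]
      tensor_lift_tens[OF R N tensor_abelian_group[OF R N]] assms by simp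
qed

lemma rsmult_tensor:
  assumes M: "right_module S M" and N: "ring_bimodule S T N"
    and "t \<in> carrier T" "u \<in> carrier (tensor S M N)"
  shows "balanced S M N (tensor S M N) (\<lambda>x y. tens S M N x (y \<odot>\<^sub>r\<^bsub>N\<^esub> t))" (is ?b)
    and "u \<odot>\<^sub>r\<^bsub>tensor S M N\<^esub> t = tensor_lift S M N (tensor S M N) (\<lambda>x y. tens S M N x (y \<odot>\<^sub>r\<^bsub>N\<^esub> t)) u"
proof -
  interpret N: ring_bimodule S T N by fact
  show b: ?b
    by (rule balanced_comp[OF balanced_tens[OF M N.left_module_axioms] id_right_hom, simplified])
      (use \<open>t \<in> carrier T\<close> in \<open>auto intro!: left_homI simp: N.rsmult_closed N.rsmult_l_distr N.smult_rsmult\<close>)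
  show "u \<odot>\<^sub>r\<^bsub>tensor S M N\<^esub> t = tensor_lift S M N (tensor S M N) (\<lambda>x y. tens S M N x (y \<odot>\<^sub>r\<^bsub>N\<^esub> t)) u"
    using tensor_class_frag_extend[OF M N.left_module_axioms b] assms(3,4) N.rsmult_closed
    by (simp add: tensor_def Let_def)
qed

lemma rsmult_tens:
  assumes M: "right_module S M" and N: "ring_bimodule S T N"
    and "t \<in> carrier T" "x \<in> carrier M" "y \<in> carrier N"
  shows "tens S M N x y \<odot>\<^sub>r\<^bsub>tensor S M N\<^esub> t = tens S M N x (y \<odot>\<^sub>r\<^bsub>N\<^esub> t)"
proof -
  note L = ring_bimodule_left[OF N]
  show ?thesis
    using rsmult_tensor[OF M N assms(3) tens_closed[OF M L assms(4,5)]]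
      tensor_lift_tens[OF M L tensor_abelian_group[OF M L]] assms by simp
qed

lemma tensor_left_module:
  assumes M: "ring_bimodule L S M" and N: "left_module S N"
  shows "left_module L (tensor S M N)"
proof -
  interpret M: ring_bimodule L S M by fact
  interpret N: left_module S N by fact
  interpret T: abelian_group "tensor S M N"
    by (rule tensor_abelian_group[OF M.right_module_axioms N])
  note RM = M.right_module_axioms
  have closed: "a \<odot>\<^bsub>tensor S M N\<^esub> u \<in> carrier (tensor S M N)"
    if "a \<in> carrier L" "u \<in> carrier (tensor S M N)" for a u
    using smult_tensor[OF M N that] tensor_lift_closed[OF RM N T.abelian_group_axioms _ that(2)] by simp
  have add: "a \<odot>\<^bsub>tensor S M N\<^esub> (u \<oplus>\<^bsub>tensor S M N\<^esub> v) =
      a \<odot>\<^bsub>tensor S M N\<^esub> u \<oplus>\<^bsub>tensor S M N\<^esub> a \<odot>\<^bsub>tensor S M N\<^esub> v"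
    if "a \<in> carrier L" "u \<in> carrier (tensor S M N)" "v \<in> carrier (tensor S M N)" for a u v
    using that tensor_lift_add[OF RM N T.abelian_group_axioms smult_tensor(1)[OF M N that(1,2)] that(2,3)]
    by (simp add: smult_tensor(2)[OF M N])
  note st = smult_tens[OF M N]
  note tc = tens_closed[OF RM N]
  show ?thesis
  proof (intro left_module.intro left_module_axioms.intro)
    fix a b u assume ab: "a \<in> carrier L" "b \<in> carrier L" and u: "u \<in> carrier (tensor S M N)"
    show "(a \<oplus>\<^bsub>L\<^esub> b) \<odot>\<^bsub>tensor S M N\<^esub> u =
        a \<odot>\<^bsub>tensor S M N\<^esub> u \<oplus>\<^bsub>tensor S M N\<^esub> b \<odot>\<^bsub>tensor S M N\<^esub> u"
      using u by (induction rule: tensor_induct[OF RM N, consumes 1])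
        (simp_all add: ab st add closed M.lsmult_l_distr M.lsmult_closed
          tens_add_left[OF RM N] T.a_ac)
    show "(a \<otimes>\<^bsub>L\<^esub> b) \<odot>\<^bsub>tensor S M N\<^esub> u = a \<odot>\<^bsub>tensor S M N\<^esub> (b \<odot>\<^bsub>tensor S M N\<^esub> u)"
      using u by (induction rule: tensor_induct[OF RM N, consumes 1])
        (simp_all add: ab st add closed M.lsmult_assoc M.lsmult_closed)
  next
    fix u assume u: "u \<in> carrier (tensor S M N)"
    show "\<one>\<^bsub>L\<^esub> \<odot>\<^bsub>tensor S M N\<^esub> u = u"
      using u by (induction rule: tensor_induct[OF RM N, consumes 1])
        (simp_all add: st add M.lsmult_one)
  qed (simp_all add: closed add M.L.ring_axioms T.abelian_group_axioms)
qed

lemma tensor_right_module: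
  assumes M: "right_module S M" and N: "ring_bimodule S T N"
  shows "right_module T (tensor S M N)"
proof -
  interpret M: right_module S M by fact
  interpret N: ring_bimodule S T N by fact
  note LN = N.left_module_axioms
  interpret T: abelian_group "tensor S M N"
    by (rule tensor_abelian_group[OF M LN])
  have closed: "u \<odot>\<^sub>r\<^bsub>tensor S M N\<^esub> a \<in> carrier (tensor S M N)"
    if "a \<in> carrier T" "u \<in> carrier (tensor S M N)" for a u
    using rsmult_tensor[OF M N that] tensor_lift_closed[OF M LN T.abelian_group_axioms _ that(2)] by simp
  have add: "(u \<oplus>\<^bsub>tensor S M N\<^esub> v) \<odot>\<^sub>r\<^bsub>tensor S M N\<^esub> a =
      u \<odot>\<^sub>r\<^bsub>tensor S M N\<^esub> a \<oplus>\<^bsub>tensor S M N\<^esub> v \<odot>\<^sub>r\<^bsub>tensor S M N\<^esub> a"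
    if "a \<in> carrier T" "u \<in> carrier (tensor S M N)" "v \<in> carrier (tensor S M N)" for a u v
    using that tensor_lift_add[OF M LN T.abelian_group_axioms rsmult_tensor(1)[OF M N that(1,2)] that(2,3)]
    by (simp add: rsmult_tensor(2)[OF M N])
  note st = rsmult_tens[OF M N]
  note tc = tens_closed[OF M LN]
  show ?thesis
  proof (intro right_module.intro right_module_axioms.intro)
    fix u a b assume u: "u \<in> carrier (tensor S M N)" and ab: "a \<in> carrier T" "b \<in> carrier T"
    show "u \<odot>\<^sub>r\<^bsub>tensor S M N\<^esub> (a \<oplus>\<^bsub>T\<^esub> b) =
        u \<odot>\<^sub>r\<^bsub>tensor S M N\<^esub> a \<oplus>\<^bsub>tensor S M N\<^esub> u \<odot>\<^sub>r\<^bsub>tensor S M N\<^esub> b"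
      using u by (induction rule: tensor_induct[OF M LN, consumes 1])
        (simp_all add: ab st add closed N.rsmult_r_distr N.rsmult_closed
          tens_add_right[OF M LN] T.a_ac)
    show "u \<odot>\<^sub>r\<^bsub>tensor S M N\<^esub> (a \<otimes>\<^bsub>T\<^esub> b) = (u \<odot>\<^sub>r\<^bsub>tensor S M N\<^esub> a) \<odot>\<^sub>r\<^bsub>tensor S M N\<^esub> b"
      using u by (induction rule: tensor_induct[OF M LN, consumes 1])
        (simp_all add: ab st add closed N.rsmult_assoc N.rsmult_closed)
  next
    fix u assume u: "u \<in> carrier (tensor S M N)"
    show "u \<odot>\<^sub>r\<^bsub>tensor S M N\<^esub> \<one>\<^bsub>T\<^esub> = u"
      using u by (induction rule: tensor_induct[OF M LN, consumes 1])
        (simp_all add: st add N.rsmult_one)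
  qed (simp_all add: closed add N.S.ring_axioms T.abelian_group_axioms)
qed

lemma tensor_ring_bimodule:
  assumes M: "ring_bimodule L S M" and N: "ring_bimodule S T N"
  shows "ring_bimodule L T (tensor S M N)"
proof -
  interpret M: ring_bimodule L S M by fact
  interpret N: ring_bimodule S T N by fact
  interpret X: left_module L "tensor S M N"
    by (rule tensor_left_module[OF M N.left_module_axioms])
  interpret Y: right_module T "tensor S M N"
    by (rule tensor_right_module[OF M.right_module_axioms N])
  show ?thesis
  proof (unfold_locales)
    fix a u t assume a: "a \<in> carrier L" and t: "t \<in> carrier T" and u: "u \<in> carrier (tensor S M N)"
    show "(a \<odot>\<^bsub>tensor S M N\<^esub> u) \<odot>\<^sub>r\<^bsub>tensor S M N\<^esub> t = a \<odot>\<^bsub>tensor S M N\<^esub> (u \<odot>\<^sub>r\<^bsub>tensor S M N\<^esub> t)"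
      using u
      by (induction rule: tensor_induct[OF M.right_module_axioms N.left_module_axioms, consumes 1])
        (simp_all add: a t smult_tens[OF M N.left_module_axioms] rsmult_tens[OF M.right_module_axioms N]
          M.lsmult_closed N.rsmult_closed X.lsmult_closed Y.rsmult_closed X.lsmult_r_distr Y.rsmult_l_distr)
  qed
qed

context
  fixes S :: "('s, 'x) ring_scheme" and M :: "('l, 'm, 's) bimod" and N :: "('s, 'n, 't) bimod"
    and G :: "('g, 'z) ring_scheme" and f :: "'m \<Rightarrow> 'n \<Rightarrow> 'g"
  assumes M: "right_module S M" and N: "left_module S N"
    and G: "abelian_group G" and f: "balanced S M N G f"
begin

interpretation M: right_module S M by (rule M)
interpretation N: left_module S N by (rule N)
interpretation G: abelian_group G by (rule G)

lemma tensor_lift_smult: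
  assumes bi: "ring_bimodule L S M" and "a \<in> carrier L" "u \<in> carrier (tensor S M N)"
  shows "tensor_lift S M N G f (a \<odot>\<^bsub>tensor S M N\<^esub> u) = tensor_lift S M N G (\<lambda>x y. f (a \<odot>\<^bsub>M\<^esub> x) y) u"
proof -
  interpret M: ring_bimodule L S M by fact
  have "tensor_lift S M N G f (a \<odot>\<^bsub>tensor S M N\<^esub> u) =
      tensor_lift S M N G (\<lambda>x y. tensor_lift S M N G f (tens S M N (a \<odot>\<^bsub>M\<^esub> x) y)) u"
    using smult_tensor[OF bi N assms(2,3)]
      add_hom_tensor_lift[OF M N tensor_abelian_group[OF M N] G _ tensor_lift_hom[OF M N G f] assms(3)]
    by simp
  also have "\<dots> = tensor_lift S M N G (\<lambda>x y. f (a \<odot>\<^bsub>M\<^esub> x) y) u"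
    using assms(2) M.lsmult_closed tensor_lift_tens[OF M N G f]
    by (intro tensor_lift_apply_cong) simp
  finally show ?thesis .
qed

lemma tensor_lift_rsmult:
  assumes bi: "ring_bimodule S T N" and "t \<in> carrier T" "u \<in> carrier (tensor S M N)"
  shows "tensor_lift S M N G f (u \<odot>\<^sub>r\<^bsub>tensor S M N\<^esub> t) = tensor_lift S M N G (\<lambda>x y. f x (y \<odot>\<^sub>r\<^bsub>N\<^esub> t)) u"
proof -
  interpret N: ring_bimodule S T N by fact
  have "tensor_lift S M N G f (u \<odot>\<^sub>r\<^bsub>tensor S M N\<^esub> t) =
      tensor_lift S M N G (\<lambda>x y. tensor_lift S M N G f (tens S M N x (y \<odot>\<^sub>r\<^bsub>N\<^esub> t))) u"
    using rsmult_tensor[OF M bi assms(2,3)]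
      add_hom_tensor_lift[OF M N tensor_abelian_group[OF M N] G _ tensor_lift_hom[OF M N G f] assms(3)]
    by simp
  also have "\<dots> = tensor_lift S M N G (\<lambda>x y. f x (y \<odot>\<^sub>r\<^bsub>N\<^esub> t)) u"
    using assms(2) N.rsmult_closed tensor_lift_tens[OF M N G f]
    by (intro tensor_lift_apply_cong) simp
  finally show ?thesis .
qed

text \<open>Additivity of a Sweedler sum in its integrand. It yields additivity in any further
  argument on which the integrand depends.\<close>

lemma tensor_lift_add_fun:
  assumes g: "balanced S M N G g" and u: "u \<in> carrier (tensor S M N)"
  shows "tensor_lift S M N G (\<lambda>x y. f x y \<oplus>\<^bsub>G\<^esub> g x y) u =
    tensor_lift S M N G f u \<oplus>\<^bsub>G\<^esub> tensor_lift S M N G g u"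
proof -
  have b: "balanced S M N G (\<lambda>x y. f x y \<oplus>\<^bsub>G\<^esub> g x y)"
    using f g by (auto simp: balanced_def G.a_ac)
  show ?thesis
    using u by (induction rule: tensor_induct[OF M N, consumes 1])
      (simp_all add: tensor_lift_tens[OF M N G b] tensor_lift_tens[OF M N G f] tensor_lift_tens[OF M N G g]
        tensor_lift_add[OF M N G b] tensor_lift_add[OF M N G f] tensor_lift_add[OF M N G g]
        tensor_lift_closed[OF M N G f] tensor_lift_closed[OF M N G g] G.a_ac)
qed

end

text \<open>Acting on u by a amounts to acting on the first leg; \<open>lin\<close> pulls a out of
  each summand, and additivity of the action on G pulls it out of the sum.\<close>

lemma tensor_lift_left_hom:
  assumes M: "ring_bimodule L S M" and N: "left_module S N" and G: "left_module L G"
    and f: "balanced S M N G f"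
    and lin: "\<And>a x y. \<lbrakk>a \<in> carrier L; x \<in> carrier M; y \<in> carrier N\<rbrakk> \<Longrightarrow> f (a \<odot>\<^bsub>M\<^esub> x) y = a \<odot>\<^bsub>G\<^esub> f x y"
  shows "tensor_lift S M N G f \<in> left_hom L (tensor S M N) G"
proof -
  note M' = ring_bimodule_right[OF M] and G' = left_module_abelian_group[OF G]
  have "tensor_lift S M N G f (a \<odot>\<^bsub>tensor S M N\<^esub> u) = a \<odot>\<^bsub>G\<^esub> tensor_lift S M N G f u"
    if "a \<in> carrier L" "u \<in> carrier (tensor S M N)" for a u
  proof -
    have "tensor_lift S M N G (\<lambda>x y. f (a \<odot>\<^bsub>M\<^esub> x) y) = tensor_lift S M N G (\<lambda>x y. a \<odot>\<^bsub>G\<^esub> f x y)"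
      by (rule tensor_lift_cong) (use that lin in simp)
    then show ?thesis
      using tensor_lift_smult[OF M' N G' f M that]
        add_hom_tensor_lift[OF M' N G' G' f left_module_smult_hom[OF G that(1)] that(2)] by simp
  qed
  then show ?thesis
    using tensor_lift_hom[OF M' N G' f] by (simp add: left_hom_def)
qed

lemma tensor_lift_right_hom:
  assumes M: "right_module S M" and N: "ring_bimodule S T N" and G: "right_module T G"
    and f: "balanced S M N G f"
    and lin: "\<And>t x y. \<lbrakk>t \<in> carrier T; x \<in> carrier M; y \<in> carrier N\<rbrakk> \<Longrightarrow> f x (y \<odot>\<^sub>r\<^bsub>N\<^esub> t) = f x y \<odot>\<^sub>r\<^bsub>G\<^esub> t"
  shows "tensor_lift S M N G f \<in> right_hom T (tensor S M N) G"
proof -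
  note N' = ring_bimodule_left[OF N] and G' = right_module_abelian_group[OF G]
  have "tensor_lift S M N G f (u \<odot>\<^sub>r\<^bsub>tensor S M N\<^esub> t) = tensor_lift S M N G f u \<odot>\<^sub>r\<^bsub>G\<^esub> t"
    if "t \<in> carrier T" "u \<in> carrier (tensor S M N)" for t u
  proof -
    have "tensor_lift S M N G (\<lambda>x y. f x (y \<odot>\<^sub>r\<^bsub>N\<^esub> t)) = tensor_lift S M N G (\<lambda>x y. f x y \<odot>\<^sub>r\<^bsub>G\<^esub> t)"
      by (rule tensor_lift_cong) (use that lin in simp)
    then show ?thesis
      using tensor_lift_rsmult[OF M N' G' f N that]
        add_hom_tensor_lift[OF M N' G' G' f right_module_rsmult_hom[OF G that(1)] that(2)] by simp
  qed
  then show ?thesis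
    using tensor_lift_hom[OF M N' G' f] by (simp add: right_hom_def)
qed

section \<open>Functoriality of the tensor product\<close>

context
  fixes S :: "('s, 'x) ring_scheme" and M :: "('l, 'm, 's) bimod" and N :: "('s, 'n, 't) bimod"
    and M' :: "('l1, 'm1, 's) bimod" and N' :: "('s, 'n1, 't1) bimod" and f g
  assumes M: "right_module S M" and N: "left_module S N"
    and M': "right_module S M'" and N': "left_module S N'"
    and f: "f \<in> right_hom S M M'" and g: "g \<in> left_hom S N N'"
begin

lemma balanced_tensor_map: "balanced S M N (tensor S M' N') (\<lambda>x y. tens S M' N' (f x) (g y))"
  by (rule balanced_comp[OF balanced_tens[OF M' N'] f g])

lemma tensor_map_hom: "tensor_map S M N M' N' f g \<in> add_hom (tensor S M N) (tensor S M' N')"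
  unfolding tensor_map_def
  by (rule tensor_lift_hom[OF M N tensor_abelian_group[OF M' N'] balanced_tensor_map])

lemma tensor_map_tens:
  "\<lbrakk>x \<in> carrier M; y \<in> carrier N\<rbrakk>
    \<Longrightarrow> tensor_map S M N M' N' f g (tens S M N x y) = tens S M' N' (f x) (g y)"
  unfolding tensor_map_def
  by (rule tensor_lift_tens[OF M N tensor_abelian_group[OF M' N'] balanced_tensor_map])

lemma tensor_lift_tensor_map:
  assumes G: "abelian_group G" and h: "balanced S M' N' G h" and u: "u \<in> carrier (tensor S M N)"
  shows "tensor_lift S M' N' G h (tensor_map S M N M' N' f g u) =
    tensor_lift S M N G (\<lambda>x y. h (f x) (g y)) u"
proof -
  have "tensor_lift S M' N' G h (tensor_map S M N M' N' f g u) =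
      tensor_lift S M N G (\<lambda>x y. tensor_lift S M' N' G h (tens S M' N' (f x) (g y))) u"
    unfolding tensor_map_def
    by (rule add_hom_tensor_lift[OF M N tensor_abelian_group[OF M' N'] G balanced_tensor_map
          tensor_lift_hom[OF M' N' G h] u])
  also have "\<dots> = tensor_lift S M N G (\<lambda>x y. h (f x) (g y)) u"
    using add_hom_closed[OF right_hom_add_hom[OF f]] add_hom_closed[OF left_hom_add_hom[OF g]]
      tensor_lift_tens[OF M' N' G h]
    by (intro tensor_lift_apply_cong) simp
  finally show ?thesis .
qed

end

lemma tensor_map_id:
  assumes M: "right_module S M" and N: "left_module S N" and "u \<in> carrier (tensor S M N)"
  shows "tensor_map S M N M N id id u = u"
  using tensor_lift_tens_id[OF assms] by (simp add: tensor_map_def)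

subsection \<open>Balanced maps of three arguments\<close>

text \<open>A map balanced over S in its first two arguments and over T in its last two corresponds
  to an additive map on the threefold tensor product, with either bracketing. Sweedler expressions
  with three legs are handled in this form.\<close>

definition balanced3 where
  "balanced3 S T M N P G F \<longleftrightarrow>
    (\<forall>z\<in>carrier P. balanced S M N G (\<lambda>x y. F x y z)) \<and>
    (\<forall>x\<in>carrier M. balanced T N P G (F x))"

lemma balanced3D:
  assumes "balanced3 S T M N P G F"
  shows "z \<in> carrier P \<Longrightarrow> balanced S M N G (\<lambda>x y. F x y z)"
    and "x \<in> carrier M \<Longrightarrow> balanced T N P G (F x)"
  using assms by (auto simp: balanced3_def)

context
  fixes S :: "('s, 'x) ring_scheme" and T :: "('t, 'y) ring_scheme"
    and M :: "('l, 'm, 's) bimod" and N :: "('s, 'n, 't) bimod" and P :: "('t, 'p, 'u) bimod"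
  assumes M: "right_module S M" and N: "ring_bimodule S T N" and P: "left_module T P"
begin

interpretation M: right_module S M by (rule M)
interpretation N: ring_bimodule S T N by (rule N)
interpretation P: left_module T P by (rule P)


interpretation MN: right_module T "tensor S M N"
  by (rule tensor_right_module[OF M N])
interpretation NP: left_module S "tensor T N P"
  by (rule tensor_left_module[OF N P])

lemma balanced3_tens_left:
  "balanced3 S T M N P (tensor T (tensor S M N) P) (\<lambda>x y z. tens T (tensor S M N) P (tens S M N x y) z)"
proof -
  note MN = MN.right_module_axioms
  note tc = tens_closed[OF M ring_bimodule_left[OF N]] and tc' = tens_closed[OF MN P]
  show ?thesis
    unfolding balanced3_def
    by (auto intro!: balancedI simp: tc tc' tens_add_left[OF M ring_bimodule_left[OF N]] tens_add_right[OF M ring_bimodule_left[OF N]]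
        tens_add_left[OF MN P] tens_add_right[OF MN P] tens_rsmult[OF M ring_bimodule_left[OF N]]
        N.rsmult_closed rsmult_tens[OF M N, symmetric] tens_rsmult[OF MN P])
qed

lemma balanced3_tens_right:
  "balanced3 S T M N P (tensor S M (tensor T N P)) (\<lambda>x y z. tens S M (tensor T N P) x (tens T N P y z))"
proof -
  note NP = NP.left_module_axioms
  note tc = tens_closed[OF ring_bimodule_right[OF N] P] and tc' = tens_closed[OF M NP]
  show ?thesis
    unfolding balanced3_def
    by (auto intro!: balancedI simp: tc tc' tens_add_left[OF ring_bimodule_right[OF N] P] tens_add_right[OF ring_bimodule_right[OF N] P]
        tens_add_left[OF M NP] tens_add_right[OF M NP] tens_rsmult[OF ring_bimodule_right[OF N] P]
        N.lsmult_closed smult_tens[OF N P, symmetric] tens_rsmult[OF M NP])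
qed

context
  fixes G :: "('g, 'z) ring_scheme" and F
  assumes G: "abelian_group G" and F: "balanced3 S T M N P G F"
begin

text \<open>Balancedness over T moves t from z into the second leg of the integrand, which is how t
  acts on M \<otimes> N from the right. Additivity in z is additivity of the lift in its
  integrand.\<close>

lemma balanced3_lift_left:
  "balanced T (tensor S M N) P G (\<lambda>u z. tensor_lift S M N G (\<lambda>x y. F x y z) u)"
proof (rule balancedI)
  fix u z z' assume uz: "u \<in> carrier (tensor S M N)" "z \<in> carrier P" "z' \<in> carrier P"
  have "tensor_lift S M N G (\<lambda>x y. F x y (z \<oplus>\<^bsub>P\<^esub> z')) =
      tensor_lift S M N G (\<lambda>x y. F x y z \<oplus>\<^bsub>G\<^esub> F x y z')"
    by (rule tensor_lift_cong) (use balanced3D(2)[OF F] uz in \<open>simp add: balanced_def\<close>)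
  then show "tensor_lift S M N G (\<lambda>x y. F x y (z \<oplus>\<^bsub>P\<^esub> z')) u =
      tensor_lift S M N G (\<lambda>x y. F x y z) u \<oplus>\<^bsub>G\<^esub> tensor_lift S M N G (\<lambda>x y. F x y z') u"
    using tensor_lift_add_fun[OF M ring_bimodule_left[OF N] G balanced3D(1)[OF F uz(2)] balanced3D(1)[OF F uz(3)] uz(1)] by simp
next
  fix u t z assume u: "u \<in> carrier (tensor S M N)" and t: "t \<in> carrier T" and z: "z \<in> carrier P"
  have "tensor_lift S M N G (\<lambda>x y. F x y (t \<odot>\<^bsub>P\<^esub> z)) = tensor_lift S M N G (\<lambda>x y. F x (y \<odot>\<^sub>r\<^bsub>N\<^esub> t) z)"
    by (rule tensor_lift_cong) (use balanced3D(2)[OF F] t z in \<open>simp add: balanced_def\<close>)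
  then show "tensor_lift S M N G (\<lambda>x y. F x y z) (u \<odot>\<^sub>r\<^bsub>tensor S M N\<^esub> t) =
      tensor_lift S M N G (\<lambda>x y. F x y (t \<odot>\<^bsub>P\<^esub> z)) u"
    using tensor_lift_rsmult[OF M ring_bimodule_left[OF N] G balanced3D(1)[OF F z] N t u] by simp
qed (simp_all add: tensor_lift_closed[OF M ring_bimodule_left[OF N] G balanced3D(1)[OF F]] tensor_lift_add[OF M ring_bimodule_left[OF N] G balanced3D(1)[OF F]])

lemma balanced3_lift_right:
  "balanced S M (tensor T N P) G (\<lambda>x v. tensor_lift T N P G (F x) v)"
proof (rule balancedI)
  fix x x' v assume x: "x \<in> carrier M" "x' \<in> carrier M" and v: "v \<in> carrier (tensor T N P)"
  have "tensor_lift T N P G (F (x \<oplus>\<^bsub>M\<^esub> x')) = tensor_lift T N P G (\<lambda>y z. F x y z \<oplus>\<^bsub>G\<^esub> F x' y z)"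
    by (rule tensor_lift_cong) (use balanced3D(1)[OF F] x in \<open>simp add: balanced_def\<close>)
  then show "tensor_lift T N P G (F (x \<oplus>\<^bsub>M\<^esub> x')) v =
      tensor_lift T N P G (F x) v \<oplus>\<^bsub>G\<^esub> tensor_lift T N P G (F x') v"
    using tensor_lift_add_fun[OF ring_bimodule_right[OF N] P G balanced3D(2)[OF F x(1)] balanced3D(2)[OF F x(2)] v] by simp
next
  fix x s v assume x: "x \<in> carrier M" and s: "s \<in> carrier S" and v: "v \<in> carrier (tensor T N P)"
  have "tensor_lift T N P G (F (x \<odot>\<^sub>r\<^bsub>M\<^esub> s)) = tensor_lift T N P G (\<lambda>y z. F x (s \<odot>\<^bsub>N\<^esub> y) z)"
    by (rule tensor_lift_cong) (use balanced3D(1)[OF F] s x in \<open>simp add: balanced_def\<close>)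
  then show "tensor_lift T N P G (F (x \<odot>\<^sub>r\<^bsub>M\<^esub> s)) v = tensor_lift T N P G (F x) (s \<odot>\<^bsub>tensor T N P\<^esub> v)"
    using tensor_lift_smult[OF ring_bimodule_right[OF N] P G balanced3D(2)[OF F x] N s v] by simp
qed (simp_all add: tensor_lift_closed[OF ring_bimodule_right[OF N] P G balanced3D(2)[OF F]] tensor_lift_add[OF ring_bimodule_right[OF N] P G balanced3D(2)[OF F]])

end

lemma tensor_assoc_hom:
  "tensor_assoc S T M N P \<in> add_hom (tensor T (tensor S M N) P) (tensor S M (tensor T N P))"
  unfolding tensor_assoc_def Let_def
  by (rule tensor_lift_hom[OF MN.right_module_axioms P _ balanced3_lift_left])
    (simp_all add: tensor_abelian_group[OF M NP.left_module_axioms] balanced3_tens_right)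

lemma tensor_assoc_tens:
  assumes "x \<in> carrier M" "y \<in> carrier N" "z \<in> carrier P"
  shows "tensor_assoc S T M N P (tens T (tensor S M N) P (tens S M N x y) z) =
    tens S M (tensor T N P) x (tens T N P y z)"
proof -
  note G = tensor_abelian_group[OF M NP.left_module_axioms]
  show ?thesis
    unfolding tensor_assoc_def Let_def
    using assms tens_closed[OF M ring_bimodule_left[OF N]]
      tensor_lift_tens[OF MN.right_module_axioms P G balanced3_lift_left[OF G balanced3_tens_right]]
      tensor_lift_tens[OF M ring_bimodule_left[OF N] G balanced3D(1)[OF balanced3_tens_right]]
    by simp
qed

text \<open>The associator keeps the three legs x, y, z, so F gives the same value in either
  bracketing. With this, coassociativity becomes an identity of iterated Sweedler sums in which no
  associator occurs.\<close>

lemma tensor_lift_tensor_assoc: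
  assumes G: "abelian_group G" and F: "balanced3 S T M N P G F"
    and w: "w \<in> carrier (tensor T (tensor S M N) P)"
  shows "tensor_lift S M (tensor T N P) G (\<lambda>x v. tensor_lift T N P G (F x) v) (tensor_assoc S T M N P w) =
    tensor_lift T (tensor S M N) P G (\<lambda>u z. tensor_lift S M N G (\<lambda>x y. F x y z) u) w"
proof -
  note MNP = tensor_abelian_group[OF M NP.left_module_axioms]
  let ?h = "tensor_lift S M (tensor T N P) G (\<lambda>x v. tensor_lift T N P G (F x) v)"
  have h: "?h \<in> add_hom (tensor S M (tensor T N P)) G"
    by (rule tensor_lift_hom[OF M NP.left_module_axioms G balanced3_lift_right[OF G F]])
  have "?h (tensor_assoc S T M N P w) = tensor_lift T (tensor S M N) P G
      (\<lambda>u z. ?h (tensor_lift S M N (tensor S M (tensor T N P))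
        (\<lambda>x y. tens S M (tensor T N P) x (tens T N P y z)) u)) w"
    unfolding tensor_assoc_def Let_def
    by (rule add_hom_tensor_lift[OF MN.right_module_axioms P MNP G
          balanced3_lift_left[OF MNP balanced3_tens_right] h w])
  also have "\<dots> = tensor_lift T (tensor S M N) P G (\<lambda>u z. tensor_lift S M N G (\<lambda>x y. F x y z) u) w"
  proof (intro tensor_lift_apply_cong)
    fix u z assume u: "u \<in> carrier (tensor S M N)" and z: "z \<in> carrier P"
    have "tensor_lift S M N G (\<lambda>x y. ?h (tens S M (tensor T N P) x (tens T N P y z))) =
        tensor_lift S M N G (\<lambda>x y. F x y z)"
      by (rule tensor_lift_cong)
        (simp add: z tens_closed[OF ring_bimodule_right[OF N] P] tensor_lift_tens[OF M NP.left_module_axioms G balanced3_lift_right[OF G F]]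
          tensor_lift_tens[OF ring_bimodule_right[OF N] P G balanced3D(2)[OF F]])
    then show "?h (tensor_lift S M N (tensor S M (tensor T N P))
        (\<lambda>x y. tens S M (tensor T N P) x (tens T N P y z)) u) = tensor_lift S M N G (\<lambda>x y. F x y z) u"
      using add_hom_tensor_lift[OF M ring_bimodule_left[OF N] MNP G balanced3D(1)[OF balanced3_tens_right z] h u] by simp
  qed
  finally show ?thesis .
qed

end

text \<open>The working form of moving an additive map inside a Sweedler sum: the summand is
  simplified on the carriers at the same time.\<close>

lemma add_hom_tensor_lift_eq:
  assumes M: "right_module S M" and N: "left_module S N"
    and G: "abelian_group G" "abelian_group G'" and f: "balanced S M N G f"
    and h: "h \<in> add_hom G G'" and u: "u \<in> carrier (tensor S M N)"
    and eq: "\<And>x y. \<lbrakk>x \<in> carrier M; y \<in> carrier N\<rbrakk> \<Longrightarrow> h (f x y) = f' x y"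
  shows "h (tensor_lift S M N G f u) = tensor_lift S M N G' f' u"
proof -
  have "tensor_lift S M N G' (\<lambda>x y. h (f x y)) = tensor_lift S M N G' f'"
    by (rule tensor_lift_cong) (rule eq)
  with add_hom_tensor_lift[OF M N G f h u] show ?thesis by simp
qed

lemma add_hom_eq_tensor_lift:
  assumes M: "right_module S M" and N: "left_module S N" and G: "abelian_group G"
    and h: "h \<in> add_hom (tensor S M N) G" and u: "u \<in> carrier (tensor S M N)"
    and eq: "\<And>x y. \<lbrakk>x \<in> carrier M; y \<in> carrier N\<rbrakk> \<Longrightarrow> h (tens S M N x y) = f x y"
  shows "h u = tensor_lift S M N G f u"
  using add_hom_tensor_lift_eq[OF M N tensor_abelian_group[OF M N] G balanced_tens[OF M N] h u eq]
  by (simp add: tensor_lift_tens_id[OF M N u])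

lemma tens_right_hom:
  assumes M: "right_module S M" and N: "ring_bimodule S T N" and x: "x \<in> carrier M"
  shows "tens S M N x \<in> right_hom T N (tensor S M N)"
  using x by (intro right_homI)
    (simp_all add: tens_closed[OF M ring_bimodule_left[OF N]] rsmult_tens[OF M N]
      tens_add_right[OF M ring_bimodule_left[OF N]])

lemma tens_add_hom:
  assumes M: "right_module S M" and N: "left_module S N"
  shows "x \<in> carrier M \<Longrightarrow> tens S M N x \<in> add_hom N (tensor S M N)"
    and "y \<in> carrier N \<Longrightarrow> (\<lambda>x. tens S M N x y) \<in> add_hom M (tensor S M N)"
  by (auto intro!: add_homI simp: tens_closed[OF M N] tens_add_left[OF M N] tens_add_right[OF M N])

lemma tensor_map_right_hom:
  assumes M: "right_module S M" and N: "ring_bimodule S T N"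
    and M': "right_module S M'" and N': "ring_bimodule S T N'"
    and f: "f \<in> right_hom S M M'" and g: "g \<in> left_hom S N N'" "g \<in> right_hom T N N'"
  shows "tensor_map S M N M' N' f g \<in> right_hom T (tensor S M N) (tensor S M' N')"
  unfolding tensor_map_def
proof (rule tensor_lift_right_hom[OF M N tensor_right_module[OF M' N']])
  show "balanced S M N (tensor S M' N') (\<lambda>x y. tens S M' N' (f x) (g y))"
    by (rule balanced_tensor_map[OF M ring_bimodule_left[OF N] M' ring_bimodule_left[OF N'] f g(1)])
qed (simp add: right_hom_rsmult[OF g(2)] rsmult_tens[OF M' N'] add_hom_closed[OF right_hom_add_hom[OF f]]
    add_hom_closed[OF left_hom_add_hom[OF g(1)]])

lemma balanced3_comp_left:
  assumes "balanced3 S T M' N P G F" "f \<in> right_hom S M M'"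
  shows "balanced3 S T M N P G (\<lambda>x. F (f x))"
  unfolding balanced3_def
proof (intro conjI ballI)
  fix z assume "z \<in> carrier P"
  from balanced_comp[OF balanced3D(1)[OF assms(1) this] assms(2) id_left_hom]
  show "balanced S M N G (\<lambda>x y. F (f x) y z)" by simp
next
  fix x assume "x \<in> carrier M"
  then show "balanced T N P G (F (f x))"
    by (intro balanced3D(2)[OF assms(1)] add_hom_closed[OF right_hom_add_hom[OF assms(2)]])
qed

lemma ring_bimod_simps [simp]:
  "carrier (ring_bimod A f g) = carrier A"
  "\<zero>\<^bsub>ring_bimod A f g\<^esub> = \<zero>\<^bsub>A\<^esub>"
  "x \<oplus>\<^bsub>ring_bimod A f g\<^esub> y = x \<oplus>\<^bsub>A\<^esub> y"
  "l \<odot>\<^bsub>ring_bimod A f g\<^esub> x = f l \<otimes>\<^bsub>A\<^esub> x"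
  "x \<odot>\<^sub>r\<^bsub>ring_bimod A f g\<^esub> s = x \<otimes>\<^bsub>A\<^esub> g s"
  by (simp_all add: ring_bimod_def)

section \<open>Corings and comodules\<close>

locale coring_locale =
  fixes K :: "'k ring" and S :: "('k, 's, 'x) module_scheme" and C :: "('s, 'c, 's) bimod" and \<Delta> \<epsilon>
  assumes coring: "coring K S C \<Delta> \<epsilon>"
begin

lemma bimodule_C: "ring_bimodule S S C"
  using coring unfolding coring_def by (blast intro: bimodule_ring_bimodule)

lemma left_C: "left_module S C" and right_C: "right_module S C"
  using bimodule_C by (simp_all add: ring_bimodule_def)

interpretation C: ring_bimodule S S C by (rule bimodule_C)

lemma \<Delta>_left: "\<Delta> \<in> left_hom S C (tensor S C C)"
  and \<Delta>_right: "\<Delta> \<in> right_hom S C (tensor S C C)"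
  and \<epsilon>_left: "\<epsilon> \<in> left_hom S C (ring_bimod S id id)"
  and \<epsilon>_right: "\<epsilon> \<in> right_hom S C (ring_bimod S id id)"
  using coring by (simp_all add: coring_def)

lemmas \<Delta>_closed = add_hom_closed[OF left_hom_add_hom[OF \<Delta>_left]]

lemma \<epsilon>_closed: "c \<in> carrier C \<Longrightarrow> \<epsilon> c \<in> carrier S"
  using add_hom_closed[OF left_hom_add_hom[OF \<epsilon>_left]] by simp

lemma \<epsilon>_add: "\<lbrakk>c \<in> carrier C; c' \<in> carrier C\<rbrakk> \<Longrightarrow> \<epsilon> (c \<oplus>\<^bsub>C\<^esub> c') = \<epsilon> c \<oplus>\<^bsub>S\<^esub> \<epsilon> c'"
  using add_hom_add[OF left_hom_add_hom[OF \<epsilon>_left]] by simp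

lemma \<epsilon>_smult: "\<lbrakk>s \<in> carrier S; c \<in> carrier C\<rbrakk> \<Longrightarrow> \<epsilon> (s \<odot>\<^bsub>C\<^esub> c) = s \<otimes>\<^bsub>S\<^esub> \<epsilon> c"
  and \<epsilon>_rsmult: "\<lbrakk>s \<in> carrier S; c \<in> carrier C\<rbrakk> \<Longrightarrow> \<epsilon> (c \<odot>\<^sub>r\<^bsub>C\<^esub> s) = \<epsilon> c \<otimes>\<^bsub>S\<^esub> s"
  using left_hom_smult[OF \<epsilon>_left] right_hom_rsmult[OF \<epsilon>_right] by simp_all

lemma balanced_counit_left: "balanced S C C C (\<lambda>c1 c2. \<epsilon> c1 \<odot>\<^bsub>C\<^esub> c2)"
  by (rule balancedI)
    (simp_all add: \<epsilon>_closed \<epsilon>_add \<epsilon>_rsmult C.lsmult_closed C.lsmult_l_distr C.lsmult_r_distr C.lsmult_assoc)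

lemma balanced_counit:
  assumes "right_module S M"
  shows "balanced S M C M (\<lambda>x c. x \<odot>\<^sub>r\<^bsub>M\<^esub> \<epsilon> c)"
proof -
  interpret M: right_module S M by fact
  show ?thesis
    by (rule balancedI)
      (simp_all add: \<epsilon>_closed \<epsilon>_add \<epsilon>_smult M.rsmult_closed M.rsmult_l_distr M.rsmult_r_distr M.rsmult_assoc)
qed

lemma counit_left: "c \<in> carrier C \<Longrightarrow> tensor_lift S C C C (\<lambda>c1 c2. \<epsilon> c1 \<odot>\<^bsub>C\<^esub> c2) (\<Delta> c) = c"
  and counit_right: "c \<in> carrier C \<Longrightarrow> tensor_lift S C C C (\<lambda>c1 c2. c1 \<odot>\<^sub>r\<^bsub>C\<^esub> \<epsilon> c2) (\<Delta> c) = c"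
  using coring by (simp_all add: coring_def)

text \<open>Coassociativity tested against an arbitrary balanced map of three legs. Both sides are
  values of the lift of F, at (\<rho> \<otimes> id)(\<rho>(x)) and at (id \<otimes>
  \<Delta>)(\<rho>(x)), which the associator identifies.\<close>

lemma comodule_coassoc:
  assumes M: "comodule S C \<Delta> \<epsilon> M \<rho>" and G: "abelian_group G"
    and F: "balanced3 S S M C C G F" and x: "x \<in> carrier M"
  shows "tensor_lift S M C G (\<lambda>m c. tensor_lift S M C G (\<lambda>m' c'. F m' c' c) (\<rho> m)) (\<rho> x) =
    tensor_lift S M C G (\<lambda>m c. tensor_lift S C C G (F m) (\<Delta> c)) (\<rho> x)"
proof -
  have M': "right_module S M" and \<rho>: "\<rho> \<in> right_hom S M (tensor S M C)"
    and eq: "tensor_assoc S S M C C (tensor_map S M C (tensor S M C) C \<rho> id (\<rho> x)) =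
        tensor_map S M C M (tensor S C C) id \<Delta> (\<rho> x)"
    using M x by (simp_all add: comodule_def)
  note MC = tensor_right_module[OF M' bimodule_C] and CC = tensor_left_module[OF bimodule_C left_C]
  have \<rho>x: "\<rho> x \<in> carrier (tensor S M C)"
    by (rule add_hom_closed[OF right_hom_add_hom[OF \<rho>] x])
  have "tensor_lift S M C G (\<lambda>m c. tensor_lift S M C G (\<lambda>m' c'. F m' c' c) (\<rho> m)) (\<rho> x) =
      tensor_lift S (tensor S M C) C G (\<lambda>u z. tensor_lift S M C G (\<lambda>x y. F x y z) u)
        (tensor_map S M C (tensor S M C) C \<rho> id (\<rho> x))"
    by (subst tensor_lift_tensor_map[OF M' left_C MC left_C \<rho> id_left_hom G
          balanced3_lift_left[OF M' bimodule_C left_C G F] \<rho>x]) simp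
  also have "\<dots> = tensor_lift S M (tensor S C C) G (\<lambda>x v. tensor_lift S C C G (F x) v)
      (tensor_map S M C M (tensor S C C) id \<Delta> (\<rho> x))"
    unfolding eq[symmetric]
    by (rule tensor_lift_tensor_assoc[OF M' bimodule_C left_C G F, symmetric])
      (rule add_hom_closed[OF tensor_map_hom[OF M' left_C MC left_C \<rho> id_left_hom] \<rho>x])
  also have "\<dots> = tensor_lift S M C G (\<lambda>m c. tensor_lift S C C G (F m) (\<Delta> c)) (\<rho> x)"
    by (subst tensor_lift_tensor_map[OF M' left_C M' CC id_right_hom \<Delta>_left G
          balanced3_lift_right[OF M' bimodule_C left_C G F] \<rho>x]) simp
  finally show ?thesis .
qed

text \<open>Viewing C as a comodule over itself makes coassociativity of \<Delta> an instance of
  \<open>comodule_coassoc\<close>.\<close>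

lemma comodule_coring: "comodule S C \<Delta> \<epsilon> C \<Delta>"
  using coring right_C by (simp add: comodule_def coring_def)

lemmas coassoc = comodule_coassoc[OF comodule_coring]

section \<open>The cofree comodule X \<otimes> C\<close>

context
  fixes X :: "('l, 'm, 's) bimod"
  assumes X: "right_module S X"
begin

lemma balanced_tensor_coaction:
  "balanced S X C (tensor S (tensor S X C) C)
    (\<lambda>x d. tensor_lift S C C (tensor S (tensor S X C) C)
      (\<lambda>d1 d2. tens S (tensor S X C) C (tens S X C x d1) d2) (\<Delta> d))"
  using balanced_comp[OF balanced3_lift_right[OF X bimodule_C left_C _ balanced3_tens_left[OF X bimodule_C left_C]]
      id_right_hom \<Delta>_left]
  by (simp add: tensor_abelian_group[OF tensor_right_module[OF X bimodule_C] left_C])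

lemma tensor_coaction_tens:
  "\<lbrakk>x \<in> carrier X; d \<in> carrier C\<rbrakk> \<Longrightarrow> tensor_coaction S X C \<Delta> (tens S X C x d) =
    tensor_lift S C C (tensor S (tensor S X C) C)
      (\<lambda>d1 d2. tens S (tensor S X C) C (tens S X C x d1) d2) (\<Delta> d)"
  unfolding tensor_coaction_def Let_def
  by (rule tensor_lift_tens[OF X left_C _ balanced_tensor_coaction])
    (simp_all add: tensor_abelian_group[OF tensor_right_module[OF X bimodule_C] left_C])

lemma tensor_coaction_right_hom:
  "tensor_coaction S X C \<Delta> \<in> right_hom S (tensor S X C) (tensor S (tensor S X C) C)"
proof -
  note Y = tensor_right_module[OF X bimodule_C]
  note b = balanced3D(2)[OF balanced3_tens_left[OF X bimodule_C left_C]]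
  show ?thesis
    unfolding tensor_coaction_def Let_def
  proof (rule tensor_lift_right_hom[OF X bimodule_C tensor_right_module[OF Y bimodule_C] balanced_tensor_coaction])
    fix t x d assume t: "t \<in> carrier S" and x: "x \<in> carrier X" and d: "d \<in> carrier C"
    have "tensor_lift S C C (tensor S (tensor S X C) C)
        (\<lambda>d1 d2. tens S (tensor S X C) C (tens S X C x d1) d2)
      \<in> right_hom S (tensor S C C) (tensor S (tensor S X C) C)"
      by (rule tensor_lift_right_hom[OF right_C bimodule_C tensor_right_module[OF Y bimodule_C] b[OF x]])
        (simp add: rsmult_tens[OF Y bimodule_C] x tens_closed[OF X left_C])
    from right_hom_rsmult[OF this \<Delta>_closed[OF d] t]
    show "tensor_lift S C C (tensor S (tensor S X C) C)
          (\<lambda>d1 d2. tens S (tensor S X C) C (tens S X C x d1) d2) (\<Delta> (d \<odot>\<^sub>r\<^bsub>C\<^esub> t)) =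
        tensor_lift S C C (tensor S (tensor S X C) C)
          (\<lambda>d1 d2. tens S (tensor S X C) C (tens S X C x d1) d2) (\<Delta> d) \<odot>\<^sub>r\<^bsub>tensor S (tensor S X C) C\<^esub> t"
      by (simp add: right_hom_rsmult[OF \<Delta>_right d t])
  qed
qed

lemma tensor_coaction_left_hom:
  assumes LX: "ring_bimodule L S X"
  shows "tensor_coaction S X C \<Delta> \<in> left_hom L (tensor S X C) (tensor S (tensor S X C) C)"
proof -
  note Y = tensor_ring_bimodule[OF LX bimodule_C]
  note Z = tensor_left_module[OF Y left_C]
  note b = balanced3D(2)[OF balanced3_tens_left[OF X bimodule_C left_C]]
  interpret LX: ring_bimodule L S X by fact
  show ?thesis
    unfolding tensor_coaction_def Let_def
  proof (rule tensor_lift_left_hom[OF LX left_C Z balanced_tensor_coaction])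
    fix a x d assume a: "a \<in> carrier L" and x: "x \<in> carrier X" and d: "d \<in> carrier C"
    show "tensor_lift S C C (tensor S (tensor S X C) C)
          (\<lambda>d1 d2. tens S (tensor S X C) C (tens S X C (a \<odot>\<^bsub>X\<^esub> x) d1) d2) (\<Delta> d) =
        a \<odot>\<^bsub>tensor S (tensor S X C) C\<^esub> tensor_lift S C C (tensor S (tensor S X C) C)
          (\<lambda>d1 d2. tens S (tensor S X C) C (tens S X C x d1) d2) (\<Delta> d)"
      by (rule add_hom_tensor_lift_eq[OF right_C left_C _ _ b[OF x] left_module_smult_hom[OF Z a] \<Delta>_closed[OF d],
            symmetric])
        (simp_all add: left_module_abelian_group[OF Z] a x smult_tens[OF Y left_C] smult_tens[OF LX left_C]
          tens_closed[OF X left_C])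
  qed
qed

text \<open>On a pure tensor x \<otimes> d both axioms reduce to those of the coring, with x carried
  along: coassociativity of \<Delta> tested against \<open>?F\<close>, and the right counit law
  inside the second factor.\<close>

lemma comodule_tensor_coaction: "comodule S C \<Delta> \<epsilon> (tensor S X C) (tensor_coaction S X C \<Delta>)"
proof -
  let ?Y = "tensor S X C" and ?c = "tensor_coaction S X C \<Delta>"
  let ?Z = "tensor S ?Y C" and ?W = "tensor S ?Y (tensor S C C)"
  note Y = tensor_right_module[OF X bimodule_C]
  note CC = tensor_left_module[OF bimodule_C left_C]
  note Z = tensor_right_module[OF Y bimodule_C]
  note gY = right_module_abelian_group[OF Y] and gZ = right_module_abelian_group[OF Z]
    and gW = tensor_abelian_group[OF Y CC]
  note tY = tens_closed[OF X left_C] and tZ = tens_closed[OF Y left_C]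
  note c = tensor_coaction_right_hom and ch = right_hom_add_hom[OF tensor_coaction_right_hom]
  note cc = add_hom_closed[OF ch]
  note b = balanced3D(2)[OF balanced3_tens_left[OF X bimodule_C left_C]]
  have assoc: "tensor_assoc S S ?Y C C (tensor_map S ?Y C ?Z C ?c id (?c u)) =
      tensor_map S ?Y C ?Y (tensor S C C) id \<Delta> (?c u)" if u: "u \<in> carrier ?Y" for u
  proof (rule tensor_hom_eqI[OF X left_C _ _ _ u, where
        h = "\<lambda>u. tensor_assoc S S ?Y C C (tensor_map S ?Y C ?Z C ?c id (?c u))"
        and k = "\<lambda>u. tensor_map S ?Y C ?Y (tensor S C C) id \<Delta> (?c u)"])
    have h1: "(\<lambda>w. tensor_assoc S S ?Y C C (tensor_map S ?Y C ?Z C ?c id w)) \<in> add_hom ?Z ?W"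
      by (rule add_hom_comp[OF tensor_map_hom[OF Y left_C Z left_C c id_left_hom]
            tensor_assoc_hom[OF Y bimodule_C left_C]])
    have h2: "tensor_map S ?Y C ?Y (tensor S C C) id \<Delta> \<in> add_hom ?Z ?W"
      by (rule tensor_map_hom[OF Y left_C Y CC id_right_hom \<Delta>_left])
    show "(\<lambda>u. tensor_assoc S S ?Y C C (tensor_map S ?Y C ?Z C ?c id (?c u))) \<in> add_hom ?Y ?W"
      by (rule add_hom_comp[OF ch h1])
    show "(\<lambda>u. tensor_map S ?Y C ?Y (tensor S C C) id \<Delta> (?c u)) \<in> add_hom ?Y ?W"
      by (rule add_hom_comp[OF ch h2])
    fix x d assume x: "x \<in> carrier X" and d: "d \<in> carrier C"
    let ?F = "\<lambda>d1 d2 d3. tens S ?Y (tensor S C C) (tens S X C x d1) (tens S C C d2 d3)"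
    have F: "balanced3 S S C C C ?W ?F"
      by (rule balanced3_comp_left[OF balanced3_tens_right[OF Y bimodule_C left_C] tens_right_hom[OF X bimodule_C x]])
    have "tensor_assoc S S ?Y C C (tensor_map S ?Y C ?Z C ?c id (?c (tens S X C x d))) =
        tensor_lift S C C ?W (\<lambda>d1 d2. tensor_lift S C C ?W (\<lambda>d1' d2'. ?F d1' d2' d2) (\<Delta> d1)) (\<Delta> d)"
      unfolding tensor_coaction_tens[OF x d]
    proof (rule add_hom_tensor_lift_eq[OF right_C left_C gZ gW b[OF x] h1 \<Delta>_closed[OF d]])
      fix d1 d2 assume d12: "d1 \<in> carrier C" "d2 \<in> carrier C"
      have "tensor_assoc S S ?Y C C (tensor_map S ?Y C ?Z C ?c id (tens S ?Y C (tens S X C x d1) d2)) =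
          tensor_assoc S S ?Y C C (tens S ?Z C (?c (tens S X C x d1)) d2)"
        by (simp add: tensor_map_tens[OF Y left_C Z left_C c id_left_hom] tY x d12)
      also have "\<dots> = tensor_lift S C C ?W (\<lambda>d1' d2'. ?F d1' d2' d2) (\<Delta> d1)"
        unfolding tensor_coaction_tens[OF x d12(1)]
        by (rule add_hom_tensor_lift_eq[OF right_C left_C gZ gW b[OF x]
              add_hom_comp[OF tens_add_hom(2)[OF Z left_C d12(2)] tensor_assoc_hom[OF Y bimodule_C left_C]]
              \<Delta>_closed[OF d12(1)]])
          (simp add: tensor_assoc_tens[OF Y bimodule_C left_C] tY x d12)
      finally show "tensor_assoc S S ?Y C C (tensor_map S ?Y C ?Z C ?c id (tens S ?Y C (tens S X C x d1) d2)) =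
          tensor_lift S C C ?W (\<lambda>d1' d2'. ?F d1' d2' d2) (\<Delta> d1)" .
    qed
    also have "\<dots> = tensor_lift S C C ?W (\<lambda>d1 d2. tensor_lift S C C ?W (?F d1) (\<Delta> d2)) (\<Delta> d)"
      by (rule coassoc[OF gW F d])
    also have "\<dots> = tensor_map S ?Y C ?Y (tensor S C C) id \<Delta> (?c (tens S X C x d))"
      unfolding tensor_coaction_tens[OF x d]
    proof (rule add_hom_tensor_lift_eq[OF right_C left_C gZ gW b[OF x] h2 \<Delta>_closed[OF d], symmetric])
      fix d1 d2 assume d12: "d1 \<in> carrier C" "d2 \<in> carrier C"
      have "tensor_map S ?Y C ?Y (tensor S C C) id \<Delta> (tens S ?Y C (tens S X C x d1) d2) =
          tens S ?Y (tensor S C C) (tens S X C x d1) (\<Delta> d2)"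
        by (simp add: tensor_map_tens[OF Y left_C Y CC id_right_hom \<Delta>_left] tY x d12)
      also have "\<dots> = tensor_lift S C C ?W (?F d1) (\<Delta> d2)"
        by (rule add_hom_eq_tensor_lift[OF right_C left_C gW tens_add_hom(1)[OF Y CC] \<Delta>_closed[OF d12(2)]])
          (simp_all add: tY x d12)
      finally show "tensor_map S ?Y C ?Y (tensor S C C) id \<Delta> (tens S ?Y C (tens S X C x d1) d2) =
          tensor_lift S C C ?W (?F d1) (\<Delta> d2)" .
    qed
    finally show "tensor_assoc S S ?Y C C (tensor_map S ?Y C ?Z C ?c id (?c (tens S X C x d))) =
        tensor_map S ?Y C ?Y (tensor S C C) id \<Delta> (?c (tens S X C x d))" .
  qed
  have counit: "tensor_lift S ?Y C ?Y (\<lambda>y c. y \<odot>\<^sub>r\<^bsub>?Y\<^esub> \<epsilon> c) (?c u) = u" if u: "u \<in> carrier ?Y" for u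
  proof (rule tensor_hom_eqI[OF X left_C _ _ _ u, where
        h = "\<lambda>u. tensor_lift S ?Y C ?Y (\<lambda>y c. y \<odot>\<^sub>r\<^bsub>?Y\<^esub> \<epsilon> c) (?c u)" and k = "\<lambda>u. u"])
    note be = balanced_counit[OF Y]
    have h: "tensor_lift S ?Y C ?Y (\<lambda>y c. y \<odot>\<^sub>r\<^bsub>?Y\<^esub> \<epsilon> c) \<in> add_hom ?Z ?Y"
      by (rule tensor_lift_hom[OF Y left_C gY be])
    show "(\<lambda>u. tensor_lift S ?Y C ?Y (\<lambda>y c. y \<odot>\<^sub>r\<^bsub>?Y\<^esub> \<epsilon> c) (?c u)) \<in> add_hom ?Y ?Y"
      by (rule add_hom_comp[OF ch h])
    fix x d assume x: "x \<in> carrier X" and d: "d \<in> carrier C"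
    have "tensor_lift S ?Y C ?Y (\<lambda>y c. y \<odot>\<^sub>r\<^bsub>?Y\<^esub> \<epsilon> c) (?c (tens S X C x d)) =
        tensor_lift S C C ?Y (\<lambda>d1 d2. tens S X C x (d1 \<odot>\<^sub>r\<^bsub>C\<^esub> \<epsilon> d2)) (\<Delta> d)"
      unfolding tensor_coaction_tens[OF x d]
      by (rule add_hom_tensor_lift_eq[OF right_C left_C gZ gY b[OF x] h \<Delta>_closed[OF d]])
        (simp add: tensor_lift_tens[OF Y left_C gY be] tY x rsmult_tens[OF X bimodule_C] \<epsilon>_closed)
    also have "\<dots> = tens S X C x (tensor_lift S C C C (\<lambda>d1 d2. d1 \<odot>\<^sub>r\<^bsub>C\<^esub> \<epsilon> d2) (\<Delta> d))"
      by (rule add_hom_tensor_lift[OF right_C left_C C.M.abelian_group_axioms gY balanced_counit[OF right_C]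
            tens_add_hom(1)[OF X left_C x] \<Delta>_closed[OF d], symmetric])
    finally show "tensor_lift S ?Y C ?Y (\<lambda>y c. y \<odot>\<^sub>r\<^bsub>?Y\<^esub> \<epsilon> c) (?c (tens S X C x d)) = tens S X C x d"
      by (simp add: counit_right[OF d])
  qed (simp add: hom_def)
  show ?thesis
    using assoc counit by (simp add: comodule_def Y c)
qed

text \<open>One half of the universal property of the cofree comodule: applying p to the first leg
  of \<rho> is colinear because \<rho> is coassociative.\<close>

lemma comodule_hom_tensor_map_coaction:
  assumes M: "comodule S C \<Delta> \<epsilon> M \<rho>" and p: "p \<in> right_hom S M X"
  shows "(\<lambda>x. tensor_map S M C X C p id (\<rho> x))
    \<in> comodule_hom S C M \<rho> (tensor S X C) (tensor_coaction S X C \<Delta>)"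
proof -
  let ?Y = "tensor S X C" and ?c = "tensor_coaction S X C \<Delta>"
  let ?Z = "tensor S ?Y C" and ?q = "tensor_map S M C X C p id"
  have M': "right_module S M" and \<rho>: "\<rho> \<in> right_hom S M (tensor S M C)"
    using M by (simp_all add: comodule_def)
  note pc = add_hom_closed[OF right_hom_add_hom[OF p]]
  note Y = tensor_right_module[OF X bimodule_C]
  note gY = right_module_abelian_group[OF Y] and gZ = tensor_abelian_group[OF Y left_C]
  note bp = balanced_tensor_map[OF M' left_C X left_C p id_left_hom]
  have q: "?q \<in> right_hom S (tensor S M C) ?Y"
    by (rule tensor_map_right_hom[OF M' bimodule_C X bimodule_C p id_left_hom id_right_hom])
  have f: "(\<lambda>x. ?q (\<rho> x)) \<in> right_hom S M ?Y"
    using q \<rho> by (auto simp: right_hom_def hom_def Pi_iff)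
  have "?c (?q (\<rho> x)) = tensor_map S M C ?Y C (\<lambda>x. ?q (\<rho> x)) id (\<rho> x)" if x: "x \<in> carrier M" for x
  proof -
    let ?F = "\<lambda>m d1 d2. tens S ?Y C (tens S X C (p m) d1) d2"
    have F: "balanced3 S S M C C ?Z ?F"
      by (rule balanced3_comp_left[OF balanced3_tens_left[OF X bimodule_C left_C] p])
    have \<rho>x: "\<rho> y \<in> carrier (tensor S M C)" if "y \<in> carrier M" for y
      by (rule add_hom_closed[OF right_hom_add_hom[OF \<rho>] that])
    have "?c (?q (\<rho> x)) = tensor_lift S M C ?Z (\<lambda>m d. tensor_lift S C C ?Z (?F m) (\<Delta> d)) (\<rho> x)"
      unfolding tensor_map_def
      by (rule add_hom_tensor_lift_eq[OF M' left_C gY gZ bp right_hom_add_hom[OF tensor_coaction_right_hom] \<rho>x[OF x]])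
        (simp add: tensor_coaction_tens pc)
    also have "\<dots> = tensor_lift S M C ?Z (\<lambda>m d. tensor_lift S M C ?Z (\<lambda>m' d'. ?F m' d' d) (\<rho> m)) (\<rho> x)"
      by (rule comodule_coassoc[OF M gZ F x, symmetric])
    also have "\<dots> = tensor_lift S M C ?Z (\<lambda>m d. tens S ?Y C (?q (\<rho> m)) d) (\<rho> x)"
    proof (intro tensor_lift_apply_cong)
      fix m d assume md: "m \<in> carrier M" "d \<in> carrier C"
      show "tensor_lift S M C ?Z (\<lambda>m' d'. ?F m' d' d) (\<rho> m) = tens S ?Y C (?q (\<rho> m)) d"
        unfolding tensor_map_def
        by (rule add_hom_tensor_lift_eq[OF M' left_C gY gZ bp tens_add_hom(2)[OF Y left_C md(2)] \<rho>x[OF md(1)], symmetric])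
          simp
    qed
    finally show ?thesis
      by (simp add: tensor_map_def[of S M C ?Y])
  qed
  with f show ?thesis
    by (simp add: comodule_hom_def)
qed

end

text \<open>The case p = id of the universal property. It is coassociativity of \<rho> with both
  sides already bracketed as (M \<otimes> C) \<otimes> C.\<close>

lemma tensor_coaction_coaction:
  assumes M: "comodule S C \<Delta> \<epsilon> M \<rho>" and x: "x \<in> carrier M"
  shows "tensor_coaction S M C \<Delta> (\<rho> x) =
    tensor_lift S M C (tensor S (tensor S M C) C) (\<lambda>m d. tens S (tensor S M C) C (\<rho> m) d) (\<rho> x)"
proof -
  have M': "right_module S M" and \<rho>: "\<And>x. x \<in> carrier M \<Longrightarrow> \<rho> x \<in> carrier (tensor S M C)"
    using M by (auto simp: comodule_def right_hom_def hom_def)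
  have "tensor_coaction S M C \<Delta> (\<rho> x) =
      tensor_map S M C (tensor S M C) C (\<lambda>x. tensor_map S M C M C id id (\<rho> x)) id (\<rho> x)"
    using comodule_hom_tensor_map_coaction[OF M' M id_right_hom] x \<rho>
    by (simp add: comodule_hom_def tensor_map_id[OF M' left_C])
  also have "\<dots> = tensor_lift S M C (tensor S (tensor S M C) C) (\<lambda>m d. tens S (tensor S M C) C (\<rho> m) d) (\<rho> x)"
    unfolding tensor_map_def[of _ _ _ "tensor S M C"]
    by (intro tensor_lift_apply_cong)
      (simp add: \<rho> tensor_map_id[OF M' left_C])
  finally show ?thesis .
qed

end

text \<open>Only the carrier and the addition of the target enter the description of the induced
  map. This allows exchanging targets that differ in their actions, such as A and its
  \<open>ring_bimod\<close> versions, or A \<otimes> D with its two right actions.\<close>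

lemma tensor_lift_target:
  assumes "carrier G = carrier G'" "ring.add G = ring.add G'"
  shows "tensor_lift S M N G f = tensor_lift S M N G' f"
  using assms by (simp add: tensor_lift_def hom_def)

text \<open>The relations defining a tensor product involve the right action of the first factor and
  the left action of the second. Changing the right action of the second factor leaves the
  underlying group and its pure tensors as they are.\<close>

lemma tens_with_right_action: "tens S M (with_right_action N act) = tens S M N"
  and carrier_tensor_with_right_action:
    "carrier (tensor S M (with_right_action N act)) = carrier (tensor S M N)"
  and add_tensor_with_right_action:
    "ring.add (tensor S M (with_right_action N act)) = ring.add (tensor S M N)"
  by (simp_all add: tensor_def tens_def[abs_def] tensor_class_def[abs_def] tensor_null_def tensor_rel_def
      tensor_free_def with_right_action_def Let_def)

lemma tensor_lift_ring_bimod: "tensor_lift S M N (ring_bimod A f g) = tensor_lift S M N A"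
  by (intro ext tensor_lift_target) (simp_all add: ring_bimod_def)

lemma ring_bimodule_ring_bimod:
  assumes "ring A" "ring L" "ring S" "f \<in> ring_hom L A" "g \<in> ring_hom S A"
  shows "ring_bimodule L S (ring_bimod A f g)"
proof -
  interpret A: ring A by fact
  interpret L: ring L by fact
  interpret S: ring S by fact
  interpret f: ring_hom_ring L A f using assms by (intro ring_hom_ringI2)
  interpret g: ring_hom_ring S A g using assms by (intro ring_hom_ringI2)
  have "abelian_group (ring_bimod A f g)"
    by (rule abelian_groupI) (auto simp: A.a_ac intro: bexI[of _ "\<ominus>\<^bsub>A\<^esub> x" for x] A.l_neg)
  then interpret M: abelian_group "ring_bimod A f g" .
  show ?thesis
    by unfold_locales (simp_all add: A.l_distr A.r_distr A.m_assoc)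
qed

section \<open>Extensions by a coring and the ring of coinvariants\<close>

locale coring_ext =
  D: coring_locale K R D \<Delta> \<epsilon>
  for K :: "'k ring" and R :: "('k, 'r) module" and A :: "('k, 'a) module" and \<eta> :: "'r \<Rightarrow> 'a"
    and D :: "('r, 'd, 'r) bimod" and \<Delta> :: "'d \<Rightarrow> ('d \<times> 'd \<Rightarrow>\<^sub>0 int) set" and \<epsilon> :: "'d \<Rightarrow> 'r"
    and \<rho> :: "'a \<Rightarrow> ('a \<times> 'd \<Rightarrow>\<^sub>0 int) set" +
  assumes ring_over: "ring_over K R A \<eta>"
    and comodule_A: "comodule R D \<Delta> \<epsilon> (ring_bimod A id \<eta>) \<rho>"
begin

abbreviation "Ar \<equiv> ring_bimod A id \<eta>"
abbreviation "Al \<equiv> ring_bimod A \<eta> id"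
abbreviation "AA \<equiv> ring_bimod A id id"
abbreviation "CR \<equiv> tensor R Ar D"
abbreviation "B \<equiv> coinvariants R A \<eta> D \<rho>"

lemma assoc_algebra_R: "assoc_algebra K R" and assoc_algebra_A: "assoc_algebra K A"
  and \<eta>_ring_hom: "\<eta> \<in> ring_hom R A"
  and \<eta>_smult: "\<lbrakk>c \<in> carrier K; r \<in> carrier R\<rbrakk> \<Longrightarrow> \<eta> (c \<odot>\<^bsub>R\<^esub> r) = c \<odot>\<^bsub>A\<^esub> \<eta> r"
  using ring_over by (simp_all add: ring_over_def algebra_hom_def)

sublocale R: ring R using assoc_algebra_R by (simp add: assoc_algebra_def)
sublocale A: ring A using assoc_algebra_A by (simp add: assoc_algebra_def)

lemma smult_closed_A [simp]: "\<lbrakk>c \<in> carrier K; x \<in> carrier A\<rbrakk> \<Longrightarrow> c \<odot>\<^bsub>A\<^esub> x \<in> carrier A"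
  and smult_closed_R [simp]: "\<lbrakk>c \<in> carrier K; r \<in> carrier R\<rbrakk> \<Longrightarrow> c \<odot>\<^bsub>R\<^esub> r \<in> carrier R"
  using module.smult_closed[OF assoc_algebra.axioms(1)[OF assoc_algebra_A]]
    module.smult_closed[OF assoc_algebra.axioms(1)[OF assoc_algebra_R]] by simp_all

sublocale \<eta>: ring_hom_ring R A \<eta>
  by (intro ring_hom_ringI2 R.ring_axioms A.ring_axioms \<eta>_ring_hom)

lemma id_ring_hom: "id \<in> ring_hom A A"
  by (simp add: ring_hom_def)

lemma bimodule_Ar: "ring_bimodule A R Ar" and bimodule_Al: "ring_bimodule R A Al"
  and bimodule_AA: "ring_bimodule A A AA"
  by (intro ring_bimodule_ring_bimod R.ring_axioms A.ring_axioms \<eta>_ring_hom id_ring_hom)+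

lemmas right_Ar = ring_bimodule_right[OF bimodule_Ar]
lemmas right_Al = ring_bimodule_right[OF bimodule_Al]

lemma bimodule_CR: "ring_bimodule A R CR"
  by (rule tensor_ring_bimodule[OF bimodule_Ar D.bimodule_C])

sublocale CR: ring_bimodule A R CR by (rule bimodule_CR)
sublocale D: ring_bimodule R R D by (rule D.bimodule_C)

lemmas left_CR = CR.left_module_axioms
lemmas right_CR = CR.right_module_axioms
lemmas group_CR = CR.M.abelian_group_axioms
lemmas group_A = A.abelian_group_axioms

lemma tens_CR: "\<lbrakk>a \<in> carrier A; d \<in> carrier D\<rbrakk> \<Longrightarrow> tens R Ar D a d \<in> carrier CR"
  using tens_closed[OF right_Ar D.left_C] by simp

lemma smult_CR:
  "\<lbrakk>a \<in> carrier A; x \<in> carrier A; d \<in> carrier D\<rbrakk>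
    \<Longrightarrow> a \<odot>\<^bsub>CR\<^esub> tens R Ar D x d = tens R Ar D (a \<otimes>\<^bsub>A\<^esub> x) d"
  using smult_tens[OF bimodule_Ar D.left_C] by simp

lemma rsmult_CR:
  "\<lbrakk>r \<in> carrier R; x \<in> carrier A; d \<in> carrier D\<rbrakk>
    \<Longrightarrow> tens R Ar D x d \<odot>\<^sub>r\<^bsub>CR\<^esub> r = tens R Ar D x (d \<odot>\<^sub>r\<^bsub>D\<^esub> r)"
  using rsmult_tens[OF right_Ar D.bimodule_C] by simp

lemma tens_CR_\<eta>:
  "\<lbrakk>r \<in> carrier R; x \<in> carrier A; d \<in> carrier D\<rbrakk>
    \<Longrightarrow> tens R Ar D (x \<otimes>\<^bsub>A\<^esub> \<eta> r) d = tens R Ar D x (r \<odot>\<^bsub>D\<^esub> d)"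
  using tens_rsmult[OF right_Ar D.left_C, of x r d] by simp

lemmas tens_CR_add =
  tens_add_left[OF right_Ar D.left_C, simplified] tens_add_right[OF right_Ar D.left_C, simplified]

lemma \<rho>_right_hom: "\<rho> \<in> right_hom R Ar CR"
  using comodule_A by (simp add: comodule_def)

lemma \<rho>_closed [simp]: "x \<in> carrier A \<Longrightarrow> \<rho> x \<in> carrier CR"
  and \<rho>_add: "\<lbrakk>x \<in> carrier A; y \<in> carrier A\<rbrakk> \<Longrightarrow> \<rho> (x \<oplus>\<^bsub>A\<^esub> y) = \<rho> x \<oplus>\<^bsub>CR\<^esub> \<rho> y"
  and \<rho>_rsmult: "\<lbrakk>x \<in> carrier A; r \<in> carrier R\<rbrakk> \<Longrightarrow> \<rho> (x \<otimes>\<^bsub>A\<^esub> \<eta> r) = \<rho> x \<odot>\<^sub>r\<^bsub>CR\<^esub> r"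
  using add_hom_closed[OF right_hom_add_hom[OF \<rho>_right_hom]] add_hom_add[OF right_hom_add_hom[OF \<rho>_right_hom]]
    right_hom_rsmult[OF \<rho>_right_hom] by simp_all

lemma \<rho>_coassoc:
  assumes "abelian_group G" "balanced3 R R Ar D D G F" "x \<in> carrier A"
  shows "tensor_lift R Ar D G (\<lambda>a d. tensor_lift R Ar D G (\<lambda>a' d'. F a' d' d) (\<rho> a)) (\<rho> x) =
    tensor_lift R Ar D G (\<lambda>a d. tensor_lift R D D G (F a) (\<Delta> d)) (\<rho> x)"
  using D.comodule_coassoc[OF comodule_A assms(1,2)] assms(3) by simp

lemma counit_AD_balanced: "balanced R Ar D A (\<lambda>a d. a \<otimes>\<^bsub>A\<^esub> \<eta> (\<epsilon> d))"
  using D.balanced_counit[OF right_Ar] by (simp add: balanced_def)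

lemma counit_AD_left_hom: "counit_AD R A \<eta> D \<epsilon> \<in> left_hom A CR AA"
proof -
  have "tensor_lift R Ar D AA (\<lambda>a d. a \<otimes>\<^bsub>A\<^esub> \<eta> (\<epsilon> d)) \<in> left_hom A CR AA"
    by (rule tensor_lift_left_hom[OF bimodule_Ar D.left_C ring_bimodule_left[OF bimodule_AA]])
      (use counit_AD_balanced in \<open>simp_all add: balanced_def A.m_assoc D.\<epsilon>_closed\<close>)
  then show ?thesis
    by (simp add: counit_AD_def tensor_lift_ring_bimod)
qed

lemma counit_\<rho>: "x \<in> carrier A \<Longrightarrow> counit_AD R A \<eta> D \<epsilon> (\<rho> x) = x"
  using comodule_A by (simp add: comodule_def counit_AD_def tensor_lift_ring_bimod)

lemma coaction_AD_\<rho>: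
  "x \<in> carrier A \<Longrightarrow> coaction_AD R A \<eta> D \<Delta> (\<rho> x) =
    tensor_lift R Ar D (tensor R CR D) (\<lambda>a d. tens R CR D (\<rho> a) d) (\<rho> x)"
  using D.tensor_coaction_coaction[OF comodule_A] by (simp add: coaction_AD_def)

lemma coaction_AD_left_hom: "coaction_AD R A \<eta> D \<Delta> \<in> left_hom A CR (tensor R CR D)"
  unfolding coaction_AD_def by (rule D.tensor_coaction_left_hom[OF right_Ar bimodule_Ar])

lemma B_closed: "b \<in> B \<Longrightarrow> b \<in> carrier A"
  and B_\<rho>: "\<lbrakk>b \<in> B; x \<in> carrier A\<rbrakk> \<Longrightarrow> \<rho> (b \<otimes>\<^bsub>A\<^esub> x) = b \<odot>\<^bsub>CR\<^esub> \<rho> x"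
  by (simp_all add: coinvariants_def tensor_AD_def)

lemma B_I:
  "\<lbrakk>b \<in> carrier A; \<And>x. x \<in> carrier A \<Longrightarrow> \<rho> (b \<otimes>\<^bsub>A\<^esub> x) = b \<odot>\<^bsub>CR\<^esub> \<rho> x\<rbrakk> \<Longrightarrow> b \<in> B"
  by (simp add: coinvariants_def tensor_AD_def)

lemma B_subring: "subring B A"
proof (rule A.subringI)
  show "B \<subseteq> carrier A" using B_closed by blast
  show "\<one>\<^bsub>A\<^esub> \<in> B" by (rule B_I) (simp_all add: CR.lsmult_one)
  fix b b' assume b: "b \<in> B" "b' \<in> B"
  note bc = B_closed[OF b(1)] B_closed[OF b(2)]
  show "b \<otimes>\<^bsub>A\<^esub> b' \<in> B"
    by (rule B_I) (simp_all add: bc B_\<rho>[OF b(1)] B_\<rho>[OF b(2)] A.m_assoc CR.lsmult_assoc)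
  show "b \<oplus>\<^bsub>A\<^esub> b' \<in> B"
    by (rule B_I) (simp_all add: bc B_\<rho>[OF b(1)] B_\<rho>[OF b(2)] A.l_distr CR.lsmult_l_distr \<rho>_add)
next
  fix b assume b: "b \<in> B"
  note bc = B_closed[OF b]
  show "\<ominus>\<^bsub>A\<^esub> b \<in> B"
  proof (rule B_I)
    fix x assume x: "x \<in> carrier A"
    have zero: "\<zero>\<^bsub>A\<^esub> \<odot>\<^bsub>CR\<^esub> \<rho> x = \<zero>\<^bsub>CR\<^esub>"
      using CR.lsmult_l_distr[of "\<zero>\<^bsub>A\<^esub>" "\<zero>\<^bsub>A\<^esub>" "\<rho> x"] x CR.lsmult_closed[of "\<zero>\<^bsub>A\<^esub>" "\<rho> x"]
        CR.M.add.r_cancel_one' by simp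
    have "\<rho> \<zero>\<^bsub>A\<^esub> = \<zero>\<^bsub>CR\<^esub>"
      using \<rho>_add[of "\<zero>\<^bsub>A\<^esub>" "\<zero>\<^bsub>A\<^esub>"] CR.M.add.r_cancel_one' \<rho>_closed[of "\<zero>\<^bsub>A\<^esub>"] by simp
    then have "\<rho> (\<ominus>\<^bsub>A\<^esub> b \<otimes>\<^bsub>A\<^esub> x) \<oplus>\<^bsub>CR\<^esub> \<rho> (b \<otimes>\<^bsub>A\<^esub> x) = \<zero>\<^bsub>CR\<^esub>"
      using x bc by (simp add: \<rho>_add[symmetric] A.l_distr[symmetric] A.l_neg)
    moreover have "(\<ominus>\<^bsub>A\<^esub> b) \<odot>\<^bsub>CR\<^esub> \<rho> x \<oplus>\<^bsub>CR\<^esub> b \<odot>\<^bsub>CR\<^esub> \<rho> x = \<zero>\<^bsub>CR\<^esub>"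
      using x bc zero by (simp add: CR.lsmult_l_distr[symmetric] A.l_neg)
    \<comment> \<open>Both elements are additive inverses of \<rho>(b x) = b \<rho>(x), hence
      equal.\<close>
    ultimately show "\<rho> (\<ominus>\<^bsub>A\<^esub> b \<otimes>\<^bsub>A\<^esub> x) = (\<ominus>\<^bsub>A\<^esub> b) \<odot>\<^bsub>CR\<^esub> \<rho> x"
      using CR.M.minus_equality[of "\<rho> (\<ominus>\<^bsub>A\<^esub> b \<otimes>\<^bsub>A\<^esub> x)" "\<rho> (b \<otimes>\<^bsub>A\<^esub> x)"]
        CR.M.minus_equality[of "(\<ominus>\<^bsub>A\<^esub> b) \<odot>\<^bsub>CR\<^esub> \<rho> x" "\<rho> (b \<otimes>\<^bsub>A\<^esub> x)"]
      by (simp add: x bc B_\<rho>[OF b x] CR.lsmult_closed)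
  qed (simp add: bc)
qed

lemma central_A:
  assumes "c \<in> carrier K" "x \<in> carrier A"
  shows "(c \<odot>\<^bsub>A\<^esub> \<one>\<^bsub>A\<^esub>) \<otimes>\<^bsub>A\<^esub> x = c \<odot>\<^bsub>A\<^esub> x" "x \<otimes>\<^bsub>A\<^esub> (c \<odot>\<^bsub>A\<^esub> \<one>\<^bsub>A\<^esub>) = c \<odot>\<^bsub>A\<^esub> x"
  using assms assoc_algebra.smult_mult_left[OF assoc_algebra_A, of c "\<one>\<^bsub>A\<^esub>" x]
    assoc_algebra.smult_mult_right[OF assoc_algebra_A, of c x "\<one>\<^bsub>A\<^esub>"] by simp_all

lemma \<eta>_central: "c \<in> carrier K \<Longrightarrow> \<eta> (c \<odot>\<^bsub>R\<^esub> \<one>\<^bsub>R\<^esub>) = c \<odot>\<^bsub>A\<^esub> \<one>\<^bsub>A\<^esub>"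
  by (simp add: \<eta>_smult)

text \<open>On a \<otimes> d the scalar passes from the left of a to its right by centrality, across
  the tensor sign through \<eta>, and to the right of d because D is a bimodule over the K-algebra
  R.\<close>

lemma central_CR:
  assumes c: "c \<in> carrier K" and u: "u \<in> carrier CR"
  shows "(c \<odot>\<^bsub>A\<^esub> \<one>\<^bsub>A\<^esub>) \<odot>\<^bsub>CR\<^esub> u = u \<odot>\<^sub>r\<^bsub>CR\<^esub> (c \<odot>\<^bsub>R\<^esub> \<one>\<^bsub>R\<^esub>)"
proof -
  have c1: "c \<odot>\<^bsub>R\<^esub> \<one>\<^bsub>R\<^esub> \<in> carrier R" "c \<odot>\<^bsub>A\<^esub> \<one>\<^bsub>A\<^esub> \<in> carrier A"
    using c by simp_all
  have D: "(c \<odot>\<^bsub>R\<^esub> \<one>\<^bsub>R\<^esub>) \<odot>\<^bsub>D\<^esub> d = d \<odot>\<^sub>r\<^bsub>D\<^esub> (c \<odot>\<^bsub>R\<^esub> \<one>\<^bsub>R\<^esub>)" if "d \<in> carrier D" for d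
    using D.coring c that by (simp add: coring_def bimodule_def)
  show ?thesis
  proof (rule tensor_hom_eqI[OF right_Ar D.left_C left_module_smult_hom[OF left_CR c1(2)]
        right_module_rsmult_hom[OF right_CR c1(1)] _ u])
    fix a d assume "a \<in> carrier Ar" and d: "d \<in> carrier D"
    then have a: "a \<in> carrier A" by simp
    show "(c \<odot>\<^bsub>A\<^esub> \<one>\<^bsub>A\<^esub>) \<odot>\<^bsub>CR\<^esub> tens R Ar D a d = tens R Ar D a d \<odot>\<^sub>r\<^bsub>CR\<^esub> (c \<odot>\<^bsub>R\<^esub> \<one>\<^bsub>R\<^esub>)"
      using tens_CR_\<eta>[OF c1(1) a d] c a d c1
      by (simp add: smult_CR rsmult_CR \<eta>_central central_A D)
  qed
qed

text \<open>It suffices that c 1 is coinvariant, as B is closed under products. Multiplying by c 1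
  on the left is multiplying by \<eta>(c 1) on the right, for which \<rho> is linear, and
  \<open>central_CR\<close> turns the result back into a left action.\<close>

lemma B_smult: "\<lbrakk>c \<in> carrier K; b \<in> B\<rbrakk> \<Longrightarrow> c \<odot>\<^bsub>A\<^esub> b \<in> B"
proof -
  assume c: "c \<in> carrier K" and b: "b \<in> B"
  note bc = B_closed[OF b]
  have "c \<odot>\<^bsub>A\<^esub> \<one>\<^bsub>A\<^esub> \<in> B"
  proof (rule B_I)
    fix x assume x: "x \<in> carrier A"
    have "\<rho> ((c \<odot>\<^bsub>A\<^esub> \<one>\<^bsub>A\<^esub>) \<otimes>\<^bsub>A\<^esub> x) = \<rho> (x \<otimes>\<^bsub>A\<^esub> \<eta> (c \<odot>\<^bsub>R\<^esub> \<one>\<^bsub>R\<^esub>))"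
      using c x by (simp add: \<eta>_central central_A)
    then show "\<rho> ((c \<odot>\<^bsub>A\<^esub> \<one>\<^bsub>A\<^esub>) \<otimes>\<^bsub>A\<^esub> x) = (c \<odot>\<^bsub>A\<^esub> \<one>\<^bsub>A\<^esub>) \<odot>\<^bsub>CR\<^esub> \<rho> x"
      using c x by (simp add: \<rho>_rsmult central_CR)
  qed (simp add: c)
  then show "c \<odot>\<^bsub>A\<^esub> b \<in> B"
    using subringE(6)[OF B_subring _ b] central_A(1)[OF c bc] by metis
qed

subsection \<open>Tensor products over the coinvariants\<close>

abbreviation "AB \<equiv> A\<lparr>carrier := B\<rparr>"
abbreviation "AAB \<equiv> tensor AB AA AA"

lemma ring_AB: "ring AB"
  by (rule A.subring_is_ring[OF B_subring])

lemma id_AB: "id \<in> ring_hom AB A"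
  using B_closed by (auto simp: ring_hom_def)

lemma bimodule_AA_left: "ring_bimodule A AB AA" and bimodule_AA_right: "ring_bimodule AB A AA"
  by (intro ring_bimodule_ring_bimod ring_AB A.ring_axioms id_AB id_ring_hom)+

lemma left_B_Ar: "ring_bimodule AB R Ar"
  by (intro ring_bimodule_ring_bimod ring_AB A.ring_axioms R.ring_axioms id_AB \<eta>_ring_hom)

lemmas right_AA = ring_bimodule_right[OF bimodule_AA_left]
lemmas left_AA = ring_bimodule_left[OF bimodule_AA_right]

lemma bimodule_AAB: "ring_bimodule A A AAB"
  by (rule tensor_ring_bimodule[OF bimodule_AA_left bimodule_AA_right])

sublocale AAB: ring_bimodule A A AAB by (rule bimodule_AAB)

lemmas group_AAB = AAB.M.abelian_group_axioms

lemma tens_AAB: "\<lbrakk>a \<in> carrier A; x \<in> carrier A\<rbrakk> \<Longrightarrow> tens AB AA AA a x \<in> carrier AAB"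
  using tens_closed[OF right_AA left_AA] by simp

lemma smult_AAB:
  "\<lbrakk>a \<in> carrier A; x \<in> carrier A; y \<in> carrier A\<rbrakk>
    \<Longrightarrow> a \<odot>\<^bsub>AAB\<^esub> tens AB AA AA x y = tens AB AA AA (a \<otimes>\<^bsub>A\<^esub> x) y"
  using smult_tens[OF bimodule_AA_left left_AA] by simp

lemma rsmult_AAB:
  "\<lbrakk>a \<in> carrier A; x \<in> carrier A; y \<in> carrier A\<rbrakk>
    \<Longrightarrow> tens AB AA AA x y \<odot>\<^sub>r\<^bsub>AAB\<^esub> a = tens AB AA AA x (y \<otimes>\<^bsub>A\<^esub> a)"
  using rsmult_tens[OF right_AA bimodule_AA_right] by simp

lemma tens_AAB_B:
  "\<lbrakk>b \<in> B; x \<in> carrier A; y \<in> carrier A\<rbrakk>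
    \<Longrightarrow> tens AB AA AA (x \<otimes>\<^bsub>A\<^esub> b) y = tens AB AA AA x (b \<otimes>\<^bsub>A\<^esub> y)"
  using tens_rsmult[OF right_AA left_AA, of x b y] by simp

lemma coring_AD_simps:
  "carrier (coring_AD R A \<eta> D act) = carrier CR" "\<zero>\<^bsub>coring_AD R A \<eta> D act\<^esub> = \<zero>\<^bsub>CR\<^esub>"
  "x \<oplus>\<^bsub>coring_AD R A \<eta> D act\<^esub> y = x \<oplus>\<^bsub>CR\<^esub> y"
  "a \<odot>\<^bsub>coring_AD R A \<eta> D act\<^esub> x = a \<odot>\<^bsub>CR\<^esub> x" "x \<odot>\<^sub>r\<^bsub>coring_AD R A \<eta> D act\<^esub> a = act x a"
  by (simp_all add: coring_AD_def with_right_action_def tensor_AD_def)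

abbreviation "can \<equiv> canonical_map R A \<eta> D \<rho> B"

text \<open>Balancedness over B is the defining property of the coinvariants, read as a \<rho>(b x)
  = (a b) \<rho>(x).\<close>

lemma balanced_can: "balanced AB AA AA CR (\<lambda>a x. a \<odot>\<^bsub>CR\<^esub> \<rho> x)"
  by (rule balancedI)
    (simp_all add: CR.lsmult_closed CR.lsmult_l_distr CR.lsmult_r_distr \<rho>_add B_closed B_\<rho> CR.lsmult_assoc)

lemma can_add_hom: "can \<in> add_hom AAB CR"
  unfolding canonical_map_def tensor_AD_def
  by (rule tensor_lift_hom[OF right_AA left_AA group_CR balanced_can])

lemma can_tens: "\<lbrakk>a \<in> carrier A; x \<in> carrier A\<rbrakk> \<Longrightarrow> can (tens AB AA AA a x) = a \<odot>\<^bsub>CR\<^esub> \<rho> x"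
  unfolding canonical_map_def tensor_AD_def
  using tensor_lift_tens[OF right_AA left_AA group_CR balanced_can] by simp

lemma can_left_hom: "can \<in> left_hom A AAB CR"
  unfolding canonical_map_def tensor_AD_def
  by (rule tensor_lift_left_hom[OF bimodule_AA_left left_AA left_CR balanced_can])
    (simp add: CR.lsmult_assoc)

lemma galois_iff: "galois_extension R A \<eta> D \<rho> B \<longleftrightarrow> bij_betw can (carrier AAB) (carrier CR)"
  by (simp add: galois_extension_def tensor_AD_def)

end

section \<open>The coring on $A \otimes_R D$\<close>

text \<open>The facts about the right A-action that give the coproduct formula a meaning. They come
  from the cleft coring in one direction and from the action transported along \<open>can\<close> in
  the other, so the consequences serve both.\<close>

locale coring_action = coring_ext K R A \<eta> D \<Delta> \<epsilon> \<rho>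
  for K :: "'k ring" and R :: "('k, 'r) module" and A :: "('k, 'a) module" and \<eta> :: "'r \<Rightarrow> 'a"
    and D :: "('r, 'd, 'r) bimod" and \<Delta> :: "'d \<Rightarrow> ('d \<times> 'd \<Rightarrow>\<^sub>0 int) set" and \<epsilon> :: "'d \<Rightarrow> 'r"
    and \<rho> :: "'a \<Rightarrow> ('a \<times> 'd \<Rightarrow>\<^sub>0 int) set" +
  fixes act :: "('a \<times> 'd \<Rightarrow>\<^sub>0 int) set \<Rightarrow> 'a \<Rightarrow> ('a \<times> 'd \<Rightarrow>\<^sub>0 int) set"
  assumes bimodule_C: "ring_bimodule A A (coring_AD R A \<eta> D act)"
    and act_\<eta>: "\<And>c r. \<lbrakk>c \<in> carrier CR; r \<in> carrier R\<rbrakk> \<Longrightarrow> act c (\<eta> r) = c \<odot>\<^sub>r\<^bsub>CR\<^esub> r"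
begin

abbreviation "C \<equiv> coring_AD R A \<eta> D act"
abbreviation "CC \<equiv> tensor A C C"
abbreviation "\<Delta>C \<equiv> coproduct_AD R A \<eta> D \<Delta> act"

lemmas C_simps [simp] = coring_AD_simps

sublocale C: ring_bimodule A A C by (rule bimodule_C)

lemmas left_C = C.left_module_axioms
lemmas right_C = C.right_module_axioms
lemmas group_C = C.M.abelian_group_axioms

lemma act_closed: "\<lbrakk>c \<in> carrier CR; a \<in> carrier A\<rbrakk> \<Longrightarrow> act c a \<in> carrier CR"
  and act_add_left:
    "\<lbrakk>c \<in> carrier CR; c' \<in> carrier CR; a \<in> carrier A\<rbrakk> \<Longrightarrow> act (c \<oplus>\<^bsub>CR\<^esub> c') a = act c a \<oplus>\<^bsub>CR\<^esub> act c' a"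
  and act_add_right:
    "\<lbrakk>c \<in> carrier CR; a \<in> carrier A; a' \<in> carrier A\<rbrakk> \<Longrightarrow> act c (a \<oplus>\<^bsub>A\<^esub> a') = act c a \<oplus>\<^bsub>CR\<^esub> act c a'"
  and act_mult:
    "\<lbrakk>c \<in> carrier CR; a \<in> carrier A; a' \<in> carrier A\<rbrakk> \<Longrightarrow> act c (a \<otimes>\<^bsub>A\<^esub> a') = act (act c a) a'"
  and act_smult:
    "\<lbrakk>b \<in> carrier A; c \<in> carrier CR; a \<in> carrier A\<rbrakk> \<Longrightarrow> act (b \<odot>\<^bsub>CR\<^esub> c) a = b \<odot>\<^bsub>CR\<^esub> act c a"
  using C.rsmult_closed[of c a] C.rsmult_l_distr[of c c' a] C.rsmult_r_distr[of c a a']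
    C.rsmult_assoc[of c a a'] C.smult_rsmult[of b c a] by simp_all

lemma bimodule_CC: "ring_bimodule A A CC"
  by (rule tensor_ring_bimodule[OF bimodule_C bimodule_C])

sublocale CC: ring_bimodule A A CC by (rule bimodule_CC)

lemmas group_CC = CC.M.abelian_group_axioms

lemma tens_CC: "\<lbrakk>c \<in> carrier CR; c' \<in> carrier CR\<rbrakk> \<Longrightarrow> tens A C C c c' \<in> carrier CC"
  using tens_closed[OF right_C left_C] by simp

lemma smult_CC:
  "\<lbrakk>a \<in> carrier A; c \<in> carrier CR; c' \<in> carrier CR\<rbrakk>
    \<Longrightarrow> a \<odot>\<^bsub>CC\<^esub> tens A C C c c' = tens A C C (a \<odot>\<^bsub>CR\<^esub> c) c'"
  using smult_tens[OF bimodule_C left_C] by simp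

lemma rsmult_CC:
  "\<lbrakk>a \<in> carrier A; c \<in> carrier CR; c' \<in> carrier CR\<rbrakk>
    \<Longrightarrow> tens A C C c c' \<odot>\<^sub>r\<^bsub>CC\<^esub> a = tens A C C c (act c' a)"
  using rsmult_tens[OF right_C bimodule_C] by simp

lemma tens_act:
  "\<lbrakk>c \<in> carrier CR; a \<in> carrier A; c' \<in> carrier CR\<rbrakk>
    \<Longrightarrow> tens A C C (act c a) c' = tens A C C c (a \<odot>\<^bsub>CR\<^esub> c')"
  using tens_rsmult[OF right_C left_C] by simp

lemmas tens_CC_add =
  tens_add_left[OF right_C left_C, simplified] tens_add_right[OF right_C left_C, simplified]

abbreviation "\<Delta>C_map a d1 d2 \<equiv> tens A C C (tens R Ar D a d1) (tens R Ar D \<one>\<^bsub>A\<^esub> d2)"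

lemma tens_CR_one_smult:
  "\<lbrakk>r \<in> carrier R; d \<in> carrier D\<rbrakk> \<Longrightarrow> tens R Ar D \<one>\<^bsub>A\<^esub> (r \<odot>\<^bsub>D\<^esub> d) = \<eta> r \<odot>\<^bsub>CR\<^esub> tens R Ar D \<one>\<^bsub>A\<^esub> d"
  using tens_CR_\<eta>[of r "\<one>\<^bsub>A\<^esub>" d] by (simp add: smult_CR)

lemma tens_CR_act_\<eta>:
  "\<lbrakk>a \<in> carrier A; d \<in> carrier D; r \<in> carrier R\<rbrakk>
    \<Longrightarrow> tens R Ar D a (d \<odot>\<^sub>r\<^bsub>D\<^esub> r) = act (tens R Ar D a d) (\<eta> r)"
  by (simp add: act_\<eta> tens_CR rsmult_CR)

text \<open>The balance between d1 and d2 is where \<open>act_\<eta>\<close> enters: r on the right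
  of d1 becomes the right action of \<eta>(r), which crosses the tensor product over A and gives
  \<eta>(r) \<otimes> d2 = 1 \<otimes> r d2.\<close>

lemma balanced3_\<Delta>C_map: "balanced3 R R Ar D D CC \<Delta>C_map"
  unfolding balanced3_def
  by (auto intro!: balancedI simp: tens_CC tens_CR tens_CR_add tens_CC_add tens_CR_\<eta> D.lsmult_closed
      CR.lsmult_closed D.rsmult_closed tens_CR_one_smult tens_CR_act_\<eta> tens_act act_closed)

lemma balanced_\<Delta>C: "balanced R Ar D CC (\<lambda>a d. tensor_lift R D D CC (\<Delta>C_map a) (\<Delta> d))"
  using balanced_comp[OF balanced3_lift_right[OF right_Ar D.bimodule_C D.left_C group_CC balanced3_\<Delta>C_map]
      id_right_hom D.\<Delta>_left] by simp

lemma \<Delta>C_tens: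
  "\<lbrakk>a \<in> carrier A; d \<in> carrier D\<rbrakk>
    \<Longrightarrow> \<Delta>C (tens R Ar D a d) = tensor_lift R D D CC (\<Delta>C_map a) (\<Delta> d)"
  unfolding coproduct_AD_def Let_def
  using tensor_lift_tens[OF right_Ar D.left_C group_CC balanced_\<Delta>C] by simp

lemma \<Delta>C_left_hom: "\<Delta>C \<in> left_hom A CR CC"
  unfolding coproduct_AD_def Let_def
proof (rule tensor_lift_left_hom[OF bimodule_Ar D.left_C CC.left_module_axioms balanced_\<Delta>C])
  fix a x d assume "a \<in> carrier A" "x \<in> carrier Ar" "d \<in> carrier D"
  then show "tensor_lift R D D CC (\<Delta>C_map (a \<odot>\<^bsub>Ar\<^esub> x)) (\<Delta> d) =
      a \<odot>\<^bsub>CC\<^esub> tensor_lift R D D CC (\<Delta>C_map x) (\<Delta> d)"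
    using balanced3D(2)[OF balanced3_\<Delta>C_map, of x]
    by (intro add_hom_tensor_lift_eq[OF D.right_C D.left_C group_CC group_CC _
          left_module_smult_hom[OF CC.left_module_axioms], symmetric] D.\<Delta>_closed)
      (simp_all add: smult_CC tens_CR smult_CR)
qed

lemma balanced_Al_C: "balanced A Al C CR (\<lambda>a c. a \<odot>\<^bsub>CR\<^esub> c)"
  by (rule balancedI) (simp_all add: CR.lsmult_closed CR.lsmult_l_distr CR.lsmult_r_distr CR.lsmult_assoc)

text \<open>The action map sends 1 \<otimes> c back to c. This half of the isomorphism of A
  \<otimes> C (over A) with C translates statements about \<open>coaction_A\<close> into statements
  about \<rho>.\<close>

lemma tens_Al_inj:
  assumes "c \<in> carrier CR" "c' \<in> carrier CR" "tens A Al C \<one>\<^bsub>A\<^esub> c = tens A Al C \<one>\<^bsub>A\<^esub> c'"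
  shows "c = c'"
  using assms tensor_lift_tens[OF right_Al left_C group_CR balanced_Al_C, of "\<one>\<^bsub>A\<^esub>"]
  by (metis A.one_closed C_simps(1) CR.lsmult_one ring_bimod_simps(1))

end

locale grouplike_action = coring_action +
  assumes \<rho>_act: "\<And>x a. \<lbrakk>x \<in> carrier A; a \<in> carrier A\<rbrakk> \<Longrightarrow> \<rho> (x \<otimes>\<^bsub>A\<^esub> a) = act (\<rho> x) a"
begin

lemma \<rho>_one: "x \<in> carrier A \<Longrightarrow> \<rho> x = act (\<rho> \<one>\<^bsub>A\<^esub>) x"
  using \<rho>_act[of "\<one>\<^bsub>A\<^esub>" x] by simp

text \<open>Coassociativity of \<rho> gives \<rho>(y0) \<otimes> (1 \<otimes> y1). Since \<rho>(y0)
  = \<rho>(1) y0, the factor y0 crosses the tensor product over A and \<rho>(y) is reassembled on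
  the right. At y = 1 this is the grouplike property.\<close>

lemma \<Delta>C_\<rho>:
  assumes y: "y \<in> carrier A"
  shows "\<Delta>C (\<rho> y) = tens A C C (\<rho> \<one>\<^bsub>A\<^esub>) (\<rho> y)"
proof -
  have "\<Delta>C (\<rho> y) = tensor_lift R Ar D CC (\<lambda>a d. tensor_lift R Ar D CC (\<lambda>a' d'. \<Delta>C_map a' d' d) (\<rho> a)) (\<rho> y)"
    unfolding coproduct_AD_def Let_def by (rule \<rho>_coassoc[OF group_CC balanced3_\<Delta>C_map y, symmetric])
  also have "\<dots> = tensor_lift R Ar D CC (\<lambda>a d. tens A C C (\<rho> \<one>\<^bsub>A\<^esub>) (tens R Ar D a d)) (\<rho> y)"
  proof (intro tensor_lift_apply_cong)
    fix a d assume "a \<in> carrier Ar" and d: "d \<in> carrier D"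
    then have a: "a \<in> carrier A" by simp
    have "(\<lambda>u. tens A C C u (tens R Ar D \<one>\<^bsub>A\<^esub> d)) \<in> add_hom CR CC"
      using tens_add_hom(2)[OF right_C left_C, of "tens R Ar D \<one>\<^bsub>A\<^esub> d"] d
      by (simp add: tens_CR hom_def)
    then have "tensor_lift R Ar D CC (\<lambda>a' d'. \<Delta>C_map a' d' d) (\<rho> a) = tens A C C (\<rho> a) (tens R Ar D \<one>\<^bsub>A\<^esub> d)"
      by (intro add_hom_eq_tensor_lift[OF right_Ar D.left_C group_CC,
            where h = "\<lambda>u. tens A C C u (tens R Ar D \<one>\<^bsub>A\<^esub> d)", symmetric]) (simp_all add: a)
    also have "\<dots> = tens A C C (\<rho> \<one>\<^bsub>A\<^esub>) (tens R Ar D a d)"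
      using a d by (simp add: \<rho>_one[OF a] tens_act tens_CR smult_CR)
    finally show "tensor_lift R Ar D CC (\<lambda>a' d'. \<Delta>C_map a' d' d) (\<rho> a) =
        tens A C C (\<rho> \<one>\<^bsub>A\<^esub>) (tens R Ar D a d)" .
  qed
  also have "\<dots> = tens A C C (\<rho> \<one>\<^bsub>A\<^esub>) (\<rho> y)"
  proof (rule add_hom_eq_tensor_lift[OF right_Ar D.left_C group_CC, symmetric])
    show "tens A C C (\<rho> \<one>\<^bsub>A\<^esub>) \<in> add_hom CR CC"
      using tens_add_hom(1)[OF right_C left_C, of "\<rho> \<one>\<^bsub>A\<^esub>"] by (simp add: hom_def)
  qed (simp_all add: y)
  finally show ?thesis .
qed

end

section \<open>Modules of endomorphisms\<close>

context coring_ext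
begin

abbreviation "H \<equiv> hom_AA A \<eta>"

lemma hom_AA_simps:
  "carrier H = right_hom A AA AA \<inter> extensional (carrier A)"
  "\<phi> \<oplus>\<^bsub>H\<^esub> \<psi> = (\<lambda>x\<in>carrier A. \<phi> x \<oplus>\<^bsub>A\<^esub> \<psi> x)"
  "a \<odot>\<^bsub>H\<^esub> \<phi> = (\<lambda>x\<in>carrier A. a \<otimes>\<^bsub>A\<^esub> \<phi> x)"
  "\<phi> \<odot>\<^sub>r\<^bsub>H\<^esub> r = (\<lambda>x\<in>carrier A. \<phi> (\<eta> r \<otimes>\<^bsub>A\<^esub> x))"
  "\<zero>\<^bsub>H\<^esub> = (\<lambda>x\<in>carrier A. \<zero>\<^bsub>A\<^esub>)"
  by (simp_all add: hom_AA_def)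

text \<open>Right A-linear endomorphisms of A are left multiplications by their value at 1, so
  \<open>H\<close> is a copy of A with R acting on the right through \<eta>. This is why
  \<open>jt\<close> can be traded for its value at 1.\<close>

lemma mem_H:
  assumes "\<phi> \<in> carrier H" "x \<in> carrier A"
  shows "\<phi> x \<in> carrier A" and "\<phi> x = \<phi> \<one>\<^bsub>A\<^esub> \<otimes>\<^bsub>A\<^esub> x"
proof -
  have \<phi>: "\<phi> \<in> right_hom A AA AA" using assms by (simp add: hom_AA_simps)
  show "\<phi> x \<in> carrier A" using add_hom_closed[OF right_hom_add_hom[OF \<phi>], of x] assms by simp
  show "\<phi> x = \<phi> \<one>\<^bsub>A\<^esub> \<otimes>\<^bsub>A\<^esub> x" using right_hom_rsmult[OF \<phi>, of "\<one>\<^bsub>A\<^esub>" x] assms by simp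
qed

lemma mult_in_H: "a \<in> carrier A \<Longrightarrow> (\<lambda>x\<in>carrier A. a \<otimes>\<^bsub>A\<^esub> x) \<in> carrier H"
  unfolding hom_AA_simps by (auto intro!: right_homI simp: A.r_distr A.m_assoc)

lemma H_eq: "\<phi> \<in> carrier H \<Longrightarrow> \<phi> = (\<lambda>x\<in>carrier A. \<phi> \<one>\<^bsub>A\<^esub> \<otimes>\<^bsub>A\<^esub> x)"
  by (rule extensionalityI[of _ "carrier A"]) (auto simp: hom_AA_simps(1) mem_H(2)[symmetric] hom_AA_simps)

lemma H_cases:
  assumes "\<phi> \<in> carrier H"
  obtains a where "a \<in> carrier A" "\<phi> = (\<lambda>x\<in>carrier A. a \<otimes>\<^bsub>A\<^esub> x)"
  using H_eq[OF assms] mem_H(1)[OF assms A.one_closed] by blast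

lemma H_add: "\<lbrakk>a \<in> carrier A; b \<in> carrier A\<rbrakk> \<Longrightarrow>
  (\<lambda>x\<in>carrier A. a \<otimes>\<^bsub>A\<^esub> x) \<oplus>\<^bsub>H\<^esub> (\<lambda>x\<in>carrier A. b \<otimes>\<^bsub>A\<^esub> x) = (\<lambda>x\<in>carrier A. (a \<oplus>\<^bsub>A\<^esub> b) \<otimes>\<^bsub>A\<^esub> x)"
  by (auto simp: hom_AA_simps A.l_distr)

lemma H_smult: "\<lbrakk>a \<in> carrier A; b \<in> carrier A\<rbrakk> \<Longrightarrow>
  a \<odot>\<^bsub>H\<^esub> (\<lambda>x\<in>carrier A. b \<otimes>\<^bsub>A\<^esub> x) = (\<lambda>x\<in>carrier A. (a \<otimes>\<^bsub>A\<^esub> b) \<otimes>\<^bsub>A\<^esub> x)"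
  by (auto simp: hom_AA_simps A.m_assoc)

lemma H_rsmult: "\<lbrakk>a \<in> carrier A; r \<in> carrier R\<rbrakk> \<Longrightarrow>
  (\<lambda>x\<in>carrier A. a \<otimes>\<^bsub>A\<^esub> x) \<odot>\<^sub>r\<^bsub>H\<^esub> r = (\<lambda>x\<in>carrier A. (a \<otimes>\<^bsub>A\<^esub> \<eta> r) \<otimes>\<^bsub>A\<^esub> x)"
  by (auto simp: hom_AA_simps A.m_assoc)

lemma H_zero: "\<zero>\<^bsub>H\<^esub> = (\<lambda>x\<in>carrier A. \<zero>\<^bsub>A\<^esub> \<otimes>\<^bsub>A\<^esub> x)"
  by (auto simp: hom_AA_simps)

text \<open>Each law is checked on left multiplications, where it becomes the corresponding law of
  A.\<close>

lemma group_H: "abelian_group H"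
proof (rule abelian_groupI)
  fix x assume "x \<in> carrier H"
  then obtain a where a: "a \<in> carrier A" "x = (\<lambda>x\<in>carrier A. a \<otimes>\<^bsub>A\<^esub> x)" by (rule H_cases)
  then show "\<exists>y\<in>carrier H. y \<oplus>\<^bsub>H\<^esub> x = \<zero>\<^bsub>H\<^esub>"
    by (intro bexI[of _ "\<lambda>x\<in>carrier A. (\<ominus>\<^bsub>A\<^esub> a) \<otimes>\<^bsub>A\<^esub> x"])
      (simp_all add: H_add mult_in_H A.l_neg H_zero)
qed (auto elim!: H_cases simp: H_add mult_in_H H_zero A.a_ac)

lemma left_H: "left_module A H"
  by (intro left_module.intro left_module_axioms.intro A.ring_axioms group_H)
    (auto elim!: H_cases simp: H_add H_smult mult_in_H A.l_distr A.r_distr A.m_assoc)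

end

context coring_ext
begin

lemma group_CRD: "abelian_group (tensor R CR D)"
  by (rule tensor_abelian_group[OF right_CR D.left_C])

lemma balanced_\<rho>_tens: "balanced R Ar D (tensor R CR D) (\<lambda>a d. tens R CR D (\<rho> a) d)"
  using balanced_comp[OF balanced_tens[OF right_CR D.left_C] \<rho>_right_hom id_left_hom] by simp

text \<open>The coaction of A \<otimes> D at \<rho>(y) is \<rho>(y0) \<otimes> y1, so a sum over the
  coaction turns into a sum over \<rho>(y).\<close>

lemma tensor_lift_coaction_\<rho>:
  assumes G: "abelian_group G" and h: "balanced R CR D G h" and y: "y \<in> carrier A"
  shows "tensor_lift R CR D G h (coaction_AD R A \<eta> D \<Delta> (\<rho> y)) = tensor_lift R Ar D G (\<lambda>a d. h (\<rho> a) d) (\<rho> y)"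
  unfolding coaction_AD_\<rho>[OF y]
  by (rule add_hom_tensor_lift_eq[OF right_Ar D.left_C group_CRD G balanced_\<rho>_tens
        tensor_lift_hom[OF right_CR D.left_C G h]])
    (simp_all add: y tensor_lift_tens[OF right_CR D.left_C G h])

end

locale coring_subring = coring_ext +
  assumes \<eta>_B: "\<And>r. r \<in> carrier R \<Longrightarrow> \<eta> r \<in> B"
begin

abbreviation "Bm \<equiv> ring_bimod AB id \<eta>"

lemma \<eta>_ring_hom_AB: "\<eta> \<in> ring_hom R AB"
  using \<eta>_ring_hom \<eta>_B by (auto simp: ring_hom_def)

lemma bimodule_Bm: "ring_bimodule AB R Bm"
  by (intro ring_bimodule_ring_bimod ring_AB R.ring_axioms \<eta>_ring_hom_AB) (simp add: ring_hom_def)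

lemmas right_Bm = ring_bimodule_right[OF bimodule_Bm]

lemma group_BD: "abelian_group (tensor R Bm D)"
  by (rule tensor_abelian_group[OF right_Bm D.left_C])

end

text \<open>Linearity of j and of j' = \<open>jt_one\<close>, before any inverse identity. Both
  directions produce such a pair, and the map \<open>q\<close> built from it is shared.\<close>

locale cleft_maps = grouplike_action K R A \<eta> D \<Delta> \<epsilon> \<rho> act + coring_subring K R A \<eta> D \<Delta> \<epsilon> \<rho>
  for K R A \<eta> D \<Delta> \<epsilon> \<rho> act +
  fixes j and jt_one
  assumes j_left: "j \<in> left_hom R D Al"
    and jt_one_left: "jt_one \<in> left_hom A CR AA"
    and jt_one_rsmult: "\<And>c r. \<lbrakk>c \<in> carrier CR; r \<in> carrier R\<rbrakk> \<Longrightarrow> jt_one (c \<odot>\<^sub>r\<^bsub>CR\<^esub> r) = jt_one c \<otimes>\<^bsub>A\<^esub> \<eta> r"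
begin

lemma jt_one_closed [simp]: "c \<in> carrier CR \<Longrightarrow> jt_one c \<in> carrier A"
  using add_hom_closed[OF left_hom_add_hom[OF jt_one_left]] by simp

lemma jt_one_add: "\<lbrakk>c \<in> carrier CR; c' \<in> carrier CR\<rbrakk> \<Longrightarrow> jt_one (c \<oplus>\<^bsub>CR\<^esub> c') = jt_one c \<oplus>\<^bsub>A\<^esub> jt_one c'"
  using add_hom_add[OF left_hom_add_hom[OF jt_one_left]] by simp

lemma jt_one_smult: "\<lbrakk>a \<in> carrier A; c \<in> carrier CR\<rbrakk> \<Longrightarrow> jt_one (a \<odot>\<^bsub>CR\<^esub> c) = a \<otimes>\<^bsub>A\<^esub> jt_one c"
  using left_hom_smult[OF jt_one_left] by simp

lemma jt_one_act_\<eta>: "\<lbrakk>c \<in> carrier CR; r \<in> carrier R\<rbrakk> \<Longrightarrow> jt_one (act c (\<eta> r)) = jt_one c \<otimes>\<^bsub>A\<^esub> \<eta> r"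
  by (simp add: act_\<eta> jt_one_rsmult)

lemma j_closed [simp]: "d \<in> carrier D \<Longrightarrow> j d \<in> carrier A"
  using add_hom_closed[OF left_hom_add_hom[OF j_left]] by simp

lemma j_add: "\<lbrakk>d \<in> carrier D; d' \<in> carrier D\<rbrakk> \<Longrightarrow> j (d \<oplus>\<^bsub>D\<^esub> d') = j d \<oplus>\<^bsub>A\<^esub> j d'"
  using add_hom_add[OF left_hom_add_hom[OF j_left]] by simp

lemma j_smult: "\<lbrakk>r \<in> carrier R; d \<in> carrier D\<rbrakk> \<Longrightarrow> j (r \<odot>\<^bsub>D\<^esub> d) = \<eta> r \<otimes>\<^bsub>A\<^esub> j d"
  using left_hom_smult[OF j_left] by simp

lemma balanced_act_jt_one: "balanced A C C CR (\<lambda>c1 c2. act c1 (jt_one c2))"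
  by (rule balancedI)
    (simp_all add: act_closed act_add_left act_add_right jt_one_add jt_one_smult act_mult CR.lsmult_closed)

definition p where "p y = jt_one (\<rho> y)"

lemma p_closed [simp]: "y \<in> carrier A \<Longrightarrow> p y \<in> carrier A"
  by (simp add: p_def)

lemma p_add: "\<lbrakk>x \<in> carrier A; y \<in> carrier A\<rbrakk> \<Longrightarrow> p (x \<oplus>\<^bsub>A\<^esub> y) = p x \<oplus>\<^bsub>A\<^esub> p y"
  and p_mult_B: "\<lbrakk>b \<in> B; y \<in> carrier A\<rbrakk> \<Longrightarrow> p (b \<otimes>\<^bsub>A\<^esub> y) = b \<otimes>\<^bsub>A\<^esub> p y"
  and p_rsmult: "\<lbrakk>y \<in> carrier A; r \<in> carrier R\<rbrakk> \<Longrightarrow> p (y \<otimes>\<^bsub>A\<^esub> \<eta> r) = p y \<otimes>\<^bsub>A\<^esub> \<eta> r"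
  by (simp_all add: p_def \<rho>_add jt_one_add B_\<rho> B_closed jt_one_smult \<rho>_rsmult jt_one_rsmult)

lemma balanced_jt_one_j: "balanced R CR D A (\<lambda>c0 d. jt_one c0 \<otimes>\<^bsub>A\<^esub> j d)"
  by (rule balancedI) (simp_all add: jt_one_add j_add A.l_distr A.r_distr jt_one_rsmult j_smult A.m_assoc)

text \<open>The product j'(c0) j(c1) over the coaction of A \<otimes> D; at \<rho>(y) it becomes
  p(y0) j(y1). The inverse identity on C says that the coproduct legs satisfy c1 q(c2) = c.\<close>

definition q where "q c = tensor_lift R CR D A (\<lambda>c0 d. jt_one c0 \<otimes>\<^bsub>A\<^esub> j d) (coaction_AD R A \<eta> D \<Delta> c)"

lemma q_left_hom: "q \<in> left_hom A CR AA"
proof -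
  have "tensor_lift R CR D AA (\<lambda>c0 d. jt_one c0 \<otimes>\<^bsub>A\<^esub> j d) \<in> left_hom A (tensor R CR D) AA"
    using balanced_jt_one_j
    by (intro tensor_lift_left_hom[OF bimodule_CR D.left_C ring_bimodule_left[OF bimodule_AA]])
      (simp_all add: balanced_def jt_one_smult A.m_assoc)
  then show ?thesis
    using coaction_AD_left_hom
    by (auto simp: left_hom_def hom_def Pi_iff q_def tensor_lift_ring_bimod)
qed

lemma q_closed [simp]: "c \<in> carrier CR \<Longrightarrow> q c \<in> carrier A"
  using add_hom_closed[OF left_hom_add_hom[OF q_left_hom]] by simp

lemma balanced_act_q: "balanced A C C CR (\<lambda>c1 c2. act c1 (q c2))"
  using left_hom_smult[OF q_left_hom] add_hom_add[OF left_hom_add_hom[OF q_left_hom]]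
  by (intro balancedI)
    (simp_all add: act_closed act_add_left act_add_right act_mult CR.lsmult_closed)

end

section \<open>From cleft extensions to the normal basis property\<close>

locale cleft_data = grouplike_action K R A \<eta> D \<Delta> \<epsilon> \<rho> act + coring_subring K R A \<eta> D \<Delta> \<epsilon> \<rho>
  for K R A \<eta> D \<Delta> \<epsilon> \<rho> act +
  fixes j and jt
  assumes j_left: "j \<in> left_hom R D Al"
    and j_comodule: "j \<in> comodule_hom R D D \<Delta> Ar \<rho>"
    and jt_left: "jt \<in> left_hom A CR H"
    and jt_right: "jt \<in> right_hom R CR H"
    and jt_coact: "\<And>c x. \<lbrakk>c \<in> carrier C; x \<in> carrier A\<rbrakk> \<Longrightarrow>
      tensor_lift A C C C (\<lambda>c1 c2. c1 \<odot>\<^sub>r\<^bsub>C\<^esub> jt c2 x) (\<Delta>C c) =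
      tensor_lift A Al C C (\<lambda>x0 x1. jt c x0 \<odot>\<^bsub>C\<^esub> x1) (coaction_A R A \<eta> D \<rho> act x)"
    and jt_j: "\<And>d. d \<in> carrier D \<Longrightarrow>
      tensor_lift A Al C H (\<lambda>y0 y1. y0 \<odot>\<^bsub>H\<^esub> jt y1) (coaction_A R A \<eta> D \<rho> act (j d)) =
      (\<lambda>x\<in>carrier A. \<eta> (\<epsilon> d) \<otimes>\<^bsub>A\<^esub> x)"
    and jt_j_coact: "\<And>c. c \<in> carrier C \<Longrightarrow>
      tensor_lift A C C C
        (\<lambda>c1 c2. c1 \<odot>\<^sub>r\<^bsub>C\<^esub>
          tensor_lift R CR D A (\<lambda>c0 d. jt c0 (j d)) (coaction_AD R A \<eta> D \<Delta> c2)) (\<Delta>C c) = c"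
begin

definition jt_one where "jt_one c = jt c \<one>\<^bsub>A\<^esub>"

lemma jt_closed: "c \<in> carrier CR \<Longrightarrow> jt c \<in> carrier H"
  by (rule add_hom_closed[OF left_hom_add_hom[OF jt_left]])

lemma jt_one_in: "c \<in> carrier CR \<Longrightarrow> jt_one c \<in> carrier A"
  unfolding jt_one_def by (rule mem_H(1)[OF jt_closed]) simp_all

lemma jt_eq: "\<lbrakk>c \<in> carrier CR; x \<in> carrier A\<rbrakk> \<Longrightarrow> jt c x = jt_one c \<otimes>\<^bsub>A\<^esub> x"
  unfolding jt_one_def by (rule mem_H(2)[OF jt_closed])

sublocale cleft_maps K R A \<eta> D \<Delta> \<epsilon> \<rho> act j jt_one
proof (intro cleft_maps.intro grouplike_action_axioms coring_subring_axioms cleft_maps_axioms.intro j_left)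
  show "jt_one \<in> left_hom A CR AA"
  proof (rule left_homI)
    fix c c' assume "c \<in> carrier CR" "c' \<in> carrier CR"
    then show "jt_one (c \<oplus>\<^bsub>CR\<^esub> c') = jt_one c \<oplus>\<^bsub>AA\<^esub> jt_one c'"
      using add_hom_add[OF left_hom_add_hom[OF jt_left], of c c'] by (simp add: jt_one_def hom_AA_simps)
  next
    fix a c assume "a \<in> carrier A" "c \<in> carrier CR"
    then show "jt_one (a \<odot>\<^bsub>CR\<^esub> c) = a \<odot>\<^bsub>AA\<^esub> jt_one c"
      using left_hom_smult[OF jt_left, of a c] by (simp add: jt_one_def hom_AA_simps)
  qed (simp add: jt_one_in)
next
  fix c r assume "c \<in> carrier CR" "r \<in> carrier R"
  \<comment> \<open>The right R-action on endomorphisms evaluates at \<eta>(r), and right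
    A-linearity of \<open>jt c\<close> splits this off as a right factor.\<close>
  then show "jt_one (c \<odot>\<^sub>r\<^bsub>CR\<^esub> r) = jt_one c \<otimes>\<^bsub>A\<^esub> \<eta> r"
    using right_hom_rsmult[OF jt_right, of c r] jt_eq[of c "\<eta> r"] by (simp add: jt_one_def hom_AA_simps)
qed

lemma j_right: "j \<in> right_hom R D Ar"
  using j_comodule by (simp add: comodule_hom_def)

lemma \<rho>_j: "d \<in> carrier D \<Longrightarrow> \<rho> (j d) = tensor_lift R D D CR (\<lambda>d1 d2. tens R Ar D (j d1) d2) (\<Delta> d)"
  using j_comodule by (simp add: comodule_hom_def tensor_map_def)

text \<open>This is the compatibility of \<open>jt\<close> with the coactions at x = 1, where the
  coaction of A is 1 \<otimes> \<rho>(1).\<close>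

lemma act_jt_one_coproduct:
  assumes c: "c \<in> carrier CR"
  shows "tensor_lift A C C CR (\<lambda>c1 c2. act c1 (jt_one c2)) (\<Delta>C c) = jt_one c \<odot>\<^bsub>CR\<^esub> \<rho> \<one>\<^bsub>A\<^esub>"
proof -
  have b: "balanced A Al C C (\<lambda>x0 x1. jt_one c \<otimes>\<^bsub>A\<^esub> x0 \<odot>\<^bsub>CR\<^esub> x1)"
    by (rule balancedI)
      (simp_all add: c CR.lsmult_closed A.r_distr CR.lsmult_l_distr CR.lsmult_r_distr CR.lsmult_assoc)
  have "tensor_lift A C C CR (\<lambda>c1 c2. act c1 (jt_one c2)) = tensor_lift A C C C (\<lambda>c1 c2. c1 \<odot>\<^sub>r\<^bsub>C\<^esub> jt c2 \<one>\<^bsub>A\<^esub>)"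
    by (simp add: jt_one_def tensor_lift_target[of CR C] fun_eq_iff)
  then have "tensor_lift A C C CR (\<lambda>c1 c2. act c1 (jt_one c2)) (\<Delta>C c) =
      tensor_lift A Al C C (\<lambda>x0 x1. jt c x0 \<odot>\<^bsub>C\<^esub> x1) (coaction_A R A \<eta> D \<rho> act \<one>\<^bsub>A\<^esub>)"
    using jt_coact[of c "\<one>\<^bsub>A\<^esub>"] c by simp
  also have "tensor_lift A Al C C (\<lambda>x0 x1. jt c x0 \<odot>\<^bsub>C\<^esub> x1) =
      tensor_lift A Al C C (\<lambda>x0 x1. jt_one c \<otimes>\<^bsub>A\<^esub> x0 \<odot>\<^bsub>CR\<^esub> x1)"
    by (rule tensor_lift_cong) (simp add: jt_eq c)
  also have "\<dots> (coaction_A R A \<eta> D \<rho> act \<one>\<^bsub>A\<^esub>) = jt_one c \<odot>\<^bsub>CR\<^esub> \<rho> \<one>\<^bsub>A\<^esub>"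
    unfolding coaction_A_def
    using tensor_lift_tens[OF right_Al left_C group_C b, of "\<one>\<^bsub>A\<^esub>" "\<rho> \<one>\<^bsub>A\<^esub>"] c by simp
  finally show ?thesis .
qed

text \<open>Write g = \<rho>(1). At \<rho>(y), whose coproduct is g \<otimes> \<rho>(y), the
  preceding identity reads g p(y) = p(y) g. Commuting with g means coinvariance: \<rho>(b x) = g b x
  = b g x = b \<rho>(x).\<close>

lemma p_B:
  assumes y: "y \<in> carrier A"
  shows "p y \<in> B"
proof (rule B_I)
  have "tensor_lift A C C CR (\<lambda>c1 c2. act c1 (jt_one c2)) (\<Delta>C (\<rho> y)) = act (\<rho> \<one>\<^bsub>A\<^esub>) (p y)"
    using tensor_lift_tens[OF right_C left_C group_CR balanced_act_jt_one] y
    by (simp add: \<Delta>C_\<rho> p_def)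
  then have *: "act (\<rho> \<one>\<^bsub>A\<^esub>) (p y) = p y \<odot>\<^bsub>CR\<^esub> \<rho> \<one>\<^bsub>A\<^esub>"
    using act_jt_one_coproduct[of "\<rho> y"] y by (simp add: p_def)
  fix x assume x: "x \<in> carrier A"
  show "\<rho> (p y \<otimes>\<^bsub>A\<^esub> x) = p y \<odot>\<^bsub>CR\<^esub> \<rho> x"
    using x y by (simp add: \<rho>_one[of "p y \<otimes>\<^bsub>A\<^esub> x"] \<rho>_one[of x] act_mult * act_smult)
qed (simp add: y)

text \<open>The coaction of j(d) is 1 \<otimes> \<rho>(j(d)), so the inverse identity on D
  determines \<open>jt\<close> at \<rho>(j(d)); evaluation at 1 gives the claim.\<close>

lemma p_j:
  assumes d: "d \<in> carrier D"
  shows "p (j d) = \<eta> (\<epsilon> d)"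
proof -
  have b: "balanced A Al C H (\<lambda>y0 y1. y0 \<odot>\<^bsub>H\<^esub> jt y1)"
    using jt_left left_H
    by (intro balancedI) (auto simp: left_hom_def hom_def Pi_iff left_module.lsmult_closed
        left_module.lsmult_l_distr left_module.lsmult_r_distr left_module.lsmult_assoc)
  have "jt (\<rho> (j d)) = (\<lambda>x\<in>carrier A. \<eta> (\<epsilon> d) \<otimes>\<^bsub>A\<^esub> x)"
    using jt_j[OF d] tensor_lift_tens[OF right_Al left_C group_H b, of "\<one>\<^bsub>A\<^esub>" "\<rho> (j d)"] d
    by (simp add: coaction_A_def left_module.lsmult_one[OF left_H] jt_closed)
  then show ?thesis
    by (simp add: p_def jt_one_def d D.\<epsilon>_closed)
qed

text \<open>The inverse identity on C. Since \<open>jt\<close> takes values in left multiplications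
  by j', its inner sum is \<open>q\<close>.\<close>

lemma act_q_coproduct:
  assumes c: "c \<in> carrier CR"
  shows "tensor_lift A C C CR (\<lambda>c1 c2. act c1 (q c2)) (\<Delta>C c) = c"
proof -
  have "tensor_lift R CR D A (\<lambda>c0 d. jt c0 (j d)) = tensor_lift R CR D A (\<lambda>c0 d. jt_one c0 \<otimes>\<^bsub>A\<^esub> j d)"
    by (rule tensor_lift_cong) (simp add: jt_eq)
  then show ?thesis
    using jt_j_coact[of c] c by (simp add: q_def[symmetric] tensor_lift_target[of C CR] fun_eq_iff)
qed

text \<open>At \<rho>(y) the inverse identity on C collapses to g q(\<rho>(y)) = \<rho>(y) with g =
  \<rho>(1). The left side is \<rho>(q(\<rho>(y))), and the counit makes \<rho> injective.\<close>

lemma q_\<rho>: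
  assumes y: "y \<in> carrier A"
  shows "q (\<rho> y) = y"
proof -
  have "tensor_lift A C C CR (\<lambda>c1 c2. act c1 (q c2)) (\<Delta>C (\<rho> y)) = \<rho> (q (\<rho> y))"
    using tensor_lift_tens[OF right_C left_C group_CR balanced_act_q] y
    by (simp add: \<Delta>C_\<rho> \<rho>_one[of "q (\<rho> y)"])
  then have "\<rho> (q (\<rho> y)) = \<rho> y"
    by (simp add: act_q_coproduct y)
  then show ?thesis
    using counit_\<rho>[of y] counit_\<rho>[of "q (\<rho> y)"] y by simp
qed

lemma p_j_\<rho>: "y \<in> carrier A \<Longrightarrow> tensor_lift R Ar D A (\<lambda>a d. p a \<otimes>\<^bsub>A\<^esub> j d) (\<rho> y) = y"
  using tensor_lift_coaction_\<rho>[OF group_A balanced_jt_one_j] q_\<rho> by (simp add: q_def p_def)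

lemma p_right_hom: "p \<in> right_hom R Ar Bm"
  by (rule right_homI) (simp_all add: p_B p_add p_rsmult)

definition nb where "nb y = tensor_map R Ar D Bm D p id (\<rho> y)"

lemma nb_comodule_hom:
  "nb \<in> comodule_hom R D Ar \<rho> (tensor R Bm D) (tensor_coaction R Bm D \<Delta>)"
  unfolding nb_def[abs_def]
  by (rule D.comodule_hom_tensor_map_coaction[OF right_Bm comodule_A p_right_hom])

lemma nb_left_hom: "nb \<in> left_hom AB Ar (tensor R Bm D)"
proof (rule left_homI)
  have nb: "nb \<in> add_hom Ar (tensor R Bm D)"
    using nb_comodule_hom by (simp add: comodule_hom_def right_hom_def)
  show "\<And>x. x \<in> carrier Ar \<Longrightarrow> nb x \<in> carrier (tensor R Bm D)"
    "\<And>x y. \<lbrakk>x \<in> carrier Ar; y \<in> carrier Ar\<rbrakk> \<Longrightarrow> nb (x \<oplus>\<^bsub>Ar\<^esub> y) = nb x \<oplus>\<^bsub>tensor R Bm D\<^esub> nb y"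
    using add_hom_closed[OF nb] add_hom_add[OF nb] by simp_all
  fix b x assume "b \<in> carrier AB" "x \<in> carrier Ar"
  then have b: "b \<in> B" and x: "x \<in> carrier A" by simp_all
  \<comment> \<open>Left B-linearity of p lets b act on the first leg, and coinvariance of b carries
    this back through \<rho>.\<close>
  have "tensor_map R Ar D Bm D p id \<in> left_hom AB CR (tensor R Bm D)"
    unfolding tensor_map_def
    by (rule tensor_lift_left_hom[OF left_B_Ar D.left_C tensor_left_module[OF bimodule_Bm D.left_C]
          balanced_tensor_map[OF right_Ar D.left_C right_Bm D.left_C p_right_hom id_left_hom]])
      (simp add: p_mult_B p_B smult_tens[OF bimodule_Bm D.left_C])
  then show "nb (b \<odot>\<^bsub>Ar\<^esub> x) = b \<odot>\<^bsub>tensor R Bm D\<^esub> nb x"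
    using left_hom_smult[of _ AB CR _ b "\<rho> x"] b x by (simp add: nb_def B_\<rho>)
qed

lemma balanced_mult_j: "balanced R Bm D A (\<lambda>b d. b \<otimes>\<^bsub>A\<^esub> j d)"
  by (rule balancedI) (simp_all add: B_closed A.l_distr A.r_distr j_add j_smult A.m_assoc)

text \<open>One composite is the identity by p(y0) j(y1) = y. For the other, B-linearity reduces the
  claim to \<open>nb\<close> sending j(d) to 1 \<otimes> d: colinearity of j gives p(j(d1))
  \<otimes> d2, and p(j(d1)) is \<eta>(\<epsilon>(d1)).\<close>

lemma nb_bij: "bij_betw nb (carrier A) (carrier (tensor R Bm D))"
proof (rule bij_betw_byWitness)
  let ?g = "tensor_lift R Bm D A (\<lambda>b d. b \<otimes>\<^bsub>A\<^esub> j d)"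
  have nb: "nb \<in> add_hom A (tensor R Bm D)"
    using left_hom_add_hom[OF nb_left_hom] by (simp add: hom_def)
  have g: "?g \<in> add_hom (tensor R Bm D) A"
    by (rule tensor_lift_hom[OF right_Bm D.left_C group_A balanced_mult_j])
  show "\<forall>y\<in>carrier A. ?g (nb y) = y"
    unfolding nb_def
    by (simp add: tensor_lift_tensor_map[OF right_Ar D.left_C right_Bm D.left_C p_right_hom id_left_hom
          group_A balanced_mult_j] p_j_\<rho>)
  show "\<forall>u\<in>carrier (tensor R Bm D). nb (?g u) = u"
  proof
    fix u assume u: "u \<in> carrier (tensor R Bm D)"
    show "nb (?g u) = u"
    proof (rule tensor_hom_eqI[OF right_Bm D.left_C add_hom_comp[OF g nb] _ _ u, where k = "\<lambda>u. u"])
      fix b d assume "b \<in> carrier Bm" and d: "d \<in> carrier D"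
      then have b: "b \<in> B" by simp
      have balj: "balanced R D D CR (\<lambda>d1 d2. tens R Ar D (j d1) d2)"
        using balanced_tensor_map[OF D.right_C D.left_C right_Ar D.left_C j_right id_left_hom] by simp
      have h: "tensor_map R Ar D Bm D p id \<in> add_hom CR (tensor R Bm D)"
        by (rule tensor_map_hom[OF right_Ar D.left_C right_Bm D.left_C p_right_hom id_left_hom])
      have bB: "tens R Bm D b \<in> add_hom D (tensor R Bm D)"
        by (rule tens_add_hom(1)[OF right_Bm D.left_C]) (simp add: b)
      have "nb (?g (tens R Bm D b d)) = nb (b \<otimes>\<^bsub>A\<^esub> j d)"
        using tensor_lift_tens[OF right_Bm D.left_C group_A balanced_mult_j] b d by simp
      also have "\<dots> = b \<odot>\<^bsub>tensor R Bm D\<^esub> nb (j d)"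
        using left_hom_smult[OF nb_left_hom] b d by simp
      also have "nb (j d) = tensor_lift R D D (tensor R Bm D) (\<lambda>d1 d2. tens R Bm D (\<eta> (\<epsilon> d1)) d2) (\<Delta> d)"
        unfolding nb_def \<rho>_j[OF d]
        by (rule add_hom_tensor_lift_eq[OF D.right_C D.left_C group_CR group_BD balj h D.\<Delta>_closed[OF d]])
          (simp add: tensor_map_tens[OF right_Ar D.left_C right_Bm D.left_C p_right_hom id_left_hom] p_j)
      \<comment> \<open>The factor \<eta>(\<epsilon>(d1)) is the right action of \<epsilon>(d1) on
        1, so it moves to the D side, where the left counit law applies.\<close>
      also have "\<dots> = tensor_lift R D D (tensor R Bm D) (\<lambda>d1 d2. tens R Bm D \<one>\<^bsub>A\<^esub> (\<epsilon> d1 \<odot>\<^bsub>D\<^esub> d2)) (\<Delta> d)"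
        using tens_rsmult[OF right_Bm D.left_C, of "\<one>\<^bsub>A\<^esub>"] subringE(3)[OF B_subring]
        by (intro tensor_lift_apply_cong) (simp add: D.\<epsilon>_closed)
      also have "\<dots> = tens R Bm D \<one>\<^bsub>A\<^esub> (tensor_lift R D D D (\<lambda>d1 d2. \<epsilon> d1 \<odot>\<^bsub>D\<^esub> d2) (\<Delta> d))"
        using subringE(3)[OF B_subring]
        by (intro add_hom_tensor_lift[OF D.right_C D.left_C D.M.abelian_group_axioms group_BD
              D.balanced_counit_left tens_add_hom(1)[OF right_Bm D.left_C] D.\<Delta>_closed[OF d], symmetric]) simp
      also have "b \<odot>\<^bsub>tensor R Bm D\<^esub> \<dots> = tens R Bm D b d"
        using subringE(3)[OF B_subring] b d B_closed[OF b]
        by (simp add: D.counit_left smult_tens[OF bimodule_Bm D.left_C])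
      finally show "nb (?g (tens R Bm D b d)) = tens R Bm D b d" .
    qed (simp add: hom_def)
  qed
  show "nb ` carrier A \<subseteq> carrier (tensor R Bm D)"
    using add_hom_closed[OF nb] by blast
  show "?g ` carrier (tensor R Bm D) \<subseteq> carrier A"
    using add_hom_closed[OF g] by blast
qed

theorem normal_basis: "normal_basis_property K R A \<eta> D \<Delta> \<rho> B"
  unfolding normal_basis_property_def subring_over_def Let_def
  using B_subring B_smult \<eta>_B nb_bij nb_left_hom nb_comodule_hom by blast

section \<open>From cleft extensions to Galois extensions\<close>

text \<open>Both legs turn r into \<eta>(r), to the right of j' and to the left of j. It passes
  between them because \<eta>(R) lies in B.\<close>

lemma balanced_\<theta>: "balanced R CR D AAB (\<lambda>c0 d. tens AB AA AA (jt_one c0) (j d))"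
proof (rule balancedI)
  fix c0 r d assume "c0 \<in> carrier CR" "r \<in> carrier R" "d \<in> carrier D"
  then show "tens AB AA AA (jt_one (c0 \<odot>\<^sub>r\<^bsub>CR\<^esub> r)) (j d) = tens AB AA AA (jt_one c0) (j (r \<odot>\<^bsub>D\<^esub> d))"
    by (simp add: jt_one_rsmult j_smult tens_AAB_B[OF \<eta>_B])
qed (simp_all add: tens_AAB jt_one_add j_add tens_add_left[OF right_AA left_AA, simplified]
    tens_add_right[OF right_AA left_AA, simplified])

definition \<theta> where
  "\<theta> c = tensor_lift R CR D AAB (\<lambda>c0 d. tens AB AA AA (jt_one c0) (j d)) (coaction_AD R A \<eta> D \<Delta> c)"

lemma \<theta>_left_hom: "\<theta> \<in> left_hom A CR AAB"
proof -
  have "tensor_lift R CR D AAB (\<lambda>c0 d. tens AB AA AA (jt_one c0) (j d)) \<in> left_hom A (tensor R CR D) AAB"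
    by (rule tensor_lift_left_hom[OF bimodule_CR D.left_C AAB.left_module_axioms balanced_\<theta>])
      (simp add: jt_one_smult smult_AAB)
  then show ?thesis
    using coaction_AD_left_hom by (auto simp: left_hom_def hom_def Pi_iff \<theta>_def)
qed

text \<open>The coaction at \<rho>(y) yields p(y0) \<otimes> j(y1). As p takes values in B, the
  first leg moves to the right factor, where the sum is y.\<close>

lemma \<theta>_\<rho>:
  assumes y: "y \<in> carrier A"
  shows "\<theta> (\<rho> y) = tens AB AA AA \<one>\<^bsub>A\<^esub> y"
proof -
  have t: "tens AB AA AA \<one>\<^bsub>A\<^esub> \<in> add_hom A AAB"
    using tens_add_hom(1)[OF right_AA left_AA, of "\<one>\<^bsub>A\<^esub>"] by (simp add: hom_def)
  have b: "balanced R Ar D A (\<lambda>a d. p a \<otimes>\<^bsub>A\<^esub> j d)"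
    using balanced_comp[OF balanced_jt_one_j \<rho>_right_hom id_left_hom] by (simp add: p_def)
  have "\<theta> (\<rho> y) = tensor_lift R Ar D AAB (\<lambda>a d. tens AB AA AA (p a) (j d)) (\<rho> y)"
    unfolding \<theta>_def p_def by (rule tensor_lift_coaction_\<rho>[OF group_AAB balanced_\<theta> y])
  also have "\<dots> = tens AB AA AA \<one>\<^bsub>A\<^esub> (tensor_lift R Ar D A (\<lambda>a d. p a \<otimes>\<^bsub>A\<^esub> j d) (\<rho> y))"
  proof (rule add_hom_tensor_lift_eq[OF right_Ar D.left_C group_A group_AAB b t, symmetric])
    fix a d assume "a \<in> carrier Ar" "d \<in> carrier D"
    then show "tens AB AA AA \<one>\<^bsub>A\<^esub> (p a \<otimes>\<^bsub>A\<^esub> j d) = tens AB AA AA (p a) (j d)"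
      using tens_AAB_B[of "p a" "\<one>\<^bsub>A\<^esub>" "j d"] by (simp add: p_B)
  qed (simp add: y)
  finally show ?thesis by (simp add: p_j_\<rho> y)
qed

lemma \<theta>_can:
  assumes z: "z \<in> carrier AAB"
  shows "\<theta> (can z) = z"
proof (rule tensor_hom_eqI[OF right_AA left_AA add_hom_comp[OF can_add_hom left_hom_add_hom[OF \<theta>_left_hom]] _ _ z,
      where k = "\<lambda>u. u"])
  fix a x assume "a \<in> carrier AA" "x \<in> carrier AA"
  then have a: "a \<in> carrier A" and x: "x \<in> carrier A" by simp_all
  then show "\<theta> (can (tens AB AA AA a x)) = tens AB AA AA a x"
    by (simp add: can_tens left_hom_smult[OF \<theta>_left_hom] \<theta>_\<rho> smult_AAB)
qed (simp add: hom_def)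

text \<open>The image of c is the sum of j'(c0) \<rho>(j(c1)) = j'(c0) g j(c1), with g = \<rho>(1).
  The compatibility of \<open>jt\<close> rewrites j'(c0) g through the coproduct of c0,
  coassociativity moves the coaction onto the second leg of the coproduct of c, where
  \<open>q\<close> appears, and the inverse identity on C returns c.\<close>

lemma can_\<theta>:
  assumes c: "c \<in> carrier CR"
  shows "can (\<theta> c) = c"
proof (rule tensor_hom_eqI[OF right_Ar D.left_C add_hom_comp[OF left_hom_add_hom[OF \<theta>_left_hom] can_add_hom] _ _ c,
      where k = "\<lambda>u. u"])
  fix a d assume "a \<in> carrier Ar" and d: "d \<in> carrier D"
  then have a: "a \<in> carrier A" by simp
  let ?h = "tensor_lift R CR D AAB (\<lambda>c0 d. tens AB AA AA (jt_one c0) (j d))"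
  \<comment> \<open>Coproduct and coaction of C both come from \<Delta>, so on a \<otimes> d the two
    iterated sums have a common integrand with three legs in D. Exchanging them is then
    coassociativity of \<Delta>.\<close>
  let ?F = "\<lambda>d1 d2 d3. act (tens R Ar D a d1) (jt_one (tens R Ar D \<one>\<^bsub>A\<^esub> d2) \<otimes>\<^bsub>A\<^esub> j d3)"
  have F: "balanced3 R R D D D CR ?F"
    unfolding balanced3_def
    by (auto intro!: balancedI simp: act_closed tens_CR a tens_CR_add act_add_left act_add_right jt_one_add j_add
        A.l_distr A.r_distr D.lsmult_closed D.rsmult_closed tens_CR_act_\<eta> tens_CR_one_smult jt_one_smult act_mult
        CR.lsmult_closed jt_one_act_\<eta> j_smult A.m_assoc)
  have b3: "balanced R D D (tensor R CR D) (\<lambda>d1 d2. tens R CR D (tens R Ar D a d1) d2)"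
    using balanced3D(2)[OF balanced3_tens_left[OF right_Ar D.bimodule_C D.left_C]] a by simp
  have h: "(\<lambda>w. can (?h w)) \<in> add_hom (tensor R CR D) CR"
    by (rule add_hom_comp[OF tensor_lift_hom[OF right_CR D.left_C group_AAB balanced_\<theta>] can_add_hom])
  have coact: "coaction_AD R A \<eta> D \<Delta> (tens R Ar D x e) =
      tensor_lift R D D (tensor R CR D) (\<lambda>d1 d2. tens R CR D (tens R Ar D x d1) d2) (\<Delta> e)"
    if "x \<in> carrier A" "e \<in> carrier D" for x e
    unfolding coaction_AD_def using D.tensor_coaction_tens[OF right_Ar, of x e] that by simp
  have "can (\<theta> (tens R Ar D a d)) =
      tensor_lift R D D CR (\<lambda>d1 d2. jt_one (tens R Ar D a d1) \<odot>\<^bsub>CR\<^esub> \<rho> (j d2)) (\<Delta> d)"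
    unfolding \<theta>_def coact[OF a d]
    by (rule add_hom_tensor_lift_eq[OF D.right_C D.left_C group_CRD group_CR b3 h D.\<Delta>_closed[OF d]])
      (simp add: tensor_lift_tens[OF right_CR D.left_C group_AAB balanced_\<theta>] tens_CR a can_tens)
  also have "\<dots> = tensor_lift R D D CR (\<lambda>d1 d2. tensor_lift R D D CR (\<lambda>x y. ?F x y d2) (\<Delta> d1)) (\<Delta> d)"
  proof (intro tensor_lift_apply_cong)
    fix d1 d2 assume d12: "d1 \<in> carrier D" "d2 \<in> carrier D"
    have "(\<lambda>c. act c (j d2)) \<in> add_hom CR CR"
      by (rule add_homI) (simp_all add: act_closed act_add_left d12)
    then have "(\<lambda>w. act (tensor_lift A C C CR (\<lambda>c1 c2. act c1 (jt_one c2)) w) (j d2)) \<in> add_hom CC CR"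
      by (rule add_hom_comp[OF tensor_lift_hom[OF right_C left_C group_CR balanced_act_jt_one]])
    then have "act (tensor_lift A C C CR (\<lambda>c1 c2. act c1 (jt_one c2)) (\<Delta>C (tens R Ar D a d1))) (j d2) =
        tensor_lift R D D CR (\<lambda>x y. ?F x y d2) (\<Delta> d1)"
      unfolding \<Delta>C_tens[OF a d12(1)]
      using balanced3D(2)[OF balanced3_\<Delta>C_map] a d12
      by (intro add_hom_tensor_lift_eq[OF D.right_C D.left_C group_CC group_CR, where
            h = "\<lambda>w. act (tensor_lift A C C CR (\<lambda>c1 c2. act c1 (jt_one c2)) w) (j d2)"])
        (simp_all add: D.\<Delta>_closed tensor_lift_tens[OF right_C left_C group_CR balanced_act_jt_one] tens_CR act_mult)
    then show "jt_one (tens R Ar D a d1) \<odot>\<^bsub>CR\<^esub> \<rho> (j d2) = tensor_lift R D D CR (\<lambda>x y. ?F x y d2) (\<Delta> d1)"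
      by (simp add: act_jt_one_coproduct tens_CR a d12 act_smult \<rho>_one[of "j d2"])
  qed
  also have "\<dots> = tensor_lift R D D CR (\<lambda>d1 d2. tensor_lift R D D CR (?F d1) (\<Delta> d2)) (\<Delta> d)"
    by (rule D.coassoc[OF group_CR F d])
  also have "\<dots> = tensor_lift A C C CR (\<lambda>c1 c2. act c1 (q c2)) (\<Delta>C (tens R Ar D a d))"
    unfolding \<Delta>C_tens[OF a d]
  proof (rule add_hom_tensor_lift_eq[OF D.right_C D.left_C group_CC group_CR _
        tensor_lift_hom[OF right_C left_C group_CR balanced_act_q] D.\<Delta>_closed[OF d], symmetric])
    show "balanced R D D CC (\<Delta>C_map a)"
      using balanced3D(2)[OF balanced3_\<Delta>C_map] a by simp
    fix d1 d2 assume d12: "d1 \<in> carrier D" "d2 \<in> carrier D"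
    have b3': "balanced R D D (tensor R CR D) (\<lambda>d1 d2. tens R CR D (tens R Ar D \<one>\<^bsub>A\<^esub> d1) d2)"
      using balanced3D(2)[OF balanced3_tens_left[OF right_Ar D.bimodule_C D.left_C]] by simp
    have "act (tens R Ar D a d1) \<in> add_hom A CR"
      by (rule add_homI) (simp_all add: act_closed act_add_right tens_CR a d12)
    then have "(\<lambda>w. act (tens R Ar D a d1) (tensor_lift R CR D A (\<lambda>c0 d. jt_one c0 \<otimes>\<^bsub>A\<^esub> j d) w))
        \<in> add_hom (tensor R CR D) CR"
      by (rule add_hom_comp[OF tensor_lift_hom[OF right_CR D.left_C group_A balanced_jt_one_j]])
    then have "act (tens R Ar D a d1) (q (tens R Ar D \<one>\<^bsub>A\<^esub> d2)) = tensor_lift R D D CR (?F d1) (\<Delta> d2)"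
      unfolding q_def coact[OF A.one_closed d12(2)]
      by (rule add_hom_tensor_lift_eq[OF D.right_C D.left_C group_CRD group_CR b3' _ D.\<Delta>_closed[OF d12(2)]])
        (simp add: tensor_lift_tens[OF right_CR D.left_C group_A balanced_jt_one_j] tens_CR)
    then show "tensor_lift A C C CR (\<lambda>c1 c2. act c1 (q c2)) (\<Delta>C_map a d1 d2) =
        tensor_lift R D D CR (?F d1) (\<Delta> d2)"
      by (simp add: tensor_lift_tens[OF right_C left_C group_CR balanced_act_q] tens_CR a d12)
  qed
  also have "\<dots> = tens R Ar D a d"
    by (rule act_q_coproduct) (rule tens_CR[OF a d])
  finally show "can (\<theta> (tens R Ar D a d)) = tens R Ar D a d" .
qed (simp add: hom_def)

theorem galois: "galois_extension R A \<eta> D \<rho> B"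
  unfolding galois_iff
  using \<theta>_can can_\<theta> add_hom_closed[OF can_add_hom] add_hom_closed[OF left_hom_add_hom[OF \<theta>_left_hom]]
  by (intro bij_betw_byWitness[of _ \<theta>]) auto

end

section \<open>Extracting the data of a cleft extension\<close>

context coring_ext
begin

theorem cleft_imp_galois_normal_basis:
  assumes "cleft_extension K R A \<eta> D \<Delta> \<epsilon> \<rho> B"
  shows "galois_extension R A \<eta> D \<rho> B \<and> normal_basis_property K R A \<eta> D \<Delta> \<rho> B"
proof -
  from assms obtain act where coring: "cleft_coring K R A \<eta> D \<Delta> \<epsilon> act"
    and bicom: "cleft_bicomodule R A \<eta> D \<Delta> \<epsilon> \<rho> act"
    by (auto simp: cleft_extension_def)
  note bicom = bicom[unfolded cleft_bicomodule_def Let_def]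
  let ?C = "coring_AD R A \<eta> D act"
  interpret coring_action K R A \<eta> D \<Delta> \<epsilon> \<rho> act
  proof (intro coring_action.intro coring_action_axioms.intro coring_ext_axioms)
    show "ring_bimodule A A ?C"
      using coring unfolding cleft_coring_def coring_def Let_def by (blast intro: bimodule_ring_bimodule)
    show "act c (\<eta> r) = c \<odot>\<^sub>r\<^bsub>CR\<^esub> r" if "c \<in> carrier CR" "r \<in> carrier R" for c r
      using coring that
      by (simp add: cleft_coring_def Let_def coring_AD_def with_right_action_def tensor_AD_def)
  qed
  have \<rho>C_right: "coaction_A R A \<eta> D \<rho> act \<in> right_hom A Al (tensor A Al C)"
    and \<rho>C_left: "coaction_A R A \<eta> D \<rho> act \<in> left_hom R Al (tensor A Al C)"
    using bicom[THEN conjunct1] bicom[THEN conjunct2, THEN conjunct1] by (simp_all only: comodule_def)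
  \<comment> \<open>The comodule axioms make the coaction into A \<otimes> C right A-linear; reading
    off the C-factor of 1 \<otimes> c transfers this to \<rho>.\<close>
  interpret grouplike_action K R A \<eta> D \<Delta> \<epsilon> \<rho> act
  proof
    fix x a assume x: "x \<in> carrier A" and a: "a \<in> carrier A"
    have "tens A Al C \<one>\<^bsub>A\<^esub> (\<rho> (x \<otimes>\<^bsub>A\<^esub> a)) = tens A Al C \<one>\<^bsub>A\<^esub> (act (\<rho> x) a)"
      using right_hom_rsmult[OF \<rho>C_right, of x a] rsmult_tens[OF right_Al bimodule_C, of a "\<one>\<^bsub>A\<^esub>" "\<rho> x"] x a
      by (simp add: coaction_A_def)
    then show "\<rho> (x \<otimes>\<^bsub>A\<^esub> a) = act (\<rho> x) a"
      by (rule tens_Al_inj[rotated 2]) (simp_all add: x a act_closed)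
  qed
  \<comment> \<open>Left R-linearity of the coaction says \<rho>(\<eta>(r) x) = \<eta>(r) \<rho>(x),
    which is coinvariance of \<eta>(r). This is how B comes to contain \<eta>(R).\<close>
  have \<eta>_B: "\<eta> r \<in> B" if r: "r \<in> carrier R" for r
  proof (rule B_I)
    fix x assume x: "x \<in> carrier A"
    have "tens A Al C \<one>\<^bsub>A\<^esub> (\<rho> (\<eta> r \<otimes>\<^bsub>A\<^esub> x)) = tens A Al C (\<eta> r) (\<rho> x)"
      using left_hom_smult[OF \<rho>C_left, of r x] smult_tens[OF bimodule_Al left_C, of r "\<one>\<^bsub>A\<^esub>" "\<rho> x"] x r
      by (simp add: coaction_A_def)
    also have "\<dots> = tens A Al C \<one>\<^bsub>A\<^esub> (\<eta> r \<odot>\<^bsub>CR\<^esub> \<rho> x)"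
      using tens_rsmult[OF right_Al left_C, of "\<one>\<^bsub>A\<^esub>" "\<eta> r" "\<rho> x"] x r by simp
    finally show "\<rho> (\<eta> r \<otimes>\<^bsub>A\<^esub> x) = \<eta> r \<odot>\<^bsub>CR\<^esub> \<rho> x"
      by (rule tens_Al_inj[rotated 2]) (simp_all add: x r CR.lsmult_closed)
  qed (simp add: r)
  from bicom[THEN conjunct2, THEN conjunct2, unfolded tensor_AD_def] obtain j jt where j_jt:
    "j \<in> left_hom R D Al \<inter> comodule_hom R D D \<Delta> Ar \<rho> \<and>
    jt \<in> left_hom A CR H \<inter> right_hom R CR H \<and>
    (\<forall>c\<in>carrier C. \<forall>x\<in>carrier A.
      tensor_lift A C C C (\<lambda>c1 c2. c1 \<odot>\<^sub>r\<^bsub>C\<^esub> jt c2 x) (\<Delta>C c) =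
      tensor_lift A Al C C (\<lambda>x0 x1. jt c x0 \<odot>\<^bsub>C\<^esub> x1) (coaction_A R A \<eta> D \<rho> act x)) \<and>
    (\<forall>d\<in>carrier D.
      (\<lambda>x\<in>carrier A. \<eta> (\<epsilon> d) \<otimes>\<^bsub>A\<^esub> x)
        \<in> comodule_hom A C Al (coaction_A R A \<eta> D \<rho> act) Al (coaction_A R A \<eta> D \<rho> act) \<and>
      tensor_lift A Al C H (\<lambda>y0 y1. y0 \<odot>\<^bsub>H\<^esub> jt y1) (coaction_A R A \<eta> D \<rho> act (j d)) =
      (\<lambda>x\<in>carrier A. \<eta> (\<epsilon> d) \<otimes>\<^bsub>A\<^esub> x)) \<and>
    (\<forall>c\<in>carrier C.
      tensor_lift A C C C
        (\<lambda>c1 c2. c1 \<odot>\<^sub>r\<^bsub>C\<^esub>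
          tensor_lift R CR D A (\<lambda>c0 d. jt c0 (j d)) (coaction_AD R A \<eta> D \<Delta> c2)) (\<Delta>C c) = c)"
    by (elim exE)
  note j = j_jt[THEN conjunct1] and j_jt = j_jt[THEN conjunct2]
  note jt = j_jt[THEN conjunct1] and j_jt = j_jt[THEN conjunct2]
  note jt_coact = j_jt[THEN conjunct1] and j_jt = j_jt[THEN conjunct2]
  note jt_j = j_jt[THEN conjunct1] and jt_j_coact = j_jt[THEN conjunct2]
  interpret cleft_data K R A \<eta> D \<Delta> \<epsilon> \<rho> act j jt
    by (intro cleft_data.intro grouplike_action_axioms coring_subring.intro coring_ext_axioms
        coring_subring_axioms.intro cleft_data_axioms.intro \<eta>_B
        IntD1[OF j] IntD2[OF j] IntD1[OF jt] IntD2[OF jt] bspec[OF bspec[OF jt_coact]]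
        conjunct2[OF bspec[OF jt_j]] bspec[OF jt_j_coact])
  show ?thesis
    using galois normal_basis by blast
qed

end

section \<open>From Galois extensions with a normal basis to cleft extensions\<close>

locale galois_coring_ext = coring_subring +
  assumes can_bij: "bij_betw can (carrier AAB) (carrier CR)"
begin

definition cani where "cani = inv_into (carrier AAB) can"

lemma cani_closed: "c \<in> carrier CR \<Longrightarrow> cani c \<in> carrier AAB"
  and can_cani: "c \<in> carrier CR \<Longrightarrow> can (cani c) = c"
  and cani_can: "z \<in> carrier AAB \<Longrightarrow> cani (can z) = z"
  unfolding cani_def using can_bij
  by (simp_all add: bij_betw_def inv_into_into f_inv_into_f)

lemma cani_left_hom: "cani \<in> left_hom A CR AAB"
proof (rule left_homI)
  fix c c' assume c: "c \<in> carrier CR" "c' \<in> carrier CR"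
  have "cani (can (cani c \<oplus>\<^bsub>AAB\<^esub> cani c')) = cani c \<oplus>\<^bsub>AAB\<^esub> cani c'"
    by (rule cani_can) (simp add: c cani_closed)
  then show "cani (c \<oplus>\<^bsub>CR\<^esub> c') = cani c \<oplus>\<^bsub>AAB\<^esub> cani c'"
    by (simp add: c cani_closed add_hom_add[OF can_add_hom] can_cani)
next
  fix a c assume c: "a \<in> carrier A" "c \<in> carrier CR"
  have "cani (can (a \<odot>\<^bsub>AAB\<^esub> cani c)) = a \<odot>\<^bsub>AAB\<^esub> cani c"
    by (rule cani_can) (simp add: c cani_closed AAB.lsmult_closed)
  then show "cani (a \<odot>\<^bsub>CR\<^esub> c) = a \<odot>\<^bsub>AAB\<^esub> cani c"
    by (simp add: c cani_closed left_hom_smult[OF can_left_hom] can_cani)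
qed (rule cani_closed)

lemma cani_smult_\<rho>: "\<lbrakk>a \<in> carrier A; x \<in> carrier A\<rbrakk> \<Longrightarrow> cani (a \<odot>\<^bsub>CR\<^esub> \<rho> x) = tens AB AA AA a x"
  using cani_can[OF tens_AAB] by (simp add: can_tens)

text \<open>Surjectivity of \<open>can\<close> writes every element as a sum of elements a
  \<rho>(x). These generators replace pure tensors because action, coproduct and counit are all
  explicit on them.\<close>

lemma CR_induct [consumes 1, case_names gen add]:
  assumes c: "c \<in> carrier CR"
    and gen: "\<And>a x. \<lbrakk>a \<in> carrier A; x \<in> carrier A\<rbrakk> \<Longrightarrow> P (a \<odot>\<^bsub>CR\<^esub> \<rho> x)"
    and add: "\<And>u v. \<lbrakk>u \<in> carrier CR; v \<in> carrier CR; P u; P v\<rbrakk> \<Longrightarrow> P (u \<oplus>\<^bsub>CR\<^esub> v)"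
  shows "P c"
proof -
  have "P (can z)" if "z \<in> carrier AAB" for z
    using that by (induction rule: tensor_induct[OF right_AA left_AA, consumes 1])
      (simp_all add: can_tens gen add add_hom_add[OF can_add_hom] add_hom_closed[OF can_add_hom])
  from this[OF cani_closed[OF c]] show ?thesis by (simp add: can_cani c)
qed

lemma CR_hom_eqI:
  assumes "h \<in> add_hom CR G" "k \<in> add_hom CR G"
    and "\<And>a x. \<lbrakk>a \<in> carrier A; x \<in> carrier A\<rbrakk> \<Longrightarrow> h (a \<odot>\<^bsub>CR\<^esub> \<rho> x) = k (a \<odot>\<^bsub>CR\<^esub> \<rho> x)"
    and "c \<in> carrier CR"
  shows "h c = k c"
  using assms(4) by (induction rule: CR_induct) (simp_all add: assms(3) add_hom_add[OF assms(1)] add_hom_add[OF assms(2)])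

definition act where "act c a = can (cani c \<odot>\<^sub>r\<^bsub>AAB\<^esub> a)"

lemma act_gen:
  "\<lbrakk>a \<in> carrier A; x \<in> carrier A; y \<in> carrier A\<rbrakk> \<Longrightarrow> act (a \<odot>\<^bsub>CR\<^esub> \<rho> x) y = a \<odot>\<^bsub>CR\<^esub> \<rho> (x \<otimes>\<^bsub>A\<^esub> y)"
  by (simp add: act_def cani_smult_\<rho> rsmult_AAB can_tens)

lemma cani_act: "\<lbrakk>c \<in> carrier CR; a \<in> carrier A\<rbrakk> \<Longrightarrow> cani (act c a) = cani c \<odot>\<^sub>r\<^bsub>AAB\<^esub> a"
  by (simp add: act_def cani_can cani_closed AAB.rsmult_closed)

lemma act_ring_bimodule: "ring_bimodule A A (coring_AD R A \<eta> D act)"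
proof -
  let ?C = "coring_AD R A \<eta> D act"
  note cs = coring_AD_simps[of act]
  have cl: "act c a \<in> carrier CR" if "c \<in> carrier CR" "a \<in> carrier A" for c a
    using that by (simp add: act_def add_hom_closed[OF can_add_hom] AAB.rsmult_closed cani_closed)
  note can = add_hom_add[OF can_add_hom] left_hom_smult[OF can_left_hom]
    add_hom_add[OF left_hom_add_hom[OF cani_left_hom]] left_hom_smult[OF cani_left_hom]
  have "abelian_group ?C"
  proof (rule abelian_groupI)
    fix x assume "x \<in> carrier ?C"
    then show "\<exists>y\<in>carrier ?C. y \<oplus>\<^bsub>?C\<^esub> x = \<zero>\<^bsub>?C\<^esub>"
      by (intro bexI[of _ "\<ominus>\<^bsub>CR\<^esub> x"]) (simp_all add: cs CR.M.l_neg)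
  qed (simp_all add: cs CR.M.a_ac)
  then interpret M: abelian_group ?C .
  show ?thesis
  proof (intro ring_bimodule.intro ring_bimodule_axioms.intro left_module.intro left_module_axioms.intro
      right_module.intro right_module_axioms.intro A.ring_axioms M.abelian_group_axioms)
    fix x a b assume "x \<in> carrier ?C" and ab: "a \<in> carrier A" "b \<in> carrier A"
    then have x: "x \<in> carrier CR" by (simp add: cs)
    show "x \<odot>\<^sub>r\<^bsub>?C\<^esub> (a \<otimes>\<^bsub>A\<^esub> b) = (x \<odot>\<^sub>r\<^bsub>?C\<^esub> a) \<odot>\<^sub>r\<^bsub>?C\<^esub> b"
      using x ab cani_act[OF x ab(1)] unfolding cs
      by (simp add: act_def[of x] act_def[of "can _"] cani_can AAB.rsmult_closed AAB.rsmult_assoc cani_closed)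
  qed (simp_all add: cs cl[unfolded act_def] act_def can can_cani cani_closed AAB.rsmult_closed AAB.lsmult_closed AAB.rsmult_l_distr
      AAB.rsmult_r_distr AAB.rsmult_one AAB.smult_rsmult CR.lsmult_closed CR.lsmult_l_distr
      CR.lsmult_r_distr CR.lsmult_assoc CR.lsmult_one)
qed

sublocale grouplike_action K R A \<eta> D \<Delta> \<epsilon> \<rho> act
proof (intro grouplike_action.intro coring_action.intro coring_action_axioms.intro
    grouplike_action_axioms.intro coring_ext_axioms act_ring_bimodule)
  fix x a assume "x \<in> carrier A" "a \<in> carrier A"
  then show "\<rho> (x \<otimes>\<^bsub>A\<^esub> a) = act (\<rho> x) a"
    using act_gen[of "\<one>\<^bsub>A\<^esub>" x a] by (simp add: CR.lsmult_one)
next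
  fix c r assume c: "c \<in> carrier CR" and r: "r \<in> carrier R"
  interpret C: ring_bimodule A A "coring_AD R A \<eta> D act" by (rule act_ring_bimodule)
  have "(\<lambda>c. act c (\<eta> r)) \<in> add_hom CR CR"
    using right_module_rsmult_hom[OF C.right_module_axioms, of "\<eta> r"] r by (simp add: coring_AD_simps hom_def)
  \<comment> \<open>On generators this is a \<rho>(x \<eta>(r)) = a \<rho>(x) r, the right
    R-linearity of \<rho>.\<close>
  then show "act c (\<eta> r) = c \<odot>\<^sub>r\<^bsub>CR\<^esub> r"
    by (rule CR_hom_eqI[OF _ right_module_rsmult_hom[OF right_CR r] _ c])
      (simp add: r act_gen \<rho>_rsmult CR.smult_rsmult)
qed

abbreviation "\<epsilon>C \<equiv> counit_AD R A \<eta> D \<epsilon>"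

text \<open>Along \<open>can\<close> this is the coproduct of the Sweedler coring of B in A, which
  sends a \<otimes> x to (a \<otimes> 1) \<otimes> (1 \<otimes> x).\<close>

lemma \<Delta>C_gen: "\<lbrakk>a \<in> carrier A; x \<in> carrier A\<rbrakk> \<Longrightarrow>
    \<Delta>C (a \<odot>\<^bsub>CR\<^esub> \<rho> x) = tens A C C (a \<odot>\<^bsub>CR\<^esub> \<rho> \<one>\<^bsub>A\<^esub>) (\<rho> x)"
  by (simp add: left_hom_smult[OF \<Delta>C_left_hom] \<Delta>C_\<rho> smult_CC)

lemma \<epsilon>C_gen: "\<lbrakk>a \<in> carrier A; x \<in> carrier A\<rbrakk> \<Longrightarrow> \<epsilon>C (a \<odot>\<^bsub>CR\<^esub> \<rho> x) = a \<otimes>\<^bsub>A\<^esub> x"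
  using left_hom_smult[OF counit_AD_left_hom] by (simp add: counit_\<rho>)

lemma \<epsilon>C_add: "\<lbrakk>c \<in> carrier CR; c' \<in> carrier CR\<rbrakk> \<Longrightarrow> \<epsilon>C (c \<oplus>\<^bsub>CR\<^esub> c') = \<epsilon>C c \<oplus>\<^bsub>A\<^esub> \<epsilon>C c'"
  and \<epsilon>C_smult: "\<lbrakk>a \<in> carrier A; c \<in> carrier CR\<rbrakk> \<Longrightarrow> \<epsilon>C (a \<odot>\<^bsub>CR\<^esub> c) = a \<otimes>\<^bsub>A\<^esub> \<epsilon>C c"
  and \<epsilon>C_closed: "c \<in> carrier CR \<Longrightarrow> \<epsilon>C c \<in> carrier A"
  using add_hom_add[OF left_hom_add_hom[OF counit_AD_left_hom], of c c']
    left_hom_smult[OF counit_AD_left_hom, of a c]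
    add_hom_closed[OF left_hom_add_hom[OF counit_AD_left_hom], of c] by simp_all

lemma \<Delta>C_left: "\<Delta>C \<in> left_hom A C CC"
  using \<Delta>C_left_hom by (simp add: left_hom_def hom_def)

lemma \<Delta>C_add_hom: "\<Delta>C \<in> add_hom CR CC"
  by (rule left_hom_add_hom[OF \<Delta>C_left_hom])

text \<open>At a generator a \<rho>(x) both sides equal a \<rho>(1) \<otimes> \<rho>(x y), where y
  is the acting element.\<close>

lemma \<Delta>C_act: "\<lbrakk>c \<in> carrier CR; a \<in> carrier A\<rbrakk> \<Longrightarrow> \<Delta>C (act c a) = \<Delta>C c \<odot>\<^sub>r\<^bsub>CC\<^esub> a"
proof -
  assume c: "c \<in> carrier CR" and a: "a \<in> carrier A"
  have "(\<lambda>c. act c a) \<in> add_hom CR CR"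
    by (rule add_homI) (simp_all add: act_closed act_add_left a)
  from add_hom_comp[OF this \<Delta>C_add_hom]
  show "\<Delta>C (act c a) = \<Delta>C c \<odot>\<^sub>r\<^bsub>CC\<^esub> a"
    by (rule CR_hom_eqI[OF _ add_hom_comp[OF \<Delta>C_add_hom right_module_rsmult_hom[OF CC.right_module_axioms a]] _ c])
      (simp add: act_gen a \<Delta>C_gen rsmult_CC CR.lsmult_closed \<rho>_act[symmetric])
qed

lemma \<Delta>C_right: "\<Delta>C \<in> right_hom A C CC"
  using \<Delta>C_add_hom \<Delta>C_act by (simp add: right_hom_def hom_def)

lemma \<epsilon>C_act: "\<lbrakk>c \<in> carrier CR; a \<in> carrier A\<rbrakk> \<Longrightarrow> \<epsilon>C (act c a) = \<epsilon>C c \<otimes>\<^bsub>A\<^esub> a"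
  by (induction rule: CR_induct)
    (simp_all add: act_gen \<epsilon>C_gen A.m_assoc act_add_left \<epsilon>C_add act_closed \<epsilon>C_closed A.l_distr)

text \<open>At a generator a \<rho>(x) both sides are a g \<otimes> (g \<otimes> \<rho>(x)), with g
  = \<rho>(1).\<close>

lemma CC_coassoc:
  assumes c: "c \<in> carrier CR"
  shows "tensor_assoc A A C C C (tensor_map A C C CC C \<Delta>C id (\<Delta>C c)) = tensor_map A C C C CC id \<Delta>C (\<Delta>C c)"
proof (rule CR_hom_eqI[OF _ _ _ c, where
      h = "\<lambda>c. tensor_assoc A A C C C (tensor_map A C C CC C \<Delta>C id (\<Delta>C c))" and
      k = "\<lambda>c. tensor_map A C C C CC id \<Delta>C (\<Delta>C c)"])
  note m1 = tensor_map_hom[OF right_C left_C CC.right_module_axioms left_C \<Delta>C_right id_left_hom]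
  note m2 = tensor_map_hom[OF right_C left_C right_C CC.left_module_axioms id_right_hom \<Delta>C_left]
  note t1 = tensor_map_tens[OF right_C left_C CC.right_module_axioms left_C \<Delta>C_right id_left_hom]
  note t2 = tensor_map_tens[OF right_C left_C right_C CC.left_module_axioms id_right_hom \<Delta>C_left]
  show "(\<lambda>c. tensor_assoc A A C C C (tensor_map A C C CC C \<Delta>C id (\<Delta>C c))) \<in> add_hom CR (tensor A C CC)"
    by (rule add_hom_comp[OF add_hom_comp[OF \<Delta>C_add_hom m1] tensor_assoc_hom[OF right_C bimodule_C left_C]])
  show "(\<lambda>c. tensor_map A C C C CC id \<Delta>C (\<Delta>C c)) \<in> add_hom CR (tensor A C CC)"
    by (rule add_hom_comp[OF \<Delta>C_add_hom m2])
  fix a x assume "a \<in> carrier A" "x \<in> carrier A"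
  then show "tensor_assoc A A C C C (tensor_map A C C CC C \<Delta>C id (\<Delta>C (a \<odot>\<^bsub>CR\<^esub> \<rho> x))) =
      tensor_map A C C C CC id \<Delta>C (\<Delta>C (a \<odot>\<^bsub>CR\<^esub> \<rho> x))"
    by (simp add: \<Delta>C_gen \<Delta>C_\<rho> t1 t2 CR.lsmult_closed tensor_assoc_tens[OF right_C bimodule_C left_C])
qed

text \<open>At a generator a \<rho>(x) the first coproduct leg is a \<rho>(1), whose counit is
  a.\<close>

lemma C_counit_left:
  assumes c: "c \<in> carrier CR"
  shows "tensor_lift A C C C (\<lambda>c1 c2. \<epsilon>C c1 \<odot>\<^bsub>C\<^esub> c2) (\<Delta>C c) = c"
proof -
  have b: "balanced A C C C (\<lambda>c1 c2. \<epsilon>C c1 \<odot>\<^bsub>C\<^esub> c2)"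
    by (rule balancedI) (simp_all add: \<epsilon>C_closed \<epsilon>C_add \<epsilon>C_act CR.lsmult_closed CR.lsmult_l_distr
        CR.lsmult_r_distr CR.lsmult_assoc)
  have h: "tensor_lift A C C C (\<lambda>c1 c2. \<epsilon>C c1 \<odot>\<^bsub>C\<^esub> c2) \<in> add_hom CC CR"
    using tensor_lift_hom[OF right_C left_C group_C b] by (simp add: hom_def)
  show ?thesis
    by (rule CR_hom_eqI[OF add_hom_comp[OF \<Delta>C_add_hom h] _ _ c, where k = "\<lambda>c. c"])
      (use tensor_lift_tens[OF right_C left_C group_C b] in
        \<open>simp_all add: hom_def \<Delta>C_gen CR.lsmult_closed \<epsilon>C_gen\<close>)
qed

text \<open>At a generator a \<rho>(x) the second leg \<rho>(x) has counit x, and a \<rho>(1) acted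
  on by x is a \<rho>(x).\<close>

lemma C_counit_right:
  assumes c: "c \<in> carrier CR"
  shows "tensor_lift A C C C (\<lambda>c1 c2. c1 \<odot>\<^sub>r\<^bsub>C\<^esub> \<epsilon>C c2) (\<Delta>C c) = c"
proof -
  have b: "balanced A C C C (\<lambda>c1 c2. c1 \<odot>\<^sub>r\<^bsub>C\<^esub> \<epsilon>C c2)"
    by (rule balancedI) (simp_all add: \<epsilon>C_closed \<epsilon>C_add \<epsilon>C_smult act_closed act_add_left act_add_right act_mult)
  have h: "tensor_lift A C C C (\<lambda>c1 c2. c1 \<odot>\<^sub>r\<^bsub>C\<^esub> \<epsilon>C c2) \<in> add_hom CC CR"
    using tensor_lift_hom[OF right_C left_C group_C b] by (simp add: hom_def)
  show ?thesis
    by (rule CR_hom_eqI[OF add_hom_comp[OF \<Delta>C_add_hom h] _ _ c, where k = "\<lambda>c. c"])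
      (use tensor_lift_tens[OF right_C left_C group_C b] in
        \<open>simp_all add: hom_def \<Delta>C_gen CR.lsmult_closed counit_\<rho> act_gen\<close>)
qed

text \<open>The element c 1 of A is \<eta>(c 1), so its transported right action is the original
  R-action, to which \<open>central_CR\<close> applies.\<close>

lemma bimodule_K_C: "bimodule K A A C"
proof -
  have "(c \<odot>\<^bsub>A\<^esub> \<one>\<^bsub>A\<^esub>) \<odot>\<^bsub>CR\<^esub> x = act x (c \<odot>\<^bsub>A\<^esub> \<one>\<^bsub>A\<^esub>)" if "c \<in> carrier K" "x \<in> carrier CR" for c x
    using act_\<eta>[of x "c \<odot>\<^bsub>R\<^esub> \<one>\<^bsub>R\<^esub>"] that by (simp add: \<eta>_central central_CR)
  then show ?thesis
    by (simp add: bimodule_def assoc_algebra_A left_C right_C act_smult)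
qed

lemma coring_C: "coring K A C \<Delta>C \<epsilon>C"
  unfolding coring_def
proof (intro conjI ballI)
  show "\<Delta>C \<in> left_hom A C CC \<inter> right_hom A C CC"
    using \<Delta>C_left \<Delta>C_right by simp
  show "\<epsilon>C \<in> left_hom A C AA \<inter> right_hom A C AA"
    by (auto intro!: left_homI right_homI simp: \<epsilon>C_closed \<epsilon>C_add \<epsilon>C_smult \<epsilon>C_act)
  fix c assume "c \<in> carrier C"
  then have c: "c \<in> carrier CR" by simp
  show "tensor_assoc A A C C C (tensor_map A C C CC C \<Delta>C id (\<Delta>C c)) = tensor_map A C C C CC id \<Delta>C (\<Delta>C c)"
    by (rule CC_coassoc[OF c])
  show "tensor_lift A C C C (\<lambda>c1 c2. \<epsilon>C c1 \<odot>\<^bsub>C\<^esub> c2) (\<Delta>C c) = c"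
    by (rule C_counit_left[OF c])
  show "tensor_lift A C C C (\<lambda>c1 c2. c1 \<odot>\<^sub>r\<^bsub>C\<^esub> \<epsilon>C c2) (\<Delta>C c) = c"
    by (rule C_counit_right[OF c])
qed (rule bimodule_K_C)

abbreviation "CCR \<equiv> tensor A C CR"

lemma bimodule_CCR: "ring_bimodule A R CCR"
  by (rule tensor_ring_bimodule[OF bimodule_C bimodule_CR])

lemmas right_CCR = ring_bimodule_right[OF bimodule_CCR]

text \<open>The coproduct takes values in C \<otimes> C with A acting on the right, while the
  comodule condition refers to the same group with R acting there. The identification lets formulas
  pass between the two.\<close>

lemma tens_CCR: "tens A C CR = tens A C C"
  and carrier_CCR: "carrier CCR = carrier CC"
  and add_CCR: "ring.add CCR = ring.add CC"
  unfolding coring_AD_def tensor_AD_def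
  by (simp_all only: tens_with_right_action carrier_tensor_with_right_action add_tensor_with_right_action)

lemma coaction_AD_gen:
  assumes a: "a \<in> carrier A" and y: "y \<in> carrier A"
  shows "coaction_AD R A \<eta> D \<Delta> (a \<odot>\<^bsub>CR\<^esub> \<rho> y) =
    tensor_lift R Ar D (tensor R CR D) (\<lambda>a' d. tens R CR D (a \<odot>\<^bsub>CR\<^esub> \<rho> a') d) (\<rho> y)"
proof -
  note Z = tensor_left_module[OF bimodule_CR D.left_C]
  have "coaction_AD R A \<eta> D \<Delta> (a \<odot>\<^bsub>CR\<^esub> \<rho> y) = a \<odot>\<^bsub>tensor R CR D\<^esub> coaction_AD R A \<eta> D \<Delta> (\<rho> y)"
    by (rule left_hom_smult[OF coaction_AD_left_hom]) (simp_all add: a y)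
  also have "\<dots> = tensor_lift R Ar D (tensor R CR D) (\<lambda>a' d. tens R CR D (a \<odot>\<^bsub>CR\<^esub> \<rho> a') d) (\<rho> y)"
    unfolding coaction_AD_\<rho>[OF y]
    by (rule add_hom_tensor_lift_eq[OF right_Ar D.left_C group_CRD group_CRD balanced_\<rho>_tens
          left_module_smult_hom[OF Z a]]) (simp_all add: y a smult_tens[OF bimodule_CR D.left_C])
  finally show ?thesis .
qed

text \<open>At a generator a \<rho>(x) both composites give (a g \<otimes> \<rho>(x0)) \<otimes> x1,
  with g = \<rho>(1).\<close>

lemma \<Delta>C_comodule_hom:
  "\<Delta>C \<in> comodule_hom R D CR (coaction_AD R A \<eta> D \<Delta>) CCR (coaction_CC R A \<eta> D \<Delta> act)"
proof -
  let ?Z = "tensor R CCR D"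
  let ?F = "\<lambda>c c0 d. tens R CCR D (tens A C CR c c0) d"
  have \<Delta>': "\<Delta>C \<in> add_hom CR CCR"
    using \<Delta>C_add_hom by (simp add: hom_def carrier_CCR add_CCR)
  have rsm: "\<Delta>C (c \<odot>\<^sub>r\<^bsub>CR\<^esub> r) = \<Delta>C c \<odot>\<^sub>r\<^bsub>CCR\<^esub> r" if c: "c \<in> carrier CR" and r: "r \<in> carrier R" for c r
    by (rule CR_hom_eqI[OF add_hom_comp[OF right_module_rsmult_hom[OF right_CR r] \<Delta>']
          add_hom_comp[OF \<Delta>' right_module_rsmult_hom[OF right_CCR r]] _ c])
      (simp add: r \<Delta>C_gen CR.smult_rsmult \<rho>_rsmult[symmetric] rsmult_tens[OF right_C bimodule_CR]
        CR.lsmult_closed tens_CCR[symmetric])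
  have \<Delta>r: "\<Delta>C \<in> right_hom R CR CCR"
    using \<Delta>' rsm by (simp add: right_hom_def)
  note gZ = tensor_abelian_group[OF right_CCR D.left_C]
  have F: "balanced3 A R C CR D ?Z ?F"
    by (rule balanced3_tens_left[OF right_C bimodule_CR D.left_C])
  have bc: "balanced A C CR ?Z (\<lambda>c c'. tensor_lift R CR D ?Z (?F c) (coaction_AD R A \<eta> D \<Delta> c'))"
    using balanced_comp[OF balanced3_lift_right[OF right_C bimodule_CR D.left_C gZ F] id_right_hom coaction_AD_left_hom]
    by simp
  have cc: "coaction_CC R A \<eta> D \<Delta> act =
      tensor_lift A C CR ?Z (\<lambda>c c'. tensor_lift R CR D ?Z (?F c) (coaction_AD R A \<eta> D \<Delta> c'))"
    by (simp add: coaction_CC_def Let_def tensor_AD_def)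
  have "coaction_CC R A \<eta> D \<Delta> act (\<Delta>C c) =
      tensor_map R CR D CCR D \<Delta>C id (coaction_AD R A \<eta> D \<Delta> c)" if c: "c \<in> carrier CR" for c
  proof (rule CR_hom_eqI[OF add_hom_comp[OF \<Delta>'] add_hom_comp[OF left_hom_add_hom[OF coaction_AD_left_hom]] _ c])
    show "coaction_CC R A \<eta> D \<Delta> act \<in> add_hom CCR ?Z"
      unfolding cc by (rule tensor_lift_hom[OF right_C left_CR gZ bc])
    show m: "tensor_map R CR D CCR D \<Delta>C id \<in> add_hom (tensor R CR D) ?Z"
      by (rule tensor_map_hom[OF right_CR D.left_C right_CCR D.left_C \<Delta>r id_left_hom])
    fix a x assume a: "a \<in> carrier A" and x: "x \<in> carrier A"
    let ?g = "a \<odot>\<^bsub>CR\<^esub> \<rho> \<one>\<^bsub>A\<^esub>"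
    have g: "?g \<in> carrier CR" by (simp add: a CR.lsmult_closed)
    have bg: "balanced R CR D ?Z (?F ?g)"
      using balanced3D(2)[OF F, of ?g] g by simp
    \<comment> \<open>Acting by a on the balanced map of \<open>balanced_\<rho>_tens\<close>
      preserves balancedness; \<open>balanced_cong\<close> then rewrites the integrand on the
      carriers.\<close>
    have bg': "balanced R Ar D (tensor R CR D) (\<lambda>a' d. tens R CR D (a \<odot>\<^bsub>CR\<^esub> \<rho> a') d)"
      by (rule iffD1[OF balanced_cong[OF right_Ar D.left_C] balanced_add_hom[OF balanced_\<rho>_tens
            left_module_smult_hom[OF tensor_left_module[OF bimodule_CR D.left_C] a]]])
        (simp add: smult_tens[OF bimodule_CR D.left_C] a)
    have "coaction_CC R A \<eta> D \<Delta> act (\<Delta>C (a \<odot>\<^bsub>CR\<^esub> \<rho> x)) =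
        tensor_lift R CR D ?Z (?F ?g) (coaction_AD R A \<eta> D \<Delta> (\<rho> x))"
      unfolding cc using tensor_lift_tens[OF right_C left_CR gZ bc] a x g
      by (simp add: \<Delta>C_gen tens_CCR[symmetric])
    also have "\<dots> = tensor_lift R Ar D ?Z (\<lambda>a' d. ?F ?g (\<rho> a') d) (\<rho> x)"
      by (rule tensor_lift_coaction_\<rho>[OF gZ bg x])
    also have "\<dots> = tensor_map R CR D CCR D \<Delta>C id (coaction_AD R A \<eta> D \<Delta> (a \<odot>\<^bsub>CR\<^esub> \<rho> x))"
      unfolding coaction_AD_gen[OF a x]
      by (rule add_hom_tensor_lift_eq[OF right_Ar D.left_C group_CRD gZ bg' m, symmetric])
        (simp_all add: x a tensor_map_tens[OF right_CR D.left_C right_CCR D.left_C \<Delta>r id_left_hom]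
          CR.lsmult_closed \<Delta>C_gen tens_CCR)
    finally show "coaction_CC R A \<eta> D \<Delta> act (\<Delta>C (a \<odot>\<^bsub>CR\<^esub> \<rho> x)) =
        tensor_map R CR D CCR D \<Delta>C id (coaction_AD R A \<eta> D \<Delta> (a \<odot>\<^bsub>CR\<^esub> \<rho> x))" .
  qed
  then show ?thesis
    using \<Delta>r by (simp add: comodule_hom_def)
qed

lemma cleft_coring: "cleft_coring K R A \<eta> D \<Delta> \<epsilon> act"
  unfolding cleft_coring_def Let_def
proof (intro conjI ballI)
  show "comodule R D \<Delta> \<epsilon> (tensor_AD R A \<eta> D) (coaction_AD R A \<eta> D \<Delta>)"
    unfolding tensor_AD_def coaction_AD_def by (rule D.comodule_tensor_coaction[OF right_Ar])
  show "\<Delta>C \<in> comodule_hom R D (tensor_AD R A \<eta> D) (coaction_AD R A \<eta> D \<Delta>)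
      (tensor A C (tensor_AD R A \<eta> D)) (coaction_CC R A \<eta> D \<Delta> act)"
    unfolding tensor_AD_def by (rule \<Delta>C_comodule_hom)
qed (simp_all add: coring_C act_\<eta> tensor_AD_def)

section \<open>A as a comodule over the coring A \<otimes> D\<close>

abbreviation "\<rho>C \<equiv> coaction_A R A \<eta> D \<rho> act"

lemma tens_Al_smult:
  "\<lbrakk>a \<in> carrier A; c \<in> carrier CR\<rbrakk> \<Longrightarrow> tens A Al C a c = tens A Al C \<one>\<^bsub>A\<^esub> (a \<odot>\<^bsub>CR\<^esub> c)"
  using tens_rsmult[OF right_Al left_C, of "\<one>\<^bsub>A\<^esub>" a c] by simp

lemma tens_Al: "\<lbrakk>a \<in> carrier A; c \<in> carrier CR\<rbrakk> \<Longrightarrow> tens A Al C a c \<in> carrier (tensor A Al C)"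
  using tens_closed[OF right_Al left_C] by simp

lemma \<rho>C_right_hom: "\<rho>C \<in> right_hom A Al (tensor A Al C)"
  unfolding coaction_A_def
  by (rule right_homI)
    (simp_all add: tens_Al \<rho>_add tens_add_right[OF right_Al left_C, simplified] \<rho>_act
      rsmult_tens[OF right_Al bimodule_C])

text \<open>Coinvariance of \<eta>(r) pulls it out of \<rho>, and balancedness over A moves it to
  the first factor.\<close>

lemma \<rho>C_left_hom: "\<rho>C \<in> left_hom R Al (tensor A Al C)"
  unfolding coaction_A_def
  by (rule left_homI)
    (simp_all add: tens_Al \<rho>_add tens_add_right[OF right_Al left_C, simplified] B_\<rho> \<eta>_B
      smult_tens[OF bimodule_Al left_C] tens_Al_smult[of "\<eta> _"])

text \<open>Coassociativity is the formula for the coproduct of \<rho>(x) with 1 in front: both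
  sides are 1 \<otimes> (\<rho>(1) \<otimes> \<rho>(x)). The counit law is that of \<rho>.\<close>

lemma comodule_\<rho>C: "comodule A C \<Delta>C \<epsilon>C Al \<rho>C"
  unfolding comodule_def
proof (intro conjI ballI right_Al \<rho>C_right_hom)
  fix x assume "x \<in> carrier Al"
  then have x: "x \<in> carrier A" by simp
  note r = tensor_right_module[OF right_Al bimodule_C]
  have "tensor_map A Al C (tensor A Al C) C \<rho>C id (\<rho>C x) = tens A (tensor A Al C) C (\<rho>C \<one>\<^bsub>A\<^esub>) (\<rho> x)"
    using tensor_map_tens[OF right_Al left_C r left_C \<rho>C_right_hom id_left_hom, of "\<one>\<^bsub>A\<^esub>" "\<rho> x"] x
    by (simp add: fun_cong[OF coaction_A_def])
  moreover have "tensor_map A Al C Al CC id \<Delta>C (\<rho>C x) = tens A Al CC \<one>\<^bsub>A\<^esub> (\<Delta>C (\<rho> x))"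
    using tensor_map_tens[OF right_Al left_C right_Al CC.left_module_axioms id_right_hom \<Delta>C_left,
        of "\<one>\<^bsub>A\<^esub>" "\<rho> x"] x
    by (simp add: coaction_A_def)
  ultimately show "tensor_assoc A A Al C C (tensor_map A Al C (tensor A Al C) C \<rho>C id (\<rho>C x)) =
      tensor_map A Al C Al CC id \<Delta>C (\<rho>C x)"
    using tensor_assoc_tens[OF right_Al bimodule_C left_C, of "\<one>\<^bsub>A\<^esub>" "\<rho> \<one>\<^bsub>A\<^esub>" "\<rho> x"] x
    by (simp add: coaction_A_def \<Delta>C_\<rho>)
  have b: "balanced A Al C A (\<lambda>y c. y \<otimes>\<^bsub>A\<^esub> \<epsilon>C c)"
    by (rule balancedI) (simp_all add: \<epsilon>C_closed \<epsilon>C_add \<epsilon>C_smult A.l_distr A.r_distr A.m_assoc)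
  show "tensor_lift A Al C Al (\<lambda>y c. y \<odot>\<^sub>r\<^bsub>Al\<^esub> \<epsilon>C c) (\<rho>C x) = x"
    using tensor_lift_tens[OF right_Al left_C group_A b, of "\<one>\<^bsub>A\<^esub>" "\<rho> x"] x
    by (simp add: coaction_A_def tensor_lift_ring_bimod counit_\<rho>)
qed

end

section \<open>The maps j and \<open>jt\<close> obtained from a normal basis\<close>

locale galois_normal_basis = galois_coring_ext +
  fixes f
  assumes f_bij: "bij_betw f (carrier A) (carrier (tensor R Bm D))"
    and f_left: "f \<in> left_hom AB Ar (tensor R Bm D)"
    and f_comodule: "f \<in> comodule_hom R D Ar \<rho> (tensor R Bm D) (tensor_coaction R Bm D \<Delta>)"
begin

abbreviation "Q \<equiv> tensor R Bm D"
abbreviation "\<rho>Q \<equiv> tensor_coaction R Bm D \<Delta>"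

lemma bimodule_Q: "ring_bimodule AB R Q"
  by (rule tensor_ring_bimodule[OF bimodule_Bm D.bimodule_C])

sublocale Q: ring_bimodule AB R Q by (rule bimodule_Q)

lemmas right_Q = Q.right_module_axioms

lemma f_right: "f \<in> right_hom R Ar Q"
  and \<rho>Q_f: "x \<in> carrier A \<Longrightarrow> \<rho>Q (f x) = tensor_map R Ar D Q D f id (\<rho> x)"
  using f_comodule by (simp_all add: comodule_hom_def)

lemma f_closed: "x \<in> carrier A \<Longrightarrow> f x \<in> carrier Q"
  and f_add: "\<lbrakk>x \<in> carrier A; y \<in> carrier A\<rbrakk> \<Longrightarrow> f (x \<oplus>\<^bsub>A\<^esub> y) = f x \<oplus>\<^bsub>Q\<^esub> f y"
  and f_mult_B: "\<lbrakk>b \<in> B; x \<in> carrier A\<rbrakk> \<Longrightarrow> f (b \<otimes>\<^bsub>A\<^esub> x) = b \<odot>\<^bsub>Q\<^esub> f x"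
  and f_rsmult: "\<lbrakk>x \<in> carrier A; r \<in> carrier R\<rbrakk> \<Longrightarrow> f (x \<otimes>\<^bsub>A\<^esub> \<eta> r) = f x \<odot>\<^sub>r\<^bsub>Q\<^esub> r"
  using add_hom_closed[OF left_hom_add_hom[OF f_left], of x] add_hom_add[OF left_hom_add_hom[OF f_left], of x y]
    left_hom_smult[OF f_left, of b x] right_hom_rsmult[OF f_right, of x r] by simp_all

definition finv where "finv = inv_into (carrier A) f"

lemma finv_closed: "u \<in> carrier Q \<Longrightarrow> finv u \<in> carrier A"
  and f_finv: "u \<in> carrier Q \<Longrightarrow> f (finv u) = u"
  and finv_f: "x \<in> carrier A \<Longrightarrow> finv (f x) = x"
  unfolding finv_def using f_bij
  by (simp_all add: bij_betw_def inv_into_into f_inv_into_f)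

lemma finv_add: "\<lbrakk>u \<in> carrier Q; v \<in> carrier Q\<rbrakk> \<Longrightarrow> finv (u \<oplus>\<^bsub>Q\<^esub> v) = finv u \<oplus>\<^bsub>A\<^esub> finv v"
  using finv_f[of "finv u \<oplus>\<^bsub>A\<^esub> finv v"] by (simp add: finv_closed f_add f_finv)

lemma finv_smult: "\<lbrakk>b \<in> B; u \<in> carrier Q\<rbrakk> \<Longrightarrow> finv (b \<odot>\<^bsub>Q\<^esub> u) = b \<otimes>\<^bsub>A\<^esub> finv u"
  using finv_f[of "b \<otimes>\<^bsub>A\<^esub> finv u"] by (simp add: finv_closed f_mult_B f_finv B_closed)

lemma finv_rsmult: "\<lbrakk>u \<in> carrier Q; r \<in> carrier R\<rbrakk> \<Longrightarrow> finv (u \<odot>\<^sub>r\<^bsub>Q\<^esub> r) = finv u \<otimes>\<^bsub>A\<^esub> \<eta> r"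
  using finv_f[of "finv u \<otimes>\<^bsub>A\<^esub> \<eta> r"] by (simp add: finv_closed f_rsmult f_finv)

lemma finv_right: "finv \<in> right_hom R Q Ar"
  by (rule right_homI) (simp_all add: finv_closed finv_add finv_rsmult)

lemma finv_add_hom: "finv \<in> add_hom Q A"
  by (rule add_homI) (simp_all add: finv_closed finv_add)

text \<open>The inverse of a bijective colinear map is colinear. With u = f(x), colinearity of f
  turns the right side into the sum of \<open>finv\<close> applied to f(x0), tensored with x1, which
  is \<rho>(x).\<close>

lemma \<rho>_finv:
  assumes u: "u \<in> carrier Q"
  shows "\<rho> (finv u) = tensor_map R Q D Ar D finv id (\<rho>Q u)"
proof -
  define x where "x = finv u"
  have x: "x \<in> carrier A" and u': "u = f x"
    by (simp_all add: x_def u finv_closed f_finv)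
  have "tensor_map R Q D Ar D finv id (\<rho>Q u) = tensor_lift R Ar D CR (\<lambda>x d. tens R Ar D (finv (f x)) d) (\<rho> x)"
    unfolding u' \<rho>Q_f[OF x] tensor_map_def[of R Q D Ar]
    by (subst tensor_lift_tensor_map[OF right_Ar D.left_C right_Q D.left_C f_right id_left_hom group_CR
          balanced_tensor_map[OF right_Q D.left_C right_Ar D.left_C finv_right id_left_hom]])
      (simp_all add: x)
  also have "\<dots> = tensor_lift R Ar D CR (tens R Ar D) (\<rho> x)"
    by (intro tensor_lift_apply_cong) (simp add: finv_f)
  also have "\<dots> = \<rho> x"
    by (rule tensor_lift_tens_id[OF right_Ar D.left_C]) (simp add: x)
  finally show ?thesis by (simp add: x_def)
qed

lemma one_B: "\<one>\<^bsub>A\<^esub> \<in> B"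
  by (rule subringE(3)[OF B_subring])

definition j where "j d = finv (tens R Bm D \<one>\<^bsub>A\<^esub> d)"

lemma tens_Q: "\<lbrakk>b \<in> B; d \<in> carrier D\<rbrakk> \<Longrightarrow> tens R Bm D b d \<in> carrier Q"
  using tens_closed[OF right_Bm D.left_C] by simp

lemma finv_tens: "\<lbrakk>b \<in> B; d \<in> carrier D\<rbrakk> \<Longrightarrow> finv (tens R Bm D b d) = b \<otimes>\<^bsub>A\<^esub> j d"
  unfolding j_def
  using finv_smult[of b "tens R Bm D \<one>\<^bsub>A\<^esub> d"] smult_tens[OF bimodule_Bm D.left_C, of b "\<one>\<^bsub>A\<^esub>" d]
  by (simp add: tens_Q one_B B_closed)

lemma j_in: "d \<in> carrier D \<Longrightarrow> j d \<in> carrier A"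
  by (simp add: j_def finv_closed tens_Q one_B)

lemma j_left: "j \<in> left_hom R D Al"
proof (rule left_homI)
  fix r d assume r: "r \<in> carrier R" and d: "d \<in> carrier D"
  have "tens R Bm D \<one>\<^bsub>A\<^esub> (r \<odot>\<^bsub>D\<^esub> d) = tens R Bm D (\<eta> r) d"
    using tens_rsmult[OF right_Bm D.left_C, of "\<one>\<^bsub>A\<^esub>" r d] r d by (simp add: one_B)
  then show "j (r \<odot>\<^bsub>D\<^esub> d) = r \<odot>\<^bsub>Al\<^esub> j d"
    using finv_tens[OF \<eta>_B[OF r] d] by (simp add: j_def)
qed (simp_all add: j_in, simp add: j_def tens_add_right[OF right_Bm D.left_C, simplified] one_B finv_add tens_Q)

text \<open>Sending d to 1 \<otimes> d is colinear by the formula for the cofree coaction, and j is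
  its composite with the colinear map \<open>finv\<close>.\<close>

lemma j_comodule: "j \<in> comodule_hom R D D \<Delta> Ar \<rho>"
proof -
  have t: "tens R Bm D \<one>\<^bsub>A\<^esub> \<in> right_hom R D Q"
    by (rule tens_right_hom[OF right_Bm D.bimodule_C]) (simp add: one_B)
  have j: "j \<in> right_hom R D Ar"
    using t finv_right unfolding j_def by (auto simp: right_hom_def hom_def Pi_iff)
  have "\<rho> (j d) = tensor_map R D D Ar D j id (\<Delta> d)" if d: "d \<in> carrier D" for d
  proof -
    have b: "balanced R D D (tensor R Q D) (\<lambda>d1 d2. tens R Q D (tens R Bm D \<one>\<^bsub>A\<^esub> d1) d2)"
      using balanced3D(2)[OF balanced3_tens_left[OF right_Bm D.bimodule_C D.left_C]] one_B by simp
    have m: "tensor_map R Q D Ar D finv id \<in> add_hom (tensor R Q D) CR"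
      by (rule tensor_map_hom[OF right_Q D.left_C right_Ar D.left_C finv_right id_left_hom])
    have "\<rho>Q (tens R Bm D \<one>\<^bsub>A\<^esub> d) =
        tensor_lift R D D (tensor R Q D) (\<lambda>d1 d2. tens R Q D (tens R Bm D \<one>\<^bsub>A\<^esub> d1) d2) (\<Delta> d)"
      using D.tensor_coaction_tens[OF right_Bm, of "\<one>\<^bsub>A\<^esub>" d] d one_B by simp
    then have "\<rho> (j d) = tensor_map R Q D Ar D finv id
        (tensor_lift R D D (tensor R Q D) (\<lambda>d1 d2. tens R Q D (tens R Bm D \<one>\<^bsub>A\<^esub> d1) d2) (\<Delta> d))"
      unfolding j_def using \<rho>_finv tens_Q one_B d by simp
    also have "\<dots> = tensor_lift R D D CR (\<lambda>d1 d2. tens R Ar D (j d1) (id d2)) (\<Delta> d)"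
      by (rule add_hom_tensor_lift_eq[OF D.right_C D.left_C tensor_abelian_group[OF right_Q D.left_C] group_CR
            b m D.\<Delta>_closed[OF d]])
        (simp add: tensor_map_tens[OF right_Q D.left_C right_Ar D.left_C finv_right id_left_hom] tens_Q one_B j_def)
    finally show ?thesis by (simp add: tensor_map_def)
  qed
  with j show ?thesis by (simp add: comodule_hom_def)
qed

text \<open>The counit of the cofree comodule on B, that is B \<otimes> \<epsilon> with B \<otimes>
  R identified with B.\<close>

definition pe where "pe = tensor_lift R Bm D Bm (\<lambda>b d. b \<odot>\<^sub>r\<^bsub>Bm\<^esub> \<epsilon> d)"

lemmas balanced_pe = D.balanced_counit[OF right_Bm]
lemmas group_Bm = right_module_abelian_group[OF right_Bm]

lemma pe_tens: "\<lbrakk>b \<in> B; d \<in> carrier D\<rbrakk> \<Longrightarrow> pe (tens R Bm D b d) = b \<otimes>\<^bsub>A\<^esub> \<eta> (\<epsilon> d)"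
  unfolding pe_def using tensor_lift_tens[OF right_Bm D.left_C group_Bm balanced_pe] by simp

lemma pe_right: "pe \<in> right_hom R Q Bm"
  unfolding pe_def
  by (rule tensor_lift_right_hom[OF right_Bm D.bimodule_C right_Bm balanced_pe])
    (simp add: D.\<epsilon>_rsmult D.\<epsilon>_closed A.m_assoc B_closed)

lemma pe_left: "pe \<in> left_hom AB Q Bm"
  unfolding pe_def
  by (rule tensor_lift_left_hom[OF bimodule_Bm D.left_C ring_bimodule_left[OF bimodule_Bm] balanced_pe])
    (simp add: D.\<epsilon>_closed A.m_assoc B_closed)

definition pf where "pf x = pe (f x)"

lemma pf_right: "pf \<in> right_hom R Ar Bm"
  using f_right pe_right by (auto simp: pf_def right_hom_def hom_def Pi_iff)

lemma pf_B: "x \<in> carrier A \<Longrightarrow> pf x \<in> B"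
  using add_hom_closed[OF right_hom_add_hom[OF pf_right]] by simp

lemma pf_closed [simp]: "x \<in> carrier A \<Longrightarrow> pf x \<in> carrier A"
  by (rule B_closed[OF pf_B])

lemma pf_add: "\<lbrakk>x \<in> carrier A; y \<in> carrier A\<rbrakk> \<Longrightarrow> pf (x \<oplus>\<^bsub>A\<^esub> y) = pf x \<oplus>\<^bsub>A\<^esub> pf y"
  and pf_rsmult: "\<lbrakk>x \<in> carrier A; r \<in> carrier R\<rbrakk> \<Longrightarrow> pf (x \<otimes>\<^bsub>A\<^esub> \<eta> r) = pf x \<otimes>\<^bsub>A\<^esub> \<eta> r"
  using add_hom_add[OF right_hom_add_hom[OF pf_right], of x y] right_hom_rsmult[OF pf_right, of x r] by simp_all

lemma pf_mult_B: "\<lbrakk>b \<in> B; x \<in> carrier A\<rbrakk> \<Longrightarrow> pf (b \<otimes>\<^bsub>A\<^esub> x) = b \<otimes>\<^bsub>A\<^esub> pf x"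
  using left_hom_smult[OF pe_left, of b "f x"] by (simp add: pf_def f_mult_B f_closed)

lemma pf_j: "d \<in> carrier D \<Longrightarrow> pf (j d) = \<eta> (\<epsilon> d)"
  by (simp add: pf_def j_def f_finv tens_Q one_B pe_tens D.\<epsilon>_closed)

text \<open>Applying the counit to the middle leg of b \<otimes> d1 \<otimes> d2 leaves b \<otimes>
  \<epsilon>(d1) d2, which the left counit law reduces to b \<otimes> d.\<close>

lemma pe_\<rho>Q:
  assumes u: "u \<in> carrier Q"
  shows "tensor_map R Q D Bm D pe id (\<rho>Q u) = u"
proof (rule tensor_hom_eqI[OF right_Bm D.left_C _ _ _ u, where
      h = "\<lambda>u. tensor_map R Q D Bm D pe id (\<rho>Q u)" and k = "\<lambda>u. u"])
  have m: "tensor_map R Q D Bm D pe id \<in> add_hom (tensor R Q D) Q"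
    by (rule tensor_map_hom[OF right_Q D.left_C right_Bm D.left_C pe_right id_left_hom])
  show "(\<lambda>u. tensor_map R Q D Bm D pe id (\<rho>Q u)) \<in> add_hom Q Q"
    by (rule add_hom_comp[OF right_hom_add_hom[OF D.tensor_coaction_right_hom[OF right_Bm]] m])
  fix b d assume b': "b \<in> carrier Bm" and d: "d \<in> carrier D"
  then have b: "b \<in> B" by simp
  have bt: "balanced R D D (tensor R Q D) (\<lambda>d1 d2. tens R Q D (tens R Bm D b d1) d2)"
    by (rule balanced3D(2)[OF balanced3_tens_left[OF right_Bm D.bimodule_C D.left_C] b'])
  have "tensor_map R Q D Bm D pe id (\<rho>Q (tens R Bm D b d)) =
      tensor_lift R D D Q (\<lambda>d1 d2. tens R Bm D b (\<epsilon> d1 \<odot>\<^bsub>D\<^esub> d2)) (\<Delta> d)"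
    unfolding D.tensor_coaction_tens[OF right_Bm b' d]
    using tens_rsmult[OF right_Bm D.left_C b']
    by (intro add_hom_tensor_lift_eq[OF D.right_C D.left_C tensor_abelian_group[OF right_Q D.left_C] group_BD
          bt m D.\<Delta>_closed[OF d]])
      (simp add: tensor_map_tens[OF right_Q D.left_C right_Bm D.left_C pe_right id_left_hom] tens_Q b pe_tens
        D.\<epsilon>_closed)
  also have "\<dots> = tens R Bm D b (tensor_lift R D D D (\<lambda>d1 d2. \<epsilon> d1 \<odot>\<^bsub>D\<^esub> d2) (\<Delta> d))"
    by (rule add_hom_tensor_lift[OF D.right_C D.left_C D.M.abelian_group_axioms group_BD
          D.balanced_counit_left tens_add_hom(1)[OF right_Bm D.left_C b'] D.\<Delta>_closed[OF d], symmetric])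
  finally show "tensor_map R Q D Bm D pe id (\<rho>Q (tens R Bm D b d)) = tens R Bm D b d"
    by (simp add: D.counit_left[OF d])
qed (simp add: hom_def)

text \<open>A colinear map into a cofree comodule is recovered from its composite with the counit of
  that comodule, here \<open>pf\<close>: apply \<open>pe_\<rho>Q\<close> at f(y) and use colinearity
  of f.\<close>

lemma f_eq:
  assumes y: "y \<in> carrier A"
  shows "f y = tensor_lift R Ar D Q (\<lambda>a d. tens R Bm D (pf a) d) (\<rho> y)"
proof -
  have "f y = tensor_map R Q D Bm D pe id (tensor_map R Ar D Q D f id (\<rho> y))"
    using pe_\<rho>Q[OF f_closed[OF y]] \<rho>Q_f[OF y] by simp
  also have "\<dots> = tensor_lift R Ar D Q (\<lambda>a d. tens R Bm D (pf a) d) (\<rho> y)"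
    unfolding tensor_map_def[of R Q D Bm] pf_def
    by (subst tensor_lift_tensor_map[OF right_Ar D.left_C right_Q D.left_C f_right id_left_hom group_BD
          balanced_tensor_map[OF right_Q D.left_C right_Bm D.left_C pe_right id_left_hom]])
      (simp_all add: y)
  finally show ?thesis .
qed

text \<open>Apply \<open>finv\<close> to the formula for f(y); it sends b \<otimes> d to b
  j(d).\<close>

lemma pf_j_\<rho>:
  assumes y: "y \<in> carrier A"
  shows "tensor_lift R Ar D A (\<lambda>a d. pf a \<otimes>\<^bsub>A\<^esub> j d) (\<rho> y) = y"
proof -
  have b: "balanced R Ar D Q (\<lambda>a d. tens R Bm D (pf a) d)"
    using balanced_tensor_map[OF right_Ar D.left_C right_Bm D.left_C pf_right id_left_hom] by simp
  have "finv (f y) = tensor_lift R Ar D A (\<lambda>a d. pf a \<otimes>\<^bsub>A\<^esub> j d) (\<rho> y)"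
    unfolding f_eq[OF y]
    by (rule add_hom_tensor_lift_eq[OF right_Ar D.left_C group_BD group_A b finv_add_hom])
      (simp_all add: y finv_tens pf_B)
  then show ?thesis by (simp add: finv_f y)
qed

text \<open>Left B-linearity of f passes to \<open>pf\<close>, and this is what makes the assignment
  of a \<open>pf x\<close> to a \<rho>(x) well defined.\<close>

lemma balanced_mult_pf: "balanced AB AA AA A (\<lambda>a x. a \<otimes>\<^bsub>A\<^esub> pf x)"
  by (rule balancedI) (simp_all add: A.l_distr A.r_distr pf_add pf_mult_B B_closed A.m_assoc)

definition jt_one where "jt_one c = tensor_lift AB AA AA A (\<lambda>a x. a \<otimes>\<^bsub>A\<^esub> pf x) (cani c)"

lemma jt_one_gen: "\<lbrakk>a \<in> carrier A; x \<in> carrier A\<rbrakk> \<Longrightarrow> jt_one (a \<odot>\<^bsub>CR\<^esub> \<rho> x) = a \<otimes>\<^bsub>A\<^esub> pf x"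
  unfolding jt_one_def using tensor_lift_tens[OF right_AA left_AA group_A balanced_mult_pf]
  by (simp add: cani_smult_\<rho>)

lemma jt_one_left: "jt_one \<in> left_hom A CR AA"
proof -
  have "tensor_lift AB AA AA AA (\<lambda>a x. a \<otimes>\<^bsub>A\<^esub> pf x) \<in> left_hom A AAB AA"
    using balanced_mult_pf
    by (intro tensor_lift_left_hom[OF bimodule_AA_left left_AA ring_bimodule_left[OF bimodule_AA]])
      (simp_all add: balanced_def A.m_assoc)
  then show ?thesis
    using cani_left_hom by (auto simp: left_hom_def hom_def Pi_iff jt_one_def tensor_lift_ring_bimod)
qed

lemma jt_one_rsmult:
  assumes c: "c \<in> carrier CR" and r: "r \<in> carrier R"
  shows "jt_one (c \<odot>\<^sub>r\<^bsub>CR\<^esub> r) = jt_one c \<otimes>\<^bsub>A\<^esub> \<eta> r"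
proof -
  have jt_one: "jt_one \<in> add_hom CR A"
    using left_hom_add_hom[OF jt_one_left] by (simp add: hom_def)
  have "(\<lambda>x. x \<otimes>\<^bsub>A\<^esub> \<eta> r) \<in> add_hom A A"
    by (rule add_homI) (simp_all add: r A.l_distr)
  then show ?thesis
    by (intro CR_hom_eqI[OF add_hom_comp[OF right_module_rsmult_hom[OF right_CR r] jt_one] add_hom_comp[OF jt_one] _ c])
      (simp_all add: r CR.smult_rsmult \<rho>_rsmult[symmetric] jt_one_gen pf_rsmult A.m_assoc)
qed

sublocale cleft_maps K R A \<eta> D \<Delta> \<epsilon> \<rho> act j jt_one
  by (intro cleft_maps.intro cleft_maps_axioms.intro grouplike_action_axioms coring_subring_axioms
      j_left jt_one_left jt_one_rsmult)

lemma jt_one_\<rho>: "x \<in> carrier A \<Longrightarrow> jt_one (\<rho> x) = pf x"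
  using jt_one_gen[of "\<one>\<^bsub>A\<^esub>" x] by (simp add: CR.lsmult_one)

definition jt where "jt c = (\<lambda>x\<in>carrier A. jt_one c \<otimes>\<^bsub>A\<^esub> x)"

lemma jt_left: "jt \<in> left_hom A CR H"
  by (rule left_homI) (simp_all add: jt_def mult_in_H H_add H_smult jt_one_add jt_one_smult)

lemma jt_right: "jt \<in> right_hom R CR H"
  by (rule right_homI) (simp_all add: jt_def mult_in_H H_add H_rsmult jt_one_add jt_one_rsmult)

text \<open>At c = a \<rho>(y) the left side is a \<rho>(1) acted on by \<open>pf y\<close> times x,
  that is a \<rho>(\<open>pf y\<close> x). Since \<open>pf y\<close> is coinvariant it comes out of
  \<rho>, which leaves j'(c) \<rho>(x), the value of the right side.\<close>

lemma jt_coact: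
  assumes c: "c \<in> carrier CR" and x: "x \<in> carrier A"
  shows "tensor_lift A C C C (\<lambda>c1 c2. c1 \<odot>\<^sub>r\<^bsub>C\<^esub> jt c2 x) (\<Delta>C c) =
    tensor_lift A Al C C (\<lambda>x0 x1. jt c x0 \<odot>\<^bsub>C\<^esub> x1) (\<rho>C x)"
proof -
  have b: "balanced A C C C (\<lambda>c1 c2. c1 \<odot>\<^sub>r\<^bsub>C\<^esub> jt c2 x)"
    by (rule balancedI) (simp_all add: jt_def x act_closed act_add_left act_add_right jt_one_add jt_one_smult
        A.l_distr A.m_assoc act_mult CR.lsmult_closed)
  have h: "tensor_lift A C C C (\<lambda>c1 c2. c1 \<odot>\<^sub>r\<^bsub>C\<^esub> jt c2 x) \<in> add_hom CC CR"
    using tensor_lift_hom[OF right_C left_C group_C b] by (simp add: hom_def)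
  have k: "(\<lambda>c. jt_one c \<odot>\<^bsub>CR\<^esub> \<rho> x) \<in> add_hom CR CR"
    by (rule add_homI) (simp_all add: x CR.lsmult_closed CR.lsmult_l_distr jt_one_add)
  have b': "balanced A Al C C (\<lambda>x0 x1. jt c x0 \<odot>\<^bsub>C\<^esub> x1)"
    by (rule balancedI) (simp_all add: jt_def c CR.lsmult_closed CR.lsmult_l_distr CR.lsmult_r_distr
        A.r_distr CR.lsmult_assoc)
  have "tensor_lift A C C C (\<lambda>c1 c2. c1 \<odot>\<^sub>r\<^bsub>C\<^esub> jt c2 x) (\<Delta>C c) = jt_one c \<odot>\<^bsub>CR\<^esub> \<rho> x"
  proof (rule CR_hom_eqI[OF add_hom_comp[OF \<Delta>C_add_hom h] k _ c])
    fix a y assume a: "a \<in> carrier A" and y: "y \<in> carrier A"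
    show "tensor_lift A C C C (\<lambda>c1 c2. c1 \<odot>\<^sub>r\<^bsub>C\<^esub> jt c2 x) (\<Delta>C (a \<odot>\<^bsub>CR\<^esub> \<rho> y)) =
        jt_one (a \<odot>\<^bsub>CR\<^esub> \<rho> y) \<odot>\<^bsub>CR\<^esub> \<rho> x"
      using tensor_lift_tens[OF right_C left_C group_C b, of "a \<odot>\<^bsub>CR\<^esub> \<rho> \<one>\<^bsub>A\<^esub>" "\<rho> y"] a x y
      by (simp add: \<Delta>C_gen CR.lsmult_closed jt_def act_gen jt_one_\<rho> jt_one_gen B_\<rho>[OF pf_B] CR.lsmult_assoc)
  qed
  also have "\<dots> = tensor_lift A Al C C (\<lambda>x0 x1. jt c x0 \<odot>\<^bsub>C\<^esub> x1) (\<rho>C x)"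
    using tensor_lift_tens[OF right_Al left_C group_C b', of "\<one>\<^bsub>A\<^esub>" "\<rho> x"] x c
    by (simp add: coaction_A_def jt_def)
  finally show ?thesis .
qed

text \<open>Left multiplication by a coinvariant element is colinear, and \<eta>(\<epsilon>(d)) is
  one.\<close>

lemma \<eta>\<epsilon>_endo:
  assumes d: "d \<in> carrier D"
  shows "(\<lambda>x\<in>carrier A. \<eta> (\<epsilon> d) \<otimes>\<^bsub>A\<^esub> x) \<in> comodule_hom A C Al \<rho>C Al \<rho>C"
proof -
  let ?h = "\<lambda>x\<in>carrier A. \<eta> (\<epsilon> d) \<otimes>\<^bsub>A\<^esub> x"
  have e: "\<epsilon> d \<in> carrier R" by (rule D.\<epsilon>_closed[OF d])
  have h: "?h \<in> right_hom A Al Al"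
    by (rule right_homI) (simp_all add: e A.r_distr A.m_assoc)
  have "\<rho>C (?h x) = tensor_map A Al C Al C ?h id (\<rho>C x)" if x: "x \<in> carrier A" for x
    using tensor_map_tens[OF right_Al left_C right_Al left_C h id_left_hom, of "\<one>\<^bsub>A\<^esub>" "\<rho> x"] x e
    by (simp add: coaction_A_def B_\<rho>[OF \<eta>_B] tens_Al_smult[of "\<eta> (\<epsilon> d)"])
  with h show ?thesis by (simp add: comodule_hom_def)
qed

text \<open>The coaction of j(d) is 1 \<otimes> \<rho>(j(d)), so this is \<open>pf_j\<close>
  expressed through left multiplications.\<close>

lemma jt_j:
  assumes d: "d \<in> carrier D"
  shows "tensor_lift A Al C H (\<lambda>y0 y1. y0 \<odot>\<^bsub>H\<^esub> jt y1) (\<rho>C (j d)) = (\<lambda>x\<in>carrier A. \<eta> (\<epsilon> d) \<otimes>\<^bsub>A\<^esub> x)"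
proof -
  have b: "balanced A Al C H (\<lambda>y0 y1. y0 \<odot>\<^bsub>H\<^esub> jt y1)"
    by (rule balancedI)
      (simp_all add: jt_def H_smult H_add mult_in_H jt_one_add jt_one_smult A.l_distr A.r_distr A.m_assoc)
  show ?thesis
    using tensor_lift_tens[OF right_Al left_C group_H b, of "\<one>\<^bsub>A\<^esub>" "\<rho> (j d)"] d
    by (simp add: coaction_A_def jt_def H_smult jt_one_\<rho> pf_j D.\<epsilon>_closed)
qed

lemma q_\<rho>: "y \<in> carrier A \<Longrightarrow> q (\<rho> y) = y"
  unfolding q_def
  using tensor_lift_coaction_\<rho>[OF group_A balanced_jt_one_j, of y] pf_j_\<rho>[of y]
    tensor_lift_cong[of Ar D "\<lambda>a d. jt_one (\<rho> a) \<otimes>\<^bsub>A\<^esub> j d" "\<lambda>a d. pf a \<otimes>\<^bsub>A\<^esub> j d" R A]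
  by (simp add: jt_one_\<rho>)

text \<open>At c = a \<rho>(y) the left side is a \<rho>(1) acted on by q(\<rho>(y)) = y, which is a
  \<rho>(y).\<close>

lemma jt_j_coact:
  assumes c: "c \<in> carrier CR"
  shows "tensor_lift A C C C
        (\<lambda>c1 c2. c1 \<odot>\<^sub>r\<^bsub>C\<^esub>
          tensor_lift R CR D A (\<lambda>c0 d. jt c0 (j d)) (coaction_AD R A \<eta> D \<Delta> c2)) (\<Delta>C c) = c"
proof -
  have "tensor_lift R CR D A (\<lambda>c0 d. jt c0 (j d)) = tensor_lift R CR D A (\<lambda>c0 d. jt_one c0 \<otimes>\<^bsub>A\<^esub> j d)"
    by (rule tensor_lift_cong) (simp add: jt_def)
  then have *: "tensor_lift A C C C (\<lambda>c1 c2. c1 \<odot>\<^sub>r\<^bsub>C\<^esub>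
      tensor_lift R CR D A (\<lambda>c0 d. jt c0 (j d)) (coaction_AD R A \<eta> D \<Delta> c2)) =
      tensor_lift A C C CR (\<lambda>c1 c2. act c1 (q c2))"
    by (simp add: q_def[symmetric] tensor_lift_target[of C CR] fun_eq_iff)
  have h: "tensor_lift A C C CR (\<lambda>c1 c2. act c1 (q c2)) \<in> add_hom CC CR"
    by (rule tensor_lift_hom[OF right_C left_C group_CR balanced_act_q])
  show ?thesis
    unfolding *
  proof (rule CR_hom_eqI[OF add_hom_comp[OF \<Delta>C_add_hom h] _ _ c, where k = "\<lambda>c. c"])
    fix a y assume a: "a \<in> carrier A" and y: "y \<in> carrier A"
    show "tensor_lift A C C CR (\<lambda>c1 c2. act c1 (q c2)) (\<Delta>C (a \<odot>\<^bsub>CR\<^esub> \<rho> y)) = a \<odot>\<^bsub>CR\<^esub> \<rho> y"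
      using tensor_lift_tens[OF right_C left_C group_CR balanced_act_q, of "a \<odot>\<^bsub>CR\<^esub> \<rho> \<one>\<^bsub>A\<^esub>" "\<rho> y"] a y
      by (simp add: \<Delta>C_gen CR.lsmult_closed act_gen q_\<rho>)
  qed (simp add: hom_def)
qed

lemma cleft_bicomodule: "cleft_bicomodule R A \<eta> D \<Delta> \<epsilon> \<rho> act"
  unfolding cleft_bicomodule_def Let_def tensor_AD_def
proof (intro conjI exI[of _ j] exI[of _ jt] ballI)
  fix c assume "c \<in> carrier C"
  then have c: "c \<in> carrier CR" by simp
  show "tensor_lift A C C C (\<lambda>c1 c2. c1 \<odot>\<^sub>r\<^bsub>C\<^esub> jt c2 x) (\<Delta>C c) =
    tensor_lift A Al C C (\<lambda>x0 x1. jt c x0 \<odot>\<^bsub>C\<^esub> x1) (\<rho>C x)" if "x \<in> carrier A" for x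
    by (rule jt_coact[OF c that])
  show "tensor_lift A C C C
      (\<lambda>c1 c2. c1 \<odot>\<^sub>r\<^bsub>C\<^esub>
        tensor_lift R CR D A (\<lambda>c0 d. jt c0 (j d)) (coaction_AD R A \<eta> D \<Delta> c2)) (\<Delta>C c) = c"
    by (rule jt_j_coact[OF c])
qed (simp_all only: comodule_\<rho>C \<rho>C_left_hom j_left j_comodule jt_left jt_right \<eta>\<epsilon>_endo jt_j Int_iff simp_thms)

end

section \<open>The converse implication and the equivalence\<close>

context coring_ext
begin

theorem galois_normal_basis_imp_cleft:
  assumes "coring_extension K R A \<eta> D \<Delta> \<epsilon> \<rho> B" "galois_extension R A \<eta> D \<rho> B"
    and nb: "normal_basis_property K R A \<eta> D \<Delta> \<rho> B"
  shows "cleft_extension K R A \<eta> D \<Delta> \<epsilon> \<rho> B"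
proof -
  obtain f where f: "bij_betw f (carrier A) (carrier (tensor R (ring_bimod AB id \<eta>) D)) \<and>
      f \<in> left_hom AB Ar (tensor R (ring_bimod AB id \<eta>) D) \<and>
      f \<in> comodule_hom R D Ar \<rho> (tensor R (ring_bimod AB id \<eta>) D)
        (tensor_coaction R (ring_bimod AB id \<eta>) D \<Delta>)"
    using nb unfolding normal_basis_property_def Let_def by blast
  have "\<eta> r \<in> B" if "r \<in> carrier R" for r
    using nb that by (auto simp: normal_basis_property_def subring_over_def)
  then interpret galois_normal_basis K R A \<eta> D \<Delta> \<epsilon> \<rho> f
    by (intro galois_normal_basis.intro galois_coring_ext.intro coring_subring.intro coring_ext_axioms
        coring_subring_axioms.intro galois_coring_ext_axioms.intro galois_normal_basis_axioms.intro
        assms(2)[unfolded galois_iff] f[THEN conjunct1] f[THEN conjunct2, THEN conjunct1]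
        f[THEN conjunct2, THEN conjunct2])
  show ?thesis
    using assms(1) cleft_coring cleft_bicomodule by (auto simp: cleft_extension_def)
qed

end

theorem theorem3p17:
  fixes K :: "'k ring" and R :: "('k, 'r) module" and A :: "('k, 'a) module" and \<eta> :: "'r \<Rightarrow> 'a"
    and D :: "('r, 'd, 'r) bimod" and \<Delta> :: "'d \<Rightarrow> ('d \<times> 'd \<Rightarrow>\<^sub>0 int) set" and \<epsilon> :: "'d \<Rightarrow> 'r"
    and \<rho> :: "'a \<Rightarrow> ('a \<times> 'd \<Rightarrow>\<^sub>0 int) set" and B :: "'a set"
  assumes "coring K R D \<Delta> \<epsilon>"
    and "coring_extension K R A \<eta> D \<Delta> \<epsilon> \<rho> B"
  shows "cleft_extension K R A \<eta> D \<Delta> \<epsilon> \<rho> B \<longleftrightarrow>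
    galois_extension R A \<eta> D \<rho> B \<and> normal_basis_property K R A \<eta> D \<Delta> \<rho> B"
proof -
  interpret coring_ext K R A \<eta> D \<Delta> \<epsilon> \<rho>
    using assms by (simp add: coring_ext_def coring_locale_def coring_ext_axioms_def coring_extension_def)
  have "B = coinvariants R A \<eta> D \<rho>"
    using assms(2) by (simp add: coring_extension_def)
  then show ?thesis
    using cleft_imp_galois_normal_basis galois_normal_basis_imp_cleft assms(2) by blast
qed

end
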